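(* Let $B:M_0\to M_0$ be the open billiard map in $\mathbb{R}^n$, $n\ge 3$, for obstacles $K_1,\dots,K_{z_0}$, let $\mu$ be an ergodic shift-invariant Borel probability measure on $\Sigma$, and let $\lambda_1$ be the largest Lyapunov exponent of $B$ with respect to $\mu$. For $\mu$-almost every $\xi\in\Sigma$, let $x_0=(q_0,v_0)=R^{-1}(\xi)\in M_0$, and let $X=\{q(s):s\in[0,a]\}$ be a $\mathcal{C}^3$ curve in the unstable front $\widetilde X$ of $x_0$, with $q(0)=q_0+rv_0$, whose initial velocity $\dot q(0)$ corresponds to a vector $w\in E^u(x_0)\setminus\big(E^u_2(x_0)\oplus\dots\oplus E^u_k(x_0)\big)$. Let $d_i(0)$ and $\ell_i(0)$, $i\ge 1$, be the associated distances and the associated numbers $\ell_i$ at $s=0$. Then $$\lambda_1=\lim_{m\to\infty}\frac1m\sum_{i=1}^{m}\log\big(1+d_i(0)\,\ell_i(0)\big).$$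
   Context: Open billiard. $K_1,\dots,K_{z_0}\subset\mathbb{R}^n$ are strictly convex, pairwise disjoint, compact sets with smooth boundaries such that for distinct $i,j,k$ the convex hull of $K_i\cup K_k$ does not meet $K_j$; $K=\bigcup_iK_i$, and $\nu(q)$ is the outward unit normal at $q\in\partial K$. The billiard map sends $(q,v)$ ($q\in\partial K$, $v\in\mathbb{S}^{n-1}$, $\langle\nu(q),v\rangle\ge0$) to $(q_1,v_1)$, where $q_1=q+tv$ is the next point of $\partial K$ on the ray and $v_1=v-2\langle v,\nu(q_1)\rangle\nu(q_1)$. $M_0$ is the set of those $(q,v)$ for which all forward and backward reflection times $t_j$, $j\in\mathbb{Z}$, are finite, and $B$ is the billiard map on it. $\Phi_t$ denotes the billiard flow (unit speed motion with specular reflections) on pairs (position, velocity) in the exterior of $K$. Coding and exponents. $\Sigma=\{\xi\in\{1,\dots,z_0\}^{\mathbb{Z}}:\xi_i\ne\xi_{i+1}\ \forall i\}$ with the two-sided shift; $R:M_0\to\Sigma$ is the homeomorphism assigning to $x$ the sequence of indices of the obstacles hit by $B^j(x)$, $j\in\mathbb{Z}$; it conjugates $B$ to the shift. By the Oseledets theorem there are numbers $\lambda_1>\dots>\lambda_k>0>-\lambda_k>\dots>-\lambda_1$ and, for $\mu$-almost every $\xi$, with $x=R^{-1}(\xi)$, a decomposition of the unstable space $E^u(x)=E^u_1(x)\oplus\dots\oplus E^u_k(x)$ such that $\lim_m\frac1m\log\|D_xB^m(w)\|=\lambda_j$ for $w\in E^u_j(x)\oplus\dots\oplus E^u_k(x)$,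 $w\notin E^u_{j+1}(x)\oplus\dots\oplus E^u_k(x)$. The largest Lyapunov exponent is $\lambda_1$. Unstable front. For small $r>0$ put $y_0=(q_0+rv_0,v_0)$. The local unstable manifold of the flow at $y_0$ (points $y$ with $d(\Phi_t y,\Phi_t y_0)\le\epsilon$ for all $t\le0$ and $d(\Phi_ty,\Phi_ty_0)\to0$ as $t\to-\infty$) has the form $\{(p,n_{\widetilde X}(p)):p\in\widetilde X\}$, where $\widetilde X$ is a smooth hypersurface through $q_0+rv_0$, strictly convex with respect to the unit normal field $n_{\widetilde X}$; $\widetilde X$ is called here the unstable front of $x_0$. It is in natural one-to-one smooth correspondence (moving along trajectories) with the local unstable manifold $W^u_\epsilon(x_0)$ of $B$, and this correspondence identifies $E^u(x_0)=T_{x_0}W^u_\epsilon(x_0)$ with the tangent space $T_{q(0)}\widetilde X$. The numbers $d_j,\ell_j$. For the trajectory issued from $(q(s),n_{\widetilde X}(q(s)))$ let $q_j(s)$, $j\ge1$, be its successive forward reflection points and $t_j(s)$ their times, and put $d_j(s)=\|q_{j+1}(s)-q_j(s)\|$. For each fixed $m$, $a$ is taken small enough that for each $j\le m$ all $q_j(s)$ lie on the same obstacle. Let $\mathcal{K}_j(s)$ be the curvature operator (second fundamental form operator, with respect to the propagation direction) at $q_j(s)$ of the front obtained from $\widetilde X$ under the flow immediately after the $j$-th reflection, i.e. of the limit as $t\searrow t_j(s)$ of the projections to $\mathbb{R}^n$ of $\Phi_t\{(p,n_{\widetilde X}(p)):p\in\widetilde X\}$. Let $\hat w_j(s)$ be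 the unit tangent direction at $q_j(s)$, immediately after the $j$-th reflection, of the propagated curve obtained from $X$ (the limit as $t\searrow t_j(s)$ of the normalised $s$-derivative of the position at time $t$), and let $k_j(s)=\langle\mathcal{K}_j(s)\hat w_j(s),\hat w_j(s)\rangle$ be the normal curvature in that direction. Then $\ell_j(s)>0$ is defined by $$\big(1+d_j(s)\ell_j(s)\big)^2=1+2d_j(s)k_j(s)+d_j(s)^2\,\|\mathcal{K}_j(s)\hat w_j(s)\|^2 .$$ *)

theory Defs
  imports "HOL-Probability.Probability"
begin

section \<open>Smooth functions, curves and hypersurfaces\<close>

text \<open>Meant for open \<open>U\<close>; in finite dimension, continuity of all iterated directional
  derivatives is continuity of the higher derivatives.\<close>

primrec Ck_on :: "nat \<Rightarrow> ('a::euclidean_space \<Rightarrow> 'b::real_normed_vector) \<Rightarrow> 'a set \<Rightarrow> bool" where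
  "Ck_on 0 f U \<longleftrightarrow> continuous_on U f"
| "Ck_on (Suc k) f U \<longleftrightarrow> (\<forall>x\<in>U. f differentiable (at x)) \<and>
     (\<forall>h. Ck_on k (\<lambda>x. frechet_derivative f (at x) h) U)"

definition smooth_on :: "('a::euclidean_space \<Rightarrow> 'b::real_normed_vector) \<Rightarrow> 'a set \<Rightarrow> bool" where
  "smooth_on f U \<longleftrightarrow> (\<forall>k. Ck_on k f U)"

text \<open>Curves on a closed interval \<open>I\<close>, with one-sided derivatives at the end points.\<close>

primrec Ck_curve :: "nat \<Rightarrow> real set \<Rightarrow> (real \<Rightarrow> 'a::real_normed_vector) \<Rightarrow> bool" where
  "Ck_curve 0 I q \<longleftrightarrow> continuous_on I q"
| "Ck_curve (Suc k) I q \<longleftrightarrow> (\<forall>s\<in>I. q differentiable (at s within I)) \<and>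
     Ck_curve k I (\<lambda>s. vector_derivative q (at s within I))"

definition submersion_on :: "('a::euclidean_space \<Rightarrow> real) \<Rightarrow> ('a \<Rightarrow> 'a) \<Rightarrow> 'a set \<Rightarrow> bool" where
  "submersion_on f g U \<longleftrightarrow> open U \<and> smooth_on f U \<and> (\<forall>x\<in>U. GDERIV f x :> g x \<and> g x \<noteq> 0)"

definition defining_function ::
    "'a::euclidean_space set \<Rightarrow> 'a \<Rightarrow> ('a \<Rightarrow> real) \<Rightarrow> ('a \<Rightarrow> 'a) \<Rightarrow> 'a set \<Rightarrow> bool" where
  "defining_function S p f g U \<longleftrightarrow>
     p \<in> U \<and> submersion_on f g U \<and> S \<inter> U = {x\<in>U. f x \<le> 0}"

definition smooth_boundary :: "'a::euclidean_space set \<Rightarrow> bool" where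
  "smooth_boundary S \<longleftrightarrow> (\<forall>p\<in>frontier S. \<exists>f g U. defining_function S p f g U)"

definition outward_normal :: "'a::euclidean_space set \<Rightarrow> 'a \<Rightarrow> 'a" where
  "outward_normal S p = (THE u. \<exists>f g U. defining_function S p f g U \<and> u = sgn (g p))"

text \<open>\<open>Z\<close> is a smooth hypersurface (without boundary, not necessarily closed) and \<open>n\<close> is a smooth
  unit normal field on it.\<close>

definition oriented_hypersurface :: "'a::euclidean_space set \<Rightarrow> ('a \<Rightarrow> 'a) \<Rightarrow> bool" where
  "oriented_hypersurface Z n \<longleftrightarrow> (\<forall>p\<in>Z. \<exists>f g U. p \<in> U \<and> submersion_on f g U \<and>
     Z \<inter> U = {x\<in>U. f x = 0} \<and> (\<forall>x\<in>Z \<inter> U. n x = sgn (g x)))"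

text \<open>A cooriented hypersurface is given by the set \<open>F\<close> of its pairs (point, unit normal).  Its
  curvature operator at a point is the differential of the unit normal field \<open>N\<close>, so that
  diverging fronts have positive curvature.  Only the values of \<open>S\<close> on the tangent space are
  determined.\<close>

definition curvature_operator ::
    "('a::euclidean_space \<times> 'a) set \<Rightarrow> 'a \<Rightarrow> ('a \<Rightarrow> 'a) \<Rightarrow> bool" where
  "curvature_operator F p S \<longleftrightarrow>
     (\<exists>N. (\<forall>(p', v)\<in>F. N p' = v) \<and> (N has_derivative S) (at p within fst ` F))"

definition with_normal :: "('a \<Rightarrow> 'a) \<Rightarrow> 'a \<Rightarrow> 'a \<times> 'a" where
  "with_normal n p = (p, n p)"

definition strictly_convex_hypersurface :: "'a::euclidean_space set \<Rightarrow> ('a \<Rightarrow> 'a) \<Rightarrow> bool" where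
  "strictly_convex_hypersurface Z n \<longleftrightarrow> (\<forall>p\<in>Z. \<exists>S. curvature_operator (with_normal n ` Z) p S \<and>
     (\<forall>u. u \<noteq> 0 \<and> u \<bullet> n p = 0 \<longrightarrow> S u \<bullet> u > 0))"

definition tangent_space :: "'a::real_normed_vector set \<Rightarrow> 'a \<Rightarrow> 'a set" where
  "tangent_space S x = {w. \<exists>\<gamma>. \<gamma> 0 = x \<and> (\<forall>\<^sub>F t in nhds (0::real). \<gamma> t \<in> S) \<and>
     (\<gamma> has_vector_derivative w) (at 0)}"


section \<open>Obstacles and the billiard map\<close>

definition strictly_convex_set :: "'a::euclidean_space set \<Rightarrow> bool" where
  "strictly_convex_set S \<longleftrightarrow>
     (\<forall>x\<in>S. \<forall>y\<in>S. x \<noteq> y \<longrightarrow> open_segment x y \<subseteq> interior S)"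

definition open_billiard :: "(nat \<Rightarrow> 'a::euclidean_space set) \<Rightarrow> nat \<Rightarrow> bool" where
  "open_billiard K z \<longleftrightarrow>
     (\<forall>i\<in>{1..z}. K i \<noteq> {} \<and> compact (K i) \<and> strictly_convex_set (K i) \<and> smooth_boundary (K i)) \<and>
     (\<forall>i\<in>{1..z}. \<forall>j\<in>{1..z}. i \<noteq> j \<longrightarrow> K i \<inter> K j = {}) \<and>
     (\<forall>i\<in>{1..z}. \<forall>j\<in>{1..z}. \<forall>k\<in>{1..z}. i \<noteq> j \<and> j \<noteq> k \<and> i \<noteq> k \<longrightarrow>
        convex hull (K i \<union> K k) \<inter> K j = {})"

definition obstacles :: "(nat \<Rightarrow> 'a set) \<Rightarrow> nat \<Rightarrow> 'a set" where
  "obstacles K z = (\<Union>i\<in>{1..z}. K i)"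

text \<open>From here on \<open>Q\<close> is the union of all obstacles.  The map \<open>billiard Q\<close> is the billiard map on
  the states of \<open>boundary_states Q\<close> whose trajectory returns; the same formula, applied to a state
  in the exterior of \<open>Q\<close>, gives the next reflection point and the velocity after the reflection.\<close>

definition hit_times :: "'a::euclidean_space set \<Rightarrow> 'a \<times> 'a \<Rightarrow> real set" where
  "hit_times Q y = {t. 0 < t \<and> fst y + t *\<^sub>R snd y \<in> frontier Q}"

definition flight_time :: "'a::euclidean_space set \<Rightarrow> 'a \<times> 'a \<Rightarrow> real" where
  "flight_time Q y = Inf (hit_times Q y)"

definition reflected :: "'a::euclidean_space set \<Rightarrow> 'a \<Rightarrow> 'a \<Rightarrow> 'a" where
  "reflected Q q v = v - (2 * (v \<bullet> outward_normal Q q)) *\<^sub>R outward_normal Q q"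

definition billiard :: "'a::euclidean_space set \<Rightarrow> 'a \<times> 'a \<Rightarrow> 'a \<times> 'a" where
  "billiard Q y = (let q = fst y + flight_time Q y *\<^sub>R snd y in (q, reflected Q q (snd y)))"

definition boundary_states :: "'a::euclidean_space set \<Rightarrow> ('a \<times> 'a) set" where
  "boundary_states Q =
     {(q, v). q \<in> frontier Q \<and> norm v = 1 \<and> 0 \<le> outward_normal Q q \<bullet> v}"

text \<open>Time reversal; at the boundary the reversed incoming velocity is again an outgoing one.\<close>

definition reversal :: "'a::euclidean_space set \<Rightarrow> 'a \<times> 'a \<Rightarrow> 'a \<times> 'a" where
  "reversal Q y =
     (fst y, - (if fst y \<in> frontier Q then reflected Q (fst y) (snd y) else snd y))"

definition M0 :: "'a::euclidean_space set \<Rightarrow> ('a \<times> 'a) set" where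
  "M0 Q = {x \<in> boundary_states Q. \<forall>m. hit_times Q ((billiard Q ^^ m) x) \<noteq> {} \<and>
     hit_times Q ((billiard Q ^^ m) (reversal Q x)) \<noteq> {}}"

definition billiard_iter :: "'a::euclidean_space set \<Rightarrow> int \<Rightarrow> 'a \<times> 'a \<Rightarrow> 'a \<times> 'a" where
  "billiard_iter Q j x = (if 0 \<le> j then (billiard Q ^^ nat j) x
     else reversal Q ((billiard Q ^^ nat (- j)) (reversal Q x)))"

text \<open>The set \<open>M0 Q\<close> is not open in the phase manifold, so the differential of \<open>B^m\<close> is taken within
  \<open>boundary_states Q\<close>.  It is determined on vectors \<open>w\<close> tangent to that manifold.\<close>

definition billiard_deriv ::
    "'a::euclidean_space set \<Rightarrow> nat \<Rightarrow> 'a \<times> 'a \<Rightarrow> 'a \<times> 'a \<Rightarrow> 'a \<times> 'a" where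
  "billiard_deriv Q m x w = frechet_derivative (billiard Q ^^ m) (at x within boundary_states Q) w"

definition local_unstable_map ::
    "'a::euclidean_space set \<Rightarrow> real \<Rightarrow> 'a \<times> 'a \<Rightarrow> ('a \<times> 'a) set" where
  "local_unstable_map Q \<epsilon> x = {y \<in> boundary_states Q.
     (\<forall>m. hit_times Q ((billiard Q ^^ m) (reversal Q y)) \<noteq> {}) \<and>
     (\<forall>m. dist (billiard_iter Q (- int m) y) (billiard_iter Q (- int m) x) \<le> \<epsilon>) \<and>
     (\<lambda>m. dist (billiard_iter Q (- int m) y) (billiard_iter Q (- int m) x)) \<longlonglongrightarrow> 0}"

text \<open>The tangent space of the local unstable manifold does not depend on its size for small
  \<open>\<epsilon>\<close>; the intersection expresses this.\<close>

definition unstable_space :: "'a::euclidean_space set \<Rightarrow> 'a \<times> 'a \<Rightarrow> ('a \<times> 'a) set" where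
  "unstable_space Q x = (\<Inter>\<epsilon>\<in>{0<..}. tangent_space (local_unstable_map Q \<epsilon> x) x)"


section \<open>Coding and Lyapunov exponents\<close>

definition admissible :: "nat \<Rightarrow> (int \<Rightarrow> nat) set" where
  "admissible z = {\<xi>. \<forall>j. \<xi> j \<in> {1..z} \<and> \<xi> j \<noteq> \<xi> (j + 1)}"

definition shift :: "(int \<Rightarrow> nat) \<Rightarrow> int \<Rightarrow> nat" where
  "shift \<xi> = (\<lambda>j. \<xi> (j + 1))"

definition ergodic_shift_measure :: "nat \<Rightarrow> (int \<Rightarrow> nat) measure \<Rightarrow> bool" where
  "ergodic_shift_measure z \<mu> \<longleftrightarrow>
     prob_space \<mu> \<and> sets \<mu> = sets (restrict_space borel (admissible z)) \<and>
     distr \<mu> \<mu> shift = \<mu> \<and>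
     (\<forall>A\<in>sets \<mu>. shift -` A \<inter> space \<mu> = A \<longrightarrow> measure \<mu> A = 0 \<or> measure \<mu> A = 1)"

definition coding :: "(nat \<Rightarrow> 'a::euclidean_space set) \<Rightarrow> nat \<Rightarrow> 'a \<times> 'a \<Rightarrow> int \<Rightarrow> nat" where
  "coding K z x = (\<lambda>j. THE i. i \<in> {1..z} \<and> fst (billiard_iter (obstacles K z) j x) \<in> K i)"

text \<open>The data of the Oseledets theorem: \<open>lam 1 > \<dots> > lam k\<close> are the positive Lyapunov exponents and
  \<open>E j x\<close>, \<open>1 \<le> j \<le> k\<close>, are the summands of the unstable space at \<open>x\<close>.  For subspaces, the span of
  the union is their sum.\<close>

definition oseledets_splitting ::
    "(nat \<Rightarrow> 'a::euclidean_space set) \<Rightarrow> nat \<Rightarrow> (int \<Rightarrow> nat) measure \<Rightarrow> nat \<Rightarrow> (nat \<Rightarrow> real) \<Rightarrow>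
     (nat \<Rightarrow> 'a \<times> 'a \<Rightarrow> ('a \<times> 'a) set) \<Rightarrow> bool" where
  "oseledets_splitting K z \<mu> k lam E \<longleftrightarrow>
     1 \<le> k \<and> (\<forall>i\<in>{1..k}. \<forall>j\<in>{1..k}. i < j \<longrightarrow> lam j < lam i) \<and> 0 < lam k \<and>
     (AE \<xi> in \<mu>. \<forall>x\<in>M0 (obstacles K z). coding K z x = \<xi> \<longrightarrow>
        (\<forall>j\<in>{1..k}. subspace (E j x) \<and> E j x \<noteq> {0}) \<and>
        (\<forall>f. (\<forall>j\<in>{1..k}. f j \<in> E j x) \<and> (\<Sum>j=1..k. f j) = 0 \<longrightarrow> (\<forall>j\<in>{1..k}. f j = 0)) \<and>
        unstable_space (obstacles K z) x = span (\<Union>i\<in>{1..k}. E i x) \<and>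
        (\<forall>j\<in>{1..k}. \<forall>w \<in> span (\<Union>i\<in>{j..k}. E i x) - span (\<Union>i\<in>{j+1..k}. E i x).
           (\<lambda>m. ln (norm (billiard_deriv (obstacles K z) m x w)) / real m) \<longlonglongrightarrow> lam j))"


section \<open>The billiard flow and the unstable front\<close>

definition refl_time :: "'a::euclidean_space set \<Rightarrow> 'a \<times> 'a \<Rightarrow> nat \<Rightarrow> real" where
  "refl_time Q y j = (\<Sum>i<j. flight_time Q ((billiard Q ^^ i) y))"

text \<open>The number of reflections in the time interval \<open>(0, t]\<close>.\<close>

definition refl_count :: "'a::euclidean_space set \<Rightarrow> 'a \<times> 'a \<Rightarrow> real \<Rightarrow> nat" where
  "refl_count Q y t =
     (LEAST m. hit_times Q ((billiard Q ^^ m) y) = {} \<or> t < refl_time Q y (Suc m))"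

definition forward_flow :: "'a::euclidean_space set \<Rightarrow> real \<Rightarrow> 'a \<times> 'a \<Rightarrow> 'a \<times> 'a" where
  "forward_flow Q t y =
     (let m = refl_count Q y t; x = (billiard Q ^^ m) y
      in (fst x + (t - refl_time Q y m) *\<^sub>R snd x, snd x))"

definition flow :: "'a::euclidean_space set \<Rightarrow> real \<Rightarrow> 'a \<times> 'a \<Rightarrow> 'a \<times> 'a" where
  "flow Q t y =
     (if 0 \<le> t then forward_flow Q t y else reversal Q (forward_flow Q (- t) (reversal Q y)))"

definition flow_states :: "'a::euclidean_space set \<Rightarrow> ('a \<times> 'a) set" where
  "flow_states Q = {(p, v). p \<notin> Q \<and> norm v = 1} \<union> boundary_states Q"

text \<open>The flow is continuous only after the incoming and the outgoing velocity at a boundary point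
  have been identified.  So distances of states are measured by the quotient metric of this
  identification, the infimum of the lengths of chains that may use it.  In the Euclidean distance
  two trajectories reflecting at slightly different times would not stay close.\<close>

definition state_dist :: "'a::euclidean_space set \<Rightarrow> 'a \<times> 'a \<Rightarrow> 'a \<times> 'a \<Rightarrow> real" where
  "state_dist Q y y' = Inf {(\<Sum>i\<le>k. dist (a i) (b i)) | k (a :: nat \<Rightarrow> 'a \<times> 'a) b.
     a 0 = y \<and> b k = y' \<and>
     (\<forall>i\<le>k. a i \<in> (- interior Q) \<times> sphere 0 1 \<and> b i \<in> (- interior Q) \<times> sphere 0 1) \<and>
     (\<forall>i<k. fst (b i) \<in> frontier Q \<and>
        a (Suc i) = (fst (b i), reflected Q (fst (b i)) (snd (b i))))}"

definition local_unstable_flow ::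
    "'a::euclidean_space set \<Rightarrow> real \<Rightarrow> 'a \<times> 'a \<Rightarrow> ('a \<times> 'a) set" where
  "local_unstable_flow Q \<epsilon> y0 = {y \<in> flow_states Q.
     (\<forall>t\<le>0. state_dist Q (flow Q t y) (flow Q t y0) \<le> \<epsilon>) \<and>
     ((\<lambda>t. state_dist Q (flow Q t y) (flow Q t y0)) \<longlongrightarrow> 0) at_bot}"

text \<open>As the condition in \<open>local_unstable_flow\<close> is not strict, the front \<open>X\<close> is a hypersurface with
  boundary: it lies in a hypersurface \<open>Z\<close> without boundary, in which it is a neighbourhood of the
  base point.\<close>

definition unstable_front ::
    "'a::euclidean_space set \<Rightarrow> real \<Rightarrow> real \<Rightarrow> 'a \<times> 'a \<Rightarrow> 'a set \<Rightarrow> ('a \<Rightarrow> 'a) \<Rightarrow> bool" where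
  "unstable_front Q \<epsilon> r x0 X n \<longleftrightarrow>
     (let p0 = fst x0 + r *\<^sub>R snd x0 in
        local_unstable_flow Q \<epsilon> (p0, snd x0) = with_normal n ` X \<and>
        (\<exists>Z U. oriented_hypersurface Z n \<and> strictly_convex_hypersurface Z n \<and>
           X \<subseteq> Z \<and> open U \<and> p0 \<in> Z \<inter> U \<and> Z \<inter> U \<subseteq> X))"

text \<open>Moving back along the trajectory to its last point on the boundary.\<close>

definition foot :: "'a::euclidean_space set \<Rightarrow> 'a \<times> 'a \<Rightarrow> 'a \<times> 'a" where
  "foot Q y = (fst y - flight_time Q (fst y, - snd y) *\<^sub>R snd y, snd y)"

text \<open>The tangent vector \<open>u\<close> of \<open>X\<close> at \<open>p\<close> corresponds to the tangent vector \<open>w\<close> of the local unstable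
  manifold of the billiard map.\<close>

definition corresponds ::
    "'a::euclidean_space set \<Rightarrow> 'a set \<Rightarrow> ('a \<Rightarrow> 'a) \<Rightarrow> 'a \<Rightarrow> 'a \<Rightarrow> 'a \<times> 'a \<Rightarrow> bool" where
  "corresponds Q X n p u w \<longleftrightarrow>
     (\<exists>D. ((\<lambda>p'. foot Q (with_normal n p')) has_derivative D) (at p within X) \<and> w = D u)"


section \<open>Curvature along the trajectory\<close>

text \<open>The curvature operator at time \<open>t\<close>, at the point reached from \<open>p\<close>, of the propagated front.  The
  whole of \<open>X\<close> may be torn apart by the obstacles before time \<open>t\<close>, so only the part of \<open>X\<close> near \<open>p\<close>
  is propagated; its size does not affect the value on tangent vectors \<open>u\<close>.\<close>

definition front_curvature ::
    "'a::euclidean_space set \<Rightarrow> 'a set \<Rightarrow> ('a \<Rightarrow> 'a) \<Rightarrow> 'a \<Rightarrow> real \<Rightarrow> 'a \<Rightarrow> 'a" where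
  "front_curvature Q X n p t u = (THE h. \<exists>\<delta>>0. \<exists>S.
     curvature_operator (flow Q t ` with_normal n ` (X \<inter> ball p \<delta>))
       (fst (flow Q t (with_normal n p))) S \<and> h = S u)"

definition curvature_after ::
    "'a::euclidean_space set \<Rightarrow> 'a set \<Rightarrow> ('a \<Rightarrow> 'a) \<Rightarrow> 'a \<Rightarrow> nat \<Rightarrow> 'a \<Rightarrow> 'a" where
  "curvature_after Q X n p j u =
     Lim (at_right (refl_time Q (with_normal n p) j)) (\<lambda>t. front_curvature Q X n p t u)"

definition curve_direction ::
    "'a::euclidean_space set \<Rightarrow> ('a \<Rightarrow> 'a) \<Rightarrow> (real \<Rightarrow> 'a) \<Rightarrow> real \<Rightarrow> nat \<Rightarrow> real \<Rightarrow> 'a" where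
  "curve_direction Q n q a j s =
     Lim (at_right (refl_time Q (with_normal n (q s)) j))
       (\<lambda>t. sgn (vector_derivative (\<lambda>\<sigma>. fst (flow Q t (with_normal n (q \<sigma>)))) (at s within {0..a})))"

definition refl_distance ::
    "'a::euclidean_space set \<Rightarrow> ('a \<Rightarrow> 'a) \<Rightarrow> (real \<Rightarrow> 'a) \<Rightarrow> nat \<Rightarrow> real \<Rightarrow> real" where
  "refl_distance Q n q j s =
     norm (fst ((billiard Q ^^ Suc j) (with_normal n (q s))) - fst ((billiard Q ^^ j) (with_normal n (q s))))"

definition ell ::
    "'a::euclidean_space set \<Rightarrow> 'a set \<Rightarrow> ('a \<Rightarrow> 'a) \<Rightarrow> (real \<Rightarrow> 'a) \<Rightarrow> real \<Rightarrow> nat \<Rightarrow> real \<Rightarrow> real" where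
  "ell Q X n q a j s =
     (let d = refl_distance Q n q j s;
          w = curve_direction Q n q a j s;
          h = curvature_after Q X n (q s) j w
      in THE l. 0 < l \<and> (1 + d * l)^2 = 1 + 2 * d * (h \<bullet> w) + d^2 * (norm h)^2)"

end

theory Submission
  imports Defs
begin

text \<open>Let \<open>J\<^sub>j\<close> be the derivative, along the curve \<open>X\<close>, of the position of the propagated front just after the
  \<open>j\<close>-th reflection, and \<open>w\<^sub>j\<close> the derivative of its velocity. Until the next reflection the displacement is
  \<open>J\<^sub>j + s w\<^sub>j\<close>, after the path length \<open>s\<close>, and the reflection itself acts on it as an isometry
  (\<open>billiard_der_properties\<close>). Hence \<open>|J\<^sub>j\<^sub>+\<^sub>1| = |J\<^sub>j + d\<^sub>j w\<^sub>j|\<close>. The curvature operator of the front maps displacements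
  to changes of the velocity, so \<open>w\<^sub>j / |J\<^sub>j|\<close> is its value in the direction of the curve, and the defining
  equation of \<open>\<ell>\<^sub>j\<close> says exactly that \<open>1 + d\<^sub>j \<ell>\<^sub>j = |J\<^sub>j\<^sub>+\<^sub>1| / |J\<^sub>j|\<close> (\<open>stretch_factor\<close>). The sum of the
  logarithms therefore telescopes to \<open>ln |J\<^sub>m\<^sub>+\<^sub>1| - ln |J\<^sub>1|\<close>.

  It remains to compare \<open>|J\<^sub>m|\<close> with the norm of the derivative of the \<open>m\<close>-th iterate of the billiard map on the vector
  \<open>w\<close> that corresponds to the initial velocity of the curve; the latter norm grows at the rate \<open>\<lambda>\<^sub>1\<close> by the theorem of
  Oseledets. The displacement is a projection of the derivative of the impact point, so \<open>|J\<^sub>m|\<close> is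
  the smaller one. Conversely the derivative at step \<open>m\<close> is at most a constant times \<open>|J\<^sub>m\<^sub>+\<^sub>1|\<close>
  (\<open>orbit_der_le_jacobi\<close>): angles of reflection stay away from \<open>\<pi>/2\<close> and flight times stay away from \<open>0\<close>, by
  the condition on convex hulls and compactness (\<open>uniform_bounds\<close>), and \<open>|J\<^sub>m|\<close> is increasing because the
  fronts are convex and the obstacles keep them so.

  Most of the work goes into the derivatives. Impact points and flight times are shown to be strictly differentiable at
  transversal impacts (\<open>flight_time_strict_derivative\<close>, \<open>billiard_strict_derivative\<close>). Strictness gives
  the injectivity that is necessary for the propagated front to have a normal field and a curvature operator
  at all (\<open>curvature_operator_exists\<close>).\<close>

section \<open>Strict derivatives\<close>

definition near :: "'a::topological_space \<Rightarrow> 'a set \<Rightarrow> 'a filter" where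
  "near x S = inf (nhds x) (principal S)"

text \<open>Both points of the difference quotient move. This is what makes the map that carries a front
  injective near the base point, where a derivative at the base point alone would not. The notion is
  relative to a set \<open>S\<close>, because the billiard map is studied on states that start at the boundary
  of an obstacle, and it composes pointwise, so that no neighbourhoods of smoothness have to be tracked
  along an orbit.\<close>

definition strict_derivative ::
    "('a::real_normed_vector \<Rightarrow> 'b::real_normed_vector) \<Rightarrow> ('a \<Rightarrow> 'b) \<Rightarrow> 'a \<Rightarrow> 'a set \<Rightarrow> bool" where
  "strict_derivative f f' x S \<longleftrightarrow> bounded_linear f' \<and> (\<forall>e>0. \<forall>\<^sub>F p in near x S \<times>\<^sub>F near x S.
     norm (f (fst p) - f (snd p) - f' (fst p - snd p)) \<le> e * norm (fst p - snd p))"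

lemma eventually_near: "eventually P (near x S) \<longleftrightarrow> (\<forall>\<^sub>F y in nhds x. y \<in> S \<longrightarrow> P y)"
  by (simp add: near_def eventually_inf_principal)

lemma near_mono: "S \<subseteq> T \<Longrightarrow> near x S \<le> near x T"
  unfolding near_def by (meson inf_mono order_refl principal_le_iff)

lemma near_open: "open S \<Longrightarrow> x \<in> S \<Longrightarrow> near x S = nhds x"
  unfolding near_def by (rule inf_absorb1) (auto simp: le_principal eventually_nhds)

lemma eventually_near_nhds: "eventually P (nhds x) \<Longrightarrow> eventually P (near x S)"
  by (auto simp: eventually_near elim: eventually_mono)

lemma eventually_near_self: "eventually P (near x S) \<Longrightarrow> x \<in> S \<Longrightarrow> P x"
  using eventually_nhds_x_imp_x[of "\<lambda>y. y \<in> S \<longrightarrow> P y" x] by (auto simp: eventually_near)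

lemma eventually_near_pair:
  assumes "eventually P (near x S)"
  shows "\<forall>\<^sub>F p in near x S \<times>\<^sub>F near x S. P (fst p) \<and> P (snd p)"
  using assms eventually_prod_filter by fastforce

lemma eventually_near_mem: "\<forall>\<^sub>F y in near x S. y \<in> S"
  by (simp add: eventually_near)

lemma strict_derivativeD:
  assumes "strict_derivative f f' x S" "e > 0"
  shows "\<forall>\<^sub>F p in near x S \<times>\<^sub>F near x S.
    norm (f (fst p) - f (snd p) - f' (fst p - snd p)) \<le> e * norm (fst p - snd p)"
  using assms unfolding strict_derivative_def by blast

lemma strict_derivative_linear: "strict_derivative f f' x S \<Longrightarrow> bounded_linear f'"
  unfolding strict_derivative_def by blast

lemma strict_derivative_subset:
  assumes "strict_derivative f f' x T" "S \<subseteq> T"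
  shows "strict_derivative f f' x S"
  using assms filter_leD[OF prod_filter_mono[OF near_mono[OF assms(2)] near_mono[OF assms(2)]]]
  unfolding strict_derivative_def by blast

lemma strict_derivative_cong:
  assumes "strict_derivative f f' x S" and "\<forall>\<^sub>F y in near x S. g y = f y"
  shows "strict_derivative g f' x S"
  unfolding strict_derivative_def
proof (intro conjI allI impI)
  show "bounded_linear f'" using assms(1) by (rule strict_derivative_linear)
  fix e :: real assume "e > 0"
  show "\<forall>\<^sub>F p in near x S \<times>\<^sub>F near x S.
      norm (g (fst p) - g (snd p) - f' (fst p - snd p)) \<le> e * norm (fst p - snd p)"
    using strict_derivativeD[OF assms(1) \<open>e > 0\<close>] eventually_near_pair[OF assms(2)]
    by eventually_elim simp
qed

lemma strict_derivative_near_cong: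
  assumes "strict_derivative f f' x S" "near x S = near x T"
  shows "strict_derivative f f' x T"
  using assms unfolding strict_derivative_def by simp

lemma strict_derivative_lipschitz:
  assumes "strict_derivative f f' x S"
  obtains C where "C > 0" "\<forall>\<^sub>F p in near x S \<times>\<^sub>F near x S.
    norm (f (fst p) - f (snd p)) \<le> C * norm (fst p - snd p)"
proof -
  obtain K where K: "K > 0" "\<And>h. norm (f' h) \<le> norm h * K"
    using bounded_linear.pos_bounded[OF strict_derivative_linear[OF assms]] by blast
  have "\<forall>\<^sub>F p in near x S \<times>\<^sub>F near x S.
    norm (f (fst p) - f (snd p)) \<le> (K + 1) * norm (fst p - snd p)"
    using strict_derivativeD[OF assms zero_less_one]
  proof eventually_elim
    case (elim p)
    then show ?case
      using norm_triangle_sub[of "f (fst p) - f (snd p)" "f' (fst p - snd p)"] K(2)[of "fst p - snd p"]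
      by (simp add: algebra_simps)
  qed
  with K(1) show thesis by (intro that[of "K + 1"]) auto
qed

lemma eventually_near_diagonal:
  assumes "eventually P (near x S \<times>\<^sub>F near x S)" "x \<in> S"
  shows "\<forall>\<^sub>F y in near x S. P (y, x)"
proof -
  from assms(1) obtain Pf Pg where *: "eventually Pf (near x S)" "eventually Pg (near x S)"
    "\<And>a b. Pf a \<Longrightarrow> Pg b \<Longrightarrow> P (a, b)"
    unfolding eventually_prod_filter by metis
  from *(1) show ?thesis
    by eventually_elim (use *(3) eventually_near_self[OF *(2) assms(2)] in blast)
qed

lemma strict_derivative_tendsto:
  assumes "strict_derivative f f' x S" "x \<in> S"
  shows "(f \<longlongrightarrow> f x) (near x S)"
proof -
  obtain C where C: "C > 0" and ev: "\<forall>\<^sub>F p in near x S \<times>\<^sub>F near x S.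
    norm (f (fst p) - f (snd p)) \<le> C * norm (fst p - snd p)"
    using strict_derivative_lipschitz[OF assms(1)] by blast
  have ev': "\<forall>\<^sub>F y in near x S. norm (f y - f x) \<le> C * norm (y - x)"
    using eventually_near_diagonal[OF ev assms(2)] by simp
  have "((\<lambda>y. C * norm (y - x)) \<longlongrightarrow> C * norm (x - x)) (nhds x)"
    by (intro tendsto_intros filterlim_ident)
  then have "((\<lambda>y. C * norm (y - x)) \<longlongrightarrow> 0) (near x S)"
    unfolding near_def by (simp add: tendsto_mono[OF inf_le1])
  then have "((\<lambda>y. f y - f x) \<longlongrightarrow> 0) (near x S)"
    by (rule Lim_null_comparison[OF ev'])
  then show ?thesis by (simp add: LIM_zero_iff)
qed

lemma strict_derivative_imp_has_derivative:
  assumes "strict_derivative f f' x S" "x \<in> S"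
  shows "(f has_derivative f') (at x within S)"
  unfolding has_derivative_within_alt
proof (intro conjI allI impI)
  show "bounded_linear f'" using assms(1) by (rule strict_derivative_linear)
  fix e :: real assume "0 < e"
  from eventually_near_diagonal[OF strict_derivativeD[OF assms(1) this] assms(2)]
  obtain d where "d > 0" "\<And>y. dist y x < d \<Longrightarrow> y \<in> S \<Longrightarrow> norm (f y - f x - f' (y - x)) \<le> e * norm (y - x)"
    unfolding eventually_near eventually_nhds_metric by auto
  then show "\<exists>d>0. \<forall>y\<in>S. norm (y - x) < d \<longrightarrow> norm (f y - f x - f' (y - x)) \<le> e * norm (y - x)"
    by (auto simp: dist_norm)
qed

lemma strict_derivative_bounded_linear:
  assumes "bounded_linear f" shows "strict_derivative f f x S"
  using assms by (simp add: strict_derivative_def linear_diff[OF bounded_linear.linear])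

lemma strict_derivative_const: "strict_derivative (\<lambda>_. c) (\<lambda>_. 0) x S"
  by (simp add: strict_derivative_def)

lemma strict_derivative_add:
  assumes "strict_derivative f f' x S" "strict_derivative g g' x S"
  shows "strict_derivative (\<lambda>y. f y + g y) (\<lambda>h. f' h + g' h) x S"
  unfolding strict_derivative_def
proof (intro conjI allI impI)
  show "bounded_linear (\<lambda>h. f' h + g' h)"
    using assms by (intro bounded_linear_add strict_derivative_linear)
  fix e :: real assume "0 < e"
  then have "e/2 > 0" by simp
  from strict_derivativeD[OF assms(1) this] strict_derivativeD[OF assms(2) this]
  show "\<forall>\<^sub>F p in near x S \<times>\<^sub>F near x S. norm (f (fst p) + g (fst p) - (f (snd p) + g (snd p)) -
     (f' (fst p - snd p) + g' (fst p - snd p))) \<le> e * norm (fst p - snd p)"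
  proof eventually_elim
    case (elim p)
    have eq: "f (fst p) + g (fst p) - (f (snd p) + g (snd p)) - (f' (fst p - snd p) + g' (fst p - snd p)) =
      (f (fst p) - f (snd p) - f' (fst p - snd p)) + (g (fst p) - g (snd p) - g' (fst p - snd p))"
      by (simp add: algebra_simps)
    show ?case unfolding eq
      using elim norm_triangle_ineq[of "f (fst p) - f (snd p) - f' (fst p - snd p)" "g (fst p) - g (snd p) - g' (fst p - snd p)"]
      by simp
  qed
qed

lemma strict_derivative_compose:
  assumes f: "strict_derivative f f' x S" and g: "strict_derivative g g' (f x) T"
    and lim: "filterlim f (near (f x) T) (near x S)"
  shows "strict_derivative (\<lambda>y. g (f y)) (\<lambda>h. g' (f' h)) x S"
  unfolding strict_derivative_def
proof (intro conjI allI impI)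
  show "bounded_linear (\<lambda>h. g' (f' h))"
    using bounded_linear_compose[OF strict_derivative_linear[OF g] strict_derivative_linear[OF f]] .
  fix e :: real assume e: "0 < e"
  obtain C where C: "C > 0" and lip: "\<forall>\<^sub>F p in near x S \<times>\<^sub>F near x S.
    norm (f (fst p) - f (snd p)) \<le> C * norm (fst p - snd p)"
    using strict_derivative_lipschitz[OF f] by blast
  obtain K where K: "K > 0" "\<And>h. norm (g' h) \<le> norm h * K"
    using bounded_linear.pos_bounded[OF strict_derivative_linear[OF g]] by blast
  have e1: "e / (2 * C) > 0" and e2: "e / (2 * K) > 0" using e C K by auto
  have "\<forall>\<^sub>F p in near x S \<times>\<^sub>F near x S. norm (g (f (fst p)) - g (f (snd p)) - g' (f (fst p) - f (snd p)))
     \<le> e / (2 * C) * norm (f (fst p) - f (snd p))"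
  proof -
    from strict_derivativeD[OF g e1] obtain P1 P2 where P: "eventually P1 (near (f x) T)"
      "eventually P2 (near (f x) T)" "\<And>a b. P1 a \<Longrightarrow> P2 b \<Longrightarrow>
        norm (g a - g b - g' (a - b)) \<le> e / (2 * C) * norm (a - b)"
      unfolding eventually_prod_filter by auto
    have "eventually (\<lambda>y. P1 (f y) \<and> P2 (f y)) (near x S)"
      using eventually_conj[OF P(1,2)] lim unfolding filterlim_iff by blast
    from eventually_near_pair[OF this] show ?thesis by eventually_elim (use P(3) in auto)
  qed
  with lip strict_derivativeD[OF f e2]
  show "\<forall>\<^sub>F p in near x S \<times>\<^sub>F near x S. norm (g (f (fst p)) - g (f (snd p)) - g' (f' (fst p - snd p)))
      \<le> e * norm (fst p - snd p)"
  proof eventually_elim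
    case (elim p)
    interpret g': bounded_linear g' using strict_derivative_linear[OF g] .
    let ?a = "f (fst p)" and ?b = "f (snd p)" and ?h = "fst p - snd p"
    have "g ?a - g ?b - g' (f' ?h) = (g ?a - g ?b - g' (?a - ?b)) + g' (?a - ?b - f' ?h)"
      by (simp add: g'.diff)
    then have "norm (g ?a - g ?b - g' (f' ?h)) \<le> norm (g ?a - g ?b - g' (?a - ?b)) + norm (g' (?a - ?b - f' ?h))"
      by (metis norm_triangle_ineq)
    also have "\<dots> \<le> e / (2 * C) * norm (?a - ?b) + norm (?a - ?b - f' ?h) * K"
      using elim(3) K(2) by (intro add_mono)
    also have "\<dots> \<le> e / (2 * C) * (C * norm ?h) + (e / (2 * K) * norm ?h) * K"
      using elim(1,2) e1 K(1) by (intro add_mono mult_left_mono mult_right_mono) auto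
    also have "\<dots> = e * norm ?h" using C K by (simp add: field_simps)
    finally show ?case .
  qed
qed

lemma strict_derivative_compose_linear:
  assumes f: "strict_derivative f f' x S" "x \<in> S" and g: "bounded_linear g"
  shows "strict_derivative (\<lambda>y. g (f y)) (\<lambda>h. g (f' h)) x S"
  by (rule strict_derivative_compose[OF f(1) strict_derivative_bounded_linear[OF g, of _ UNIV]])
     (simp add: near_open strict_derivative_tendsto[OF f])

lemma strict_derivative_bilinear:
  assumes B: "bounded_bilinear B" and x: "x \<in> S"
    and f: "strict_derivative f f' x S" and g: "strict_derivative g g' x S"
  shows "strict_derivative (\<lambda>y. B (f y) (g y)) (\<lambda>h. B (f x) (g' h) + B (f' h) (g x)) x S"
  unfolding strict_derivative_def
proof (intro conjI allI impI)
  interpret B: bounded_bilinear B by (rule B)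
  note f' = strict_derivative_linear[OF f] and g' = strict_derivative_linear[OF g]
  show "bounded_linear (\<lambda>h. B (f x) (g' h) + B (f' h) (g x))"
    by (intro bounded_linear_add bounded_linear_compose[OF B.bounded_linear_right g']
        bounded_linear_compose[OF B.bounded_linear_left f'])
  fix e :: real assume e: "0 < e"
  obtain K where K: "K > 0" "\<And>a b. norm (B a b) \<le> norm a * norm b * K"
    using B.pos_bounded by blast
  obtain Kf where Kf: "Kf > 0" "\<And>h. norm (f' h) \<le> norm h * Kf"
    using bounded_linear.pos_bounded[OF f'] by blast
  obtain Kg where Kg: "Kg > 0" "\<And>h. norm (g' h) \<le> norm h * Kg"
    using bounded_linear.pos_bounded[OF g'] by blast
  define M where "M = norm (f x) + norm (g x) + 2 + Kf + Kg"
  have M: "M > 0" using Kf Kg by (simp add: M_def add_nonneg_pos)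
  define e1 where "e1 = min 1 (e / (4 * K * M))"
  have e1: "e1 > 0" "e1 \<le> 1" using e K M by (auto simp: e1_def)
  have e1': "4 * (K * (e1 * M)) \<le> e"
  proof -
    have "e1 \<le> e / (4 * K * M)" by (simp add: e1_def)
    then show ?thesis using K M by (simp add: pos_le_divide_eq mult.assoc mult.left_commute mult.commute)
  qed
  have cf: "\<forall>\<^sub>F y in near x S. dist (f y) (f x) < e1" and cg: "\<forall>\<^sub>F y in near x S. dist (g y) (g x) < e1"
    using strict_derivative_tendsto[OF f x] strict_derivative_tendsto[OF g x] e1 by (auto dest: tendstoD)
  from strict_derivativeD[OF f e1(1)] strict_derivativeD[OF g e1(1)]
    eventually_near_pair[OF cf] eventually_near_pair[OF cg]
  show "\<forall>\<^sub>F p in near x S \<times>\<^sub>F near x S. norm (B (f (fst p)) (g (fst p)) - B (f (snd p)) (g (snd p))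
     - (B (f x) (g' (fst p - snd p)) + B (f' (fst p - snd p)) (g x))) \<le> e * norm (fst p - snd p)"
  proof eventually_elim
    case (elim p)
    define h where "h = fst p - snd p"
    let ?fy = "f (fst p)" and ?fz = "f (snd p)" and ?gy = "g (fst p)" and ?gz = "g (snd p)"
    have nfy: "norm ?fy \<le> M" and ngz: "norm ?gz \<le> M"
      using elim(3,4) e1(2) Kf(1) Kg(1) norm_triangle_sub[of ?fy "f x"] norm_triangle_sub[of ?gz "g x"]
        norm_ge_zero[of "f x"] norm_ge_zero[of "g x"]
      unfolding M_def dist_norm by linarith+
    have KM: "Kf \<le> M" "Kg \<le> M" using Kf(1) Kg(1) norm_ge_zero[of "f x"] norm_ge_zero[of "g x"] unfolding M_def by linarith+
    have fh: "norm (f' h) \<le> norm h * M" and gh: "norm (g' h) \<le> norm h * M"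
      using Kf(2)[of h] Kg(2)[of h] KM by (meson mult_left_mono norm_ge_zero order_trans)+
    have 1: "norm (B ?fy (?gy - ?gz - g' h)) \<le> M * (e1 * norm h) * K"
      using elim(2) nfy K M e1 unfolding h_def[symmetric]
      by (intro order_trans[OF K(2)] mult_right_mono mult_mono) auto
    have 2: "norm (B (?fy - f x) (g' h)) \<le> e1 * (norm h * M) * K"
      using elim(3) gh K M e1
      by (intro order_trans[OF K(2)] mult_right_mono mult_mono) (auto simp: dist_norm)
    have 3: "norm (B (?fy - ?fz - f' h) ?gz) \<le> (e1 * norm h) * M * K"
      using elim(1) ngz K M e1 unfolding h_def[symmetric]
      by (intro order_trans[OF K(2)] mult_right_mono mult_mono) auto
    have 4: "norm (B (f' h) (?gz - g x)) \<le> (norm h * M) * e1 * K"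
      using elim(4) fh K M e1
      by (intro order_trans[OF K(2)] mult_right_mono mult_mono) (auto simp: dist_norm)
    have eq: "B ?fy ?gy - B ?fz ?gz - (B (f x) (g' h) + B (f' h) (g x)) =
      B ?fy (?gy - ?gz - g' h) + B (?fy - f x) (g' h) + (B (?fy - ?fz - f' h) ?gz + B (f' h) (?gz - g x))"
      by (simp add: B.diff_left B.diff_right)
    have "norm (B ?fy ?gy - B ?fz ?gz - (B (f x) (g' h) + B (f' h) (g x))) \<le> 4 * (K * (e1 * M)) * norm h"
      unfolding eq using 1 2 3 4
        norm_triangle_ineq[of "B ?fy (?gy - ?gz - g' h) + B (?fy - f x) (g' h)" "B (?fy - ?fz - f' h) ?gz + B (f' h) (?gz - g x)"]
        norm_triangle_ineq[of "B ?fy (?gy - ?gz - g' h)" "B (?fy - f x) (g' h)"]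
        norm_triangle_ineq[of "B (?fy - ?fz - f' h) ?gz" "B (f' h) (?gz - g x)"]
      by (simp add: algebra_simps)
    also have "\<dots> \<le> e * norm h" using e1' by (intro mult_right_mono) auto
    finally show ?case unfolding h_def .
  qed
qed

lemma strict_derivative_Pair:
  assumes "strict_derivative f f' x S" "strict_derivative g g' x S" "x \<in> S"
  shows "strict_derivative (\<lambda>y. (f y, g y)) (\<lambda>h. (f' h, g' h)) x S"
proof -
  have l: "bounded_linear (\<lambda>a. (a, 0))" "bounded_linear (\<lambda>a. (0, a))"
    by (intro bounded_linear_intros)+
  from strict_derivative_add[OF strict_derivative_compose_linear[OF assms(1,3) l(1)]
      strict_derivative_compose_linear[OF assms(2,3) l(2)]]
  show ?thesis by simp
qed

lemma strict_derivative_sum: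
  assumes "\<And>i. i \<in> I \<Longrightarrow> strict_derivative (f i) (f' i) x S"
  shows "strict_derivative (\<lambda>y. \<Sum>i\<in>I. f i y) (\<lambda>h. \<Sum>i\<in>I. f' i h) x S"
  using assms by (induction I rule: infinite_finite_induct)
    (auto intro: strict_derivative_const strict_derivative_add)

text \<open>The mean value inequality for \<open>f\<close> minus its derivative at \<open>x\<close>; convergence of the derivative on a
  basis bounds its operator norm.\<close>

lemma strict_derivative_C1:
  fixes f :: "'a::euclidean_space \<Rightarrow> 'b::real_normed_vector"
  assumes U: "open U" "x \<in> U" and f: "\<And>y. y \<in> U \<Longrightarrow> (f has_derivative f' y) (at y)"
    and c: "\<And>h. ((\<lambda>y. f' y h) \<longlongrightarrow> f' x h) (at x)"
  shows "strict_derivative f (f' x) x S"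
  unfolding strict_derivative_def
proof (intro conjI allI impI)
  show bl: "bounded_linear (f' x)" using f[OF U(2)] by (rule has_derivative_bounded_linear)
  fix e :: real assume e: "0 < e"
  define e1 where "e1 = e / (real DIM('a))"
  have e1: "e1 > 0" using e by (simp add: e1_def)
  have "\<forall>\<^sub>F y in at x. \<forall>b\<in>Basis. dist (f' y b) (f' x b) < e1"
    using tendstoD[OF c e1] by (simp add: eventually_ball_finite_distrib)
  then have "\<forall>\<^sub>F y in nhds x. y \<in> U \<and> (\<forall>b\<in>Basis. dist (f' y b) (f' x b) < e1)"
    using eventually_nhds_in_open[OF U] unfolding eventually_at_filter
    by eventually_elim (use e1 in force)
  then obtain d where d: "d > 0" "\<And>y. dist y x < d \<Longrightarrow> y \<in> U \<and> (\<forall>b\<in>Basis. dist (f' y b) (f' x b) < e1)"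
    unfolding eventually_nhds_metric by blast
  have bnd: "norm (f y - f z - f' x (y - z)) \<le> e * norm (y - z)" if "y \<in> ball x d" "z \<in> ball x d" for y z
  proof -
    have "norm ((f y - f' x y) - (f z - f' x z)) \<le> e * norm (y - z)"
    proof (rule differentiable_bound[of "ball x d" "\<lambda>y. f y - f' x y" "\<lambda>y h. f' y h - f' x h"])
      show "convex (ball x d)" by simp
      fix u assume u: "u \<in> ball x d"
      then have uU: "u \<in> U" and ub: "\<forall>b\<in>Basis. dist (f' u b) (f' x b) < e1"
        using d(2)[of u] by (auto simp: dist_commute)
      show "((\<lambda>y. f y - f' x y) has_derivative (\<lambda>h. f' u h - f' x h)) (at u within ball x d)"
        by (intro has_derivative_diff has_derivative_at_withinI[OF f[OF uU]] bounded_linear_imp_has_derivative bl)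
      have lin: "linear (\<lambda>h. f' u h - f' x h)"
        using bounded_linear_sub[OF has_derivative_bounded_linear[OF f[OF uU]] bl] by (simp add: bounded_linear.linear)
      show "onorm (\<lambda>h. f' u h - f' x h) \<le> e"
      proof (rule onorm_le)
        fix h :: 'a
        have "norm (f' u h - f' x h) = norm (\<Sum>b\<in>Basis. (h \<bullet> b) *\<^sub>R (f' u b - f' x b))"
          using linear_sum[OF lin, of "\<lambda>b. (h \<bullet> b) *\<^sub>R b" Basis] linear_scale[OF lin]
          by (simp add: euclidean_representation)
        also have "\<dots> \<le> (\<Sum>b\<in>(Basis::'a set). norm h * e1)"
          using ub by (intro sum_norm_le) (simp add: dist_norm mult_mono Basis_le_norm less_imp_le)
        also have "\<dots> = e * norm h" by (simp add: e1_def)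
        finally show "norm (f' u h - f' x h) \<le> e * norm h" .
      qed
    qed (use that in auto)
    then show ?thesis by (simp add: linear_diff[OF bounded_linear.linear[OF bl]] algebra_simps)
  qed
  have "eventually (\<lambda>y. y \<in> ball x d) (near x S)"
    using d(1) by (intro eventually_near_nhds eventually_nhds_in_open) auto
  from eventually_near_pair[OF this]
  show "\<forall>\<^sub>F p in near x S \<times>\<^sub>F near x S. norm (f (fst p) - f (snd p) - f' x (fst p - snd p)) \<le> e * norm (fst p - snd p)"
    by eventually_elim (use bnd in blast)
qed

lemma strict_derivative_sgn:
  fixes g :: "'a::real_normed_vector \<Rightarrow> 'b::real_inner"
  assumes g: "strict_derivative g g' x S" and x: "x \<in> S" and nz: "g x \<noteq> 0"
  shows "\<exists>n'. strict_derivative (\<lambda>y. sgn (g y)) n' x S"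
proof -
  define \<psi> where "\<psi> = (\<lambda>r. inverse (sqrt r))"
  define \<psi>' where "\<psi>' = (\<lambda>r h. h * - (inverse (sqrt r) * (inverse (sqrt r) / 2) * inverse (sqrt r)))"
  let ?r = "g x \<bullet> g x"
  have r: "?r > 0" using nz by simp
  have "strict_derivative \<psi> (\<psi>' ?r) ?r UNIV"
  proof (rule strict_derivative_C1[of "{0<..}"])
    show "(\<psi> has_derivative \<psi>' y) (at y)" if "y \<in> {0<..}" for y
      unfolding \<psi>_def \<psi>'_def using that by (auto intro!: derivative_eq_intros simp: field_simps)
    show "((\<lambda>y. \<psi>' y h) \<longlongrightarrow> \<psi>' ?r h) (at ?r)" for h
      unfolding \<psi>'_def using r by (intro tendsto_intros) auto
  qed (use r in auto)
  from strict_derivative_compose[of "\<lambda>y. g y \<bullet> g y", OF strict_derivative_bilinear[OF bounded_bilinear_inner x g g] this]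
  have "\<exists>m. strict_derivative (\<lambda>y. \<psi> (g y \<bullet> g y)) m x S"
    using strict_derivative_tendsto[OF strict_derivative_bilinear[OF bounded_bilinear_inner x g g] x]
    by (auto simp: near_open)
  then obtain m where "strict_derivative (\<lambda>y. \<psi> (g y \<bullet> g y)) m x S" ..
  from strict_derivative_bilinear[OF bounded_bilinear_scaleR x this g]
  show ?thesis by (auto simp: \<psi>_def sgn_div_norm norm_eq_sqrt_inner)
qed


section \<open>Smooth hypersurfaces\<close>

lemma frechet_derivative_gderiv: "GDERIV f x :> d \<Longrightarrow> frechet_derivative f (at x) = (\<lambda>h. h \<bullet> d)"
  unfolding gderiv_def by (rule frechet_derivative_at[symmetric])

text \<open>Each component of the gradient is a directional derivative of \<open>f\<close> and hence itself continuously
  differentiable.\<close>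

lemma Ck_on_2_strict_gradient:
  fixes f :: "'a::euclidean_space \<Rightarrow> real"
  assumes U: "open U" "q \<in> U" and C: "Ck_on 2 f U" and g: "\<And>x. x \<in> U \<Longrightarrow> GDERIV f x :> g x"
  shows "\<exists>g'. strict_derivative g g' q UNIV"
proof -
  have "\<exists>G'. strict_derivative (\<lambda>x. g x \<bullet> b) G' q UNIV" for b :: 'a
  proof -
    define G where "G = (\<lambda>x. frechet_derivative f (at x) b)"
    have "Ck_on 1 G U" using C unfolding G_def numeral_2_eq_2 by simp
    then have d: "\<And>x. x \<in> U \<Longrightarrow> (G has_derivative frechet_derivative G (at x)) (at x)"
      and c: "\<And>h. continuous_on U (\<lambda>x. frechet_derivative G (at x) h)"
      by (simp_all add: frechet_derivative_works[symmetric])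
    have "strict_derivative G (frechet_derivative G (at q)) q UNIV"
      by (rule strict_derivative_C1[OF U d]) (use c U in \<open>auto simp: continuous_on_eq_continuous_at isCont_def\<close>)
    moreover have "\<forall>\<^sub>F x in near q UNIV. g x \<bullet> b = G x"
      using eventually_near_nhds[OF eventually_nhds_in_open[OF U]]
      by eventually_elim (simp add: G_def frechet_derivative_gderiv[OF g] inner_commute)
    ultimately show ?thesis by (blast intro: strict_derivative_cong)
  qed
  then obtain G' where G': "\<And>b::'a. strict_derivative (\<lambda>x. g x \<bullet> b) (G' b) q UNIV" by metis
  have "strict_derivative (\<lambda>x. \<Sum>b\<in>Basis. (g x \<bullet> b) *\<^sub>R b) (\<lambda>h. \<Sum>b\<in>Basis. G' b h *\<^sub>R b) q UNIV"
  proof (rule strict_derivative_sum)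
    fix b :: 'a assume "b \<in> Basis"
    show "strict_derivative (\<lambda>x. (g x \<bullet> b) *\<^sub>R b) (\<lambda>h. G' b h *\<^sub>R b) q UNIV"
      by (rule strict_derivative_compose_linear[OF G' _ bounded_linear_scaleR_left]) simp
  qed
  then show ?thesis by (auto simp: euclidean_representation)
qed

lemma submersion_onD:
  assumes "submersion_on f g U" "q \<in> U"
  shows "open U" "(f has_derivative (\<lambda>h. h \<bullet> g q)) (at q)" "g q \<noteq> 0"
    "strict_derivative f (\<lambda>h. h \<bullet> g q) q S" "\<exists>g'. strict_derivative g g' q S"
    "continuous_on U f"
proof -
  from assms have U: "open U" and sm: "smooth_on f U" and gd: "\<And>x. x \<in> U \<Longrightarrow> GDERIV f x :> g x"
    and nz: "\<And>x. x \<in> U \<Longrightarrow> g x \<noteq> 0"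
    unfolding submersion_on_def by auto
  show "open U" "g q \<noteq> 0" using U nz assms by auto
  have d: "(f has_derivative (\<lambda>h. h \<bullet> g x)) (at x)" if "x \<in> U" for x
    using gd[OF that] unfolding gderiv_def by (simp add: inner_commute)
  show "(f has_derivative (\<lambda>h. h \<bullet> g q)) (at q)" using d assms by auto
  have C2: "Ck_on 2 f U" and C1: "Ck_on 1 f U" using sm unfolding smooth_on_def by blast+
  show "\<exists>g'. strict_derivative g g' q S"
    using Ck_on_2_strict_gradient[OF U assms(2) C2 gd] strict_derivative_subset by blast
  show "continuous_on U f"
    using d by (meson continuous_at_imp_continuous_on has_derivative_continuous)
  have "strict_derivative f (frechet_derivative f (at q)) q S"
  proof (rule strict_derivative_C1[OF U assms(2)])
    show "(f has_derivative frechet_derivative f (at y)) (at y)" if "y \<in> U" for y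
      using d[OF that] frechet_derivative_works differentiableI by blast
    show "((\<lambda>y. frechet_derivative f (at y) h) \<longlongrightarrow> frechet_derivative f (at q) h) (at q)" for h
      using C1 U assms(2) by (auto simp: continuous_on_eq_continuous_at isCont_def)
  qed
  then show "strict_derivative f (\<lambda>h. h \<bullet> g q) q S"
    using frechet_derivative_gderiv[OF gd[OF assms(2)]] by simp
qed

text \<open>The contingent cone of Bouligand. Being given by sequences, it contains the tangent directions of a
  level set already by the intermediate value theorem, without a parametrisation; and a derivative within
  \<open>A\<close> is determined on it.\<close>

definition contingent :: "'a::real_normed_vector set \<Rightarrow> 'a \<Rightarrow> 'a \<Rightarrow> bool" where
  "contingent A p h \<longleftrightarrow> (\<exists>y t. (\<forall>k::nat. y k \<in> A) \<and> (\<forall>k. 0 < t k) \<and> t \<longlonglongrightarrow> 0 \<and>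
     (\<lambda>k. (y k - p) /\<^sub>R t k) \<longlonglongrightarrow> h)"

lemma contingent_mono: "contingent A p h \<Longrightarrow> A \<subseteq> B \<Longrightarrow> contingent B p h"
  unfolding contingent_def by blast

lemma contingent_sequence_tendsto:
  fixes p :: "'a::real_normed_vector"
  assumes "\<forall>k. 0 < t k" "t \<longlonglongrightarrow> 0" "(\<lambda>k::nat. (y k - p) /\<^sub>R t k) \<longlonglongrightarrow> h"
  shows "y \<longlonglongrightarrow> p"
proof -
  have "(\<lambda>k. t k *\<^sub>R ((y k - p) /\<^sub>R t k)) \<longlonglongrightarrow> 0 *\<^sub>R h"
    by (intro tendsto_scaleR assms)
  moreover have "t k *\<^sub>R ((y k - p) /\<^sub>R t k) = y k - p" for k
    using assms(1)[rule_format, of k] by simp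
  ultimately show ?thesis by (simp add: LIM_zero_iff)
qed

lemma contingent_derivative_tendsto:
  assumes f: "(f has_derivative f') (at p within A)" and y: "\<forall>k. y k \<in> A"
    and t: "\<forall>k. 0 < t k" "t \<longlonglongrightarrow> 0" and h: "(\<lambda>k::nat. (y k - p) /\<^sub>R t k) \<longlonglongrightarrow> h"
  shows "(\<lambda>k. (f (y k) - f p) /\<^sub>R t k) \<longlonglongrightarrow> f' h"
proof -
  interpret f': bounded_linear f' using f by (rule has_derivative_bounded_linear)
  define r where "r = (\<lambda>x. (1 / norm (x - p)) *\<^sub>R (f x - (f p + f' (x - p))))"
  have r0: "r p = 0" by (simp add: r_def)
  have "(r \<longlongrightarrow> 0) (at p within A)"
    using f unfolding has_derivative_within r_def by blast
  then have "(r \<longlongrightarrow> 0) (near p A)"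
    unfolding near_def using r0
    by (auto simp: tendsto_iff eventually_at_filter eventually_inf_principal elim!: eventually_mono)
  moreover have "filterlim y (near p A) sequentially"
    unfolding near_def filterlim_inf filterlim_principal
    using contingent_sequence_tendsto[OF t h] y by simp
  ultimately have "(\<lambda>k. r (y k)) \<longlonglongrightarrow> 0" by (rule filterlim_compose)
  then have "(\<lambda>k. f' ((y k - p) /\<^sub>R t k) + norm ((y k - p) /\<^sub>R t k) *\<^sub>R r (y k)) \<longlonglongrightarrow> f' h + norm h *\<^sub>R 0"
    by (intro tendsto_intros h f'.tendsto)
  moreover have "f' ((y k - p) /\<^sub>R t k) + norm ((y k - p) /\<^sub>R t k) *\<^sub>R r (y k) = (f (y k) - f p) /\<^sub>R t k" for k
  proof -
    have "norm (y k - p) *\<^sub>R r (y k) = f (y k) - f p - f' (y k - p)"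
      using f'.zero by (cases "y k = p") (simp_all add: r_def)
    then have "(norm (y k - p) / t k) *\<^sub>R r (y k) = (f (y k) - f p - f' (y k - p)) /\<^sub>R t k"
      by (metis divide_inverse mult.commute scaleR_scaleR)
    moreover have "norm ((y k - p) /\<^sub>R t k) = norm (y k - p) / t k"
      using t(1)[rule_format, of k] by (simp add: divide_inverse mult.commute)
    ultimately show ?thesis unfolding f'.scaleR by (simp add: scaleR_diff_right)
  qed
  ultimately show ?thesis by simp
qed

lemma contingent_image:
  assumes "(f has_derivative f') (at p within A)" "contingent A p h"
  shows "contingent (f ` A) (f p) (f' h)"
proof -
  from assms(2) obtain y t where *: "\<forall>k::nat. y k \<in> A" "\<forall>k. 0 < t k" "t \<longlonglongrightarrow> 0"
    "(\<lambda>k. (y k - p) /\<^sub>R t k) \<longlonglongrightarrow> h" unfolding contingent_def by blast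
  show ?thesis unfolding contingent_def
    by (rule exI[of _ "\<lambda>k. f (y k)"], rule exI[of _ t])
       (use contingent_derivative_tendsto[OF assms(1) *] * in auto)
qed

lemma contingent_unique:
  assumes "(f has_derivative f') (at p within A)" "(g has_derivative g') (at p within A)"
    and "\<And>x. x \<in> A \<Longrightarrow> f x = g x" "f p = g p" "contingent A p h"
  shows "f' h = g' h"
proof -
  from assms(5) obtain y t where *: "\<forall>k::nat. y k \<in> A" "\<forall>k. 0 < t k" "t \<longlonglongrightarrow> 0"
    "(\<lambda>k. (y k - p) /\<^sub>R t k) \<longlonglongrightarrow> h" unfolding contingent_def by blast
  from contingent_derivative_tendsto[OF assms(1) *] contingent_derivative_tendsto[OF assms(2) *]
  show ?thesis using assms(3,4) *(1) LIMSEQ_unique by fastforce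
qed

lemma contingent_open_Int:
  assumes "contingent A p h" "open U" "p \<in> U"
  shows "contingent (A \<inter> U) p h"
proof -
  from assms(1) obtain y t where *: "\<forall>k::nat. y k \<in> A" "\<forall>k. 0 < t k" "t \<longlonglongrightarrow> 0"
    "(\<lambda>k. (y k - p) /\<^sub>R t k) \<longlonglongrightarrow> h" unfolding contingent_def by blast
  from topological_tendstoD[OF contingent_sequence_tendsto[OF *(2-)] assms(2,3)]
  obtain N where N: "\<And>k. k \<ge> N \<Longrightarrow> y k \<in> U" by (auto simp: eventually_sequentially)
  show ?thesis unfolding contingent_def
    using * N LIMSEQ_ignore_initial_segment[OF *(3), of N] LIMSEQ_ignore_initial_segment[OF *(4), of N]
    by (intro exI[of _ "\<lambda>k. y (k + N)"] exI[of _ "\<lambda>k. t (k + N)"]) auto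
qed

lemma contingent_interval: "0 < a \<Longrightarrow> contingent {0..a} (0::real) 1"
  unfolding contingent_def
  using LIMSEQ_inverse_real_of_nat tendsto_mult_right_zero[OF LIMSEQ_inverse_real_of_nat, of a]
  by (intro exI[of _ "\<lambda>k. a * inverse (real (Suc k))"])
     (auto simp: divide_simps simp del: of_nat_Suc)

lemma contingent_UNIV: "contingent UNIV p h"
  unfolding contingent_def
  by (intro exI[of _ "\<lambda>k. p + inverse (real (Suc k)) *\<^sub>R h"] exI[of _ "\<lambda>k. inverse (real (Suc k))"])
     (use LIMSEQ_inverse_real_of_nat in auto)

text \<open>At scale \<open>t\<close> the function changes sign between \<open>p + t *\<^sub>R h - (\<eta> * t) *\<^sub>R g\<close> and
  \<open>p + t *\<^sub>R h + (\<eta> * t) *\<^sub>R g\<close>, so it vanishes at a point at distance \<open>O(\<eta> * t)\<close> from \<open>p + t *\<^sub>R h\<close>.\<close>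

lemma contingent_level_set:
  fixes f :: "'a::real_inner \<Rightarrow> real"
  assumes U: "open U" "p \<in> U" and f: "(f has_derivative (\<lambda>h. h \<bullet> g)) (at p)" and c: "continuous_on U f"
    and p: "f p = 0" and g: "g \<noteq> 0" and h: "h \<bullet> g = 0"
  shows "contingent {x\<in>U. f x = 0} p h"
proof -
  have key: "\<exists>y t. y \<in> U \<and> f y = 0 \<and> 0 < t \<and> t < e \<and> norm ((y - p) /\<^sub>R t - h) \<le> e" if e: "e > 0" for e :: real
  proof -
    define \<eta> where "\<eta> = e / norm g"
    have \<eta>: "\<eta> > 0" using e g by (simp add: \<eta>_def)
    obtain d where d: "d > 0" "ball p d \<subseteq> U" using U openE by blast
    define M where "M = norm h + \<eta> * norm g + 1"
    have M: "M > 0" using \<eta> by (simp add: M_def add_nonneg_pos)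
    have e2: "\<eta> * (g \<bullet> g) / (2 * M) > 0" using \<eta> g M by simp
    from f[unfolded has_derivative_at_alt, THEN conjunct2, rule_format, OF e2]
    obtain d2 where d2: "d2 > 0" "\<And>y. norm (y - p) < d2 \<Longrightarrow>
      norm (f y - f p - (y - p) \<bullet> g) \<le> \<eta> * (g \<bullet> g) / (2 * M) * norm (y - p)" by blast
    define t where "t = min (e / 2) (min d d2 / (2 * M))"
    have t: "t > 0" "t < e" "t * M < d" "t * M < d2"
    proof -
      show "t > 0" "t < e" using e d d2 M by (auto simp: t_def)
      have "t * M \<le> (min d d2 / (2 * M)) * M" using M by (intro mult_right_mono) (auto simp: t_def)
      also have "\<dots> = min d d2 / 2" using M by simp
      finally show "t * M < d" "t * M < d2" using d(1) d2(1) by auto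
    qed
    define \<gamma> where "\<gamma> = (\<lambda>c. p + t *\<^sub>R h + (c * t) *\<^sub>R g)"
    have n: "norm (\<gamma> c - p) \<le> t * M" if "\<bar>c\<bar> \<le> \<eta>" for c
    proof -
      have "norm (\<gamma> c - p) \<le> t * norm h + \<bar>c\<bar> * t * norm g"
        unfolding \<gamma>_def using t(1) norm_triangle_ineq[of "t *\<^sub>R h" "(c * t) *\<^sub>R g"] by (simp add: abs_mult add.assoc)
      also have "\<dots> \<le> t * norm h + \<eta> * t * norm g" using that t(1) by (intro add_left_mono mult_right_mono) auto
      also have "\<dots> \<le> t * M" using t(1) by (simp add: M_def algebra_simps)
      finally show ?thesis .
    qed
    have est: "\<bar>f (\<gamma> c) - c * t * (g \<bullet> g)\<bar> \<le> \<eta> * (g \<bullet> g) / 2 * t" if "\<bar>c\<bar> \<le> \<eta>" for c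
    proof -
      have "\<bar>f (\<gamma> c) - (\<gamma> c - p) \<bullet> g\<bar> \<le> \<eta> * (g \<bullet> g) / (2 * M) * norm (\<gamma> c - p)"
        using d2(2)[of "\<gamma> c"] n[OF that] t(4) p by simp
      also have "\<dots> \<le> \<eta> * (g \<bullet> g) / (2 * M) * (t * M)" using n[OF that] e2 by (intro mult_left_mono) auto
      also have "\<dots> = \<eta> * (g \<bullet> g) / 2 * t" using M by simp
      finally show ?thesis by (simp add: \<gamma>_def inner_add_left h)
    qed
    have gg: "\<eta> * (g \<bullet> g) * t > 0" using \<eta> g t by simp
    have "\<exists>c\<ge>-\<eta>. c \<le> \<eta> \<and> f (\<gamma> c) = 0"
    proof (rule IVT')
      show "f (\<gamma> (-\<eta>)) \<le> 0" "0 \<le> f (\<gamma> \<eta>)"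
        using est[of \<eta>] est[of "-\<eta>"] \<eta> gg unfolding abs_le_iff by auto
      show "continuous_on {-\<eta>..\<eta>} (\<lambda>c. f (\<gamma> c))"
      proof (rule continuous_on_compose2[OF c])
        show "continuous_on {-\<eta>..\<eta>} \<gamma>" unfolding \<gamma>_def by (intro continuous_intros)
        show "\<gamma> ` {-\<eta>..\<eta>} \<subseteq> U"
        proof
          fix y assume "y \<in> \<gamma> ` {-\<eta>..\<eta>}"
          then obtain c where "c \<in> {-\<eta>..\<eta>}" and y: "y = \<gamma> c" by blast
          then have "\<bar>c\<bar> \<le> \<eta>" by auto
          then have "dist p y < d" using n[of c] t(3) by (simp add: y dist_norm norm_minus_commute)
          then show "y \<in> U" using d by auto
        qed
      qed
    qed (use \<eta> in simp)
    then obtain c where "-\<eta> \<le> c" "c \<le> \<eta>" and c: "f (\<gamma> c) = 0" by blast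
    then have c: "\<bar>c\<bar> \<le> \<eta>" "f (\<gamma> c) = 0" by auto
    show ?thesis
    proof (intro exI conjI)
      show "f (\<gamma> c) = 0" "0 < t" "t < e" using c t by auto
      show "\<gamma> c \<in> U" using n[OF c(1)] t(3) d by (auto simp: subset_iff dist_norm norm_minus_commute)
      have "(\<gamma> c - p) /\<^sub>R t - h = c *\<^sub>R g" using t(1) by (simp add: \<gamma>_def algebra_simps)
      then show "norm ((\<gamma> c - p) /\<^sub>R t - h) \<le> e"
        using c(1) g by (simp add: \<eta>_def pos_le_divide_eq)
    qed
  qed
  have "\<forall>k. \<exists>yt. fst yt \<in> U \<and> f (fst yt) = 0 \<and> 0 < snd yt \<and> snd yt < inverse (real (Suc k)) \<and>
     norm ((fst yt - p) /\<^sub>R snd yt - h) \<le> inverse (real (Suc k))"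
    using key[of "inverse (real (Suc _))"] by (metis fst_conv inverse_positive_iff_positive of_nat_0_less_iff snd_conv zero_less_Suc)
  then obtain yt where yt: "\<And>k. fst (yt k) \<in> U \<and> f (fst (yt k)) = 0 \<and> 0 < snd (yt k) \<and>
    snd (yt k) < inverse (real (Suc k)) \<and> norm ((fst (yt k) - p) /\<^sub>R snd (yt k) - h) \<le> inverse (real (Suc k))"
    by metis
  show ?thesis unfolding contingent_def
  proof (intro exI conjI allI)
    show "fst (yt k) \<in> {x\<in>U. f x = 0}" "0 < snd (yt k)" for k using yt by auto
    show "(\<lambda>k. snd (yt k)) \<longlonglongrightarrow> 0"
      by (rule tendsto_sandwich[OF _ _ tendsto_const LIMSEQ_inverse_real_of_nat])
        (use yt in \<open>auto intro!: always_eventually less_imp_le\<close>)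
    have "(\<lambda>k. (fst (yt k) - p) /\<^sub>R snd (yt k) - h) \<longlonglongrightarrow> 0"
      by (rule Lim_null_comparison[OF _ LIMSEQ_inverse_real_of_nat]) (use yt in auto)
    then show "(\<lambda>k. (fst (yt k) - p) /\<^sub>R snd (yt k)) \<longlonglongrightarrow> h" by (simp add: LIM_zero_iff)
  qed
qed

lemma unit_gradient_derivative_perp:
  assumes s: "submersion_on f g U" "p \<in> U" and N': "strict_derivative (\<lambda>x. sgn (g x)) N' p UNIV"
  shows "N' h \<bullet> sgn (g p) = 0"
proof -
  have d: "((\<lambda>x. sgn (g x)) has_derivative N') (at p)"
    using strict_derivative_imp_has_derivative[OF N'] by simp
  have D: "((\<lambda>x. sgn (g x) \<bullet> sgn (g x)) has_derivative (\<lambda>h. sgn (g p) \<bullet> N' h + N' h \<bullet> sgn (g p))) (at p within U)"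
    by (intro has_derivative_inner has_derivative_at_withinI[OF d])
  have one: "sgn (g x) \<bullet> sgn (g x) = 1" if "x \<in> U" for x
    using submersion_onD(3)[OF s(1) that] by (simp add: dot_square_norm norm_sgn)
  have "contingent U p h"
    using contingent_open_Int[OF contingent_UNIV submersion_onD(1)[OF s] s(2), of h] by simp
  from contingent_unique[OF D has_derivative_const one one[OF s(2)] this]
  show ?thesis by (simp add: inner_commute)
qed


section \<open>Obstacles and their normals\<close>

lemma Ck_on_subset: "Ck_on k f U \<Longrightarrow> V \<subseteq> U \<Longrightarrow> Ck_on k f V"
proof (induction k arbitrary: f)
  case 0
  then show ?case using continuous_on_subset by auto
next
  case (Suc k)
  then show ?case by (simp add: subset_iff)
qed

lemma defining_function_subset:
  assumes "defining_function S p f g U" "open V" "p \<in> V" "S' \<inter> V = S \<inter> V"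
  shows "defining_function S' p f g (U \<inter> V)"
proof -
  have "smooth_on f (U \<inter> V)"
    using assms(1) Ck_on_subset[of _ f U "U \<inter> V"] unfolding defining_function_def submersion_on_def smooth_on_def by auto
  then show ?thesis using assms unfolding defining_function_def submersion_on_def by auto
qed

lemma defining_function_move: "defining_function S p f g U \<Longrightarrow> x \<in> U \<Longrightarrow> defining_function S x f g U"
  by (simp add: defining_function_def)

lemma defining_functionD:
  assumes "defining_function S p f g U"
  shows "p \<in> U" "submersion_on f g U" "x \<in> U \<Longrightarrow> x \<in> S \<longleftrightarrow> f x \<le> 0"
proof -
  show p: "p \<in> U" "submersion_on f g U" using assms by (simp_all add: defining_function_def)
  have eq: "S \<inter> U = {x\<in>U. f x \<le> 0}" using assms by (simp add: defining_function_def)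
  show "x \<in> U \<Longrightarrow> x \<in> S \<longleftrightarrow> f x \<le> 0" using eqset_imp_iff[OF eq, of x] by simp
qed

lemma defining_function_interior:
  assumes d: "defining_function S p f g U"
  shows "f p < 0 \<Longrightarrow> p \<in> interior S" "0 < f p \<Longrightarrow> p \<notin> closure S" "f p = 0 \<Longrightarrow> p \<in> frontier S"
proof -
  note p = defining_functionD(1)[OF d] and s = defining_functionD(2)[OF d] and S = defining_functionD(3)[OF d]
  note sub = submersion_onD[OF s p]
  have o: "open (U \<inter> f -` {..<0})" "open (U \<inter> f -` {0<..})"
    using continuous_open_preimage[OF sub(6,1)] by auto
  show "p \<in> interior S" if "f p < 0"
    by (rule interiorI[OF o(1)]) (use that p S in auto)
  show "p \<notin> closure S" if "0 < f p"
  proof -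
    have "(U \<inter> f -` {0<..}) \<inter> S = {}" using S by auto
    then have "(U \<inter> f -` {0<..}) \<inter> closure S = {}" using open_Int_closure_eq_empty[OF o(2)] by simp
    then show ?thesis using p that by auto
  qed
  show "p \<in> frontier S" if 0: "f p = 0"
  proof -
    have "p \<in> S" using S p 0 by auto
    moreover have "p \<notin> interior S"
    proof
      assume i: "p \<in> interior S"
      have "(\<lambda>h. h \<bullet> g p) = (\<lambda>h. 0)"
      proof (rule differential_zero_maxmin[OF _ _ sub(2)])
        show "p \<in> interior S \<inter> U" "open (interior S \<inter> U)" using i p sub(1) by auto
        show "(\<forall>y\<in>interior S \<inter> U. f y \<le> f p) \<or> (\<forall>y\<in>interior S \<inter> U. f p \<le> f y)"
          using S 0 interior_subset[of S] by (intro disjI1) auto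
      qed
      from fun_cong[OF this, of "g p"] have "g p \<bullet> g p = 0" .
      then show False using sub(3) by simp
    qed
    ultimately show ?thesis unfolding frontier_def using closure_subset by auto
  qed
qed

lemma defining_function_frontier:
  assumes "defining_function S p f g U"
  shows "p \<in> frontier S \<longleftrightarrow> f p = 0"
proof (cases "f p" "0::real" rule: linorder_cases)
  case less
  then show ?thesis using defining_function_interior(1)[OF assms] by (simp add: frontier_def)
next
  case equal
  then show ?thesis using defining_function_interior(3)[OF assms] by simp
next
  case greater
  then show ?thesis using defining_function_interior(2)[OF assms] by (simp add: frontier_def)
qed

lemma derivative_direction:
  fixes f :: "'a::real_inner \<Rightarrow> real"
  assumes f: "(f has_derivative (\<lambda>h. h \<bullet> g)) (at p)" and h: "h \<bullet> g > 0"
  shows "\<exists>d>0. \<forall>t. 0 < t \<and> t < d \<longrightarrow> f p < f (p + t *\<^sub>R h)"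
proof -
  have "((\<lambda>t. f (p + t *\<^sub>R h)) has_derivative (\<lambda>t. (t *\<^sub>R h) \<bullet> g)) (at 0)"
    by (rule has_derivative_compose[of "\<lambda>t. p + t *\<^sub>R h" _ _ _ f, OF _ ])
       (auto intro!: derivative_eq_intros simp: f)
  then have "((\<lambda>t. f (p + t *\<^sub>R h)) has_real_derivative (h \<bullet> g)) (at 0)"
    unfolding has_field_derivative_def by (simp add: mult.commute[of _ "h \<bullet> g"])
  from DERIV_pos_inc_right[OF this h] show ?thesis by auto
qed

text \<open>If the unit gradients differed, their difference would be a direction that enters the set according to
  one defining function and leaves it according to the other.\<close>

lemma defining_function_sgn_unique:
  assumes d1: "defining_function S p f1 g1 U1" and d2: "defining_function S p f2 g2 U2"
    and p: "p \<in> frontier S"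
  shows "sgn (g1 p) = sgn (g2 p)"
proof (rule ccontr)
  assume ne: "sgn (g1 p) \<noteq> sgn (g2 p)"
  have p0: "f1 p = 0" "f2 p = 0" using defining_function_frontier[OF d1] defining_function_frontier[OF d2] p by auto
  from d1 d2 have s: "submersion_on f1 g1 U1" "p \<in> U1" "submersion_on f2 g2 U2" "p \<in> U2"
    "\<And>x. x \<in> U1 \<Longrightarrow> x \<in> S \<longleftrightarrow> f1 x \<le> 0" "\<And>x. x \<in> U2 \<Longrightarrow> x \<in> S \<longleftrightarrow> f2 x \<le> 0"
    using defining_functionD by blast+
  note s1 = submersion_onD[OF s(1,2)] and s2 = submersion_onD[OF s(3,4)]
  let ?a = "sgn (g1 p)" and ?b = "sgn (g2 p)"
  have n: "norm ?a = 1" "norm ?b = 1" using s1(3) s2(3) by (auto simp: norm_sgn)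
  define h where "h = ?b - ?a"
  have "h \<bullet> h > 0" using ne by (simp add: h_def)
  moreover have aa: "?a \<bullet> ?a = 1" "?b \<bullet> ?b = 1" "?b \<bullet> ?a = ?a \<bullet> ?b"
    using n by (simp_all only: dot_square_norm inner_commute[of ?b ?a]) simp_all
  moreover have "h \<bullet> h = ?a \<bullet> ?a + ?b \<bullet> ?b - 2 * (?a \<bullet> ?b)"
    unfolding h_def inner_diff_left inner_diff_right using aa(3) by simp
  ultimately have ab: "?a \<bullet> ?b < 1" by simp
  have "h \<bullet> ?b > 0" "(- h) \<bullet> ?a > 0"
    using ab aa unfolding h_def inner_diff_left inner_minus_left by linarith+
  then have "h \<bullet> g2 p > 0" "(- h) \<bullet> g1 p > 0"
    using s1(3) s2(3) by (simp_all add: sgn_div_norm zero_less_mult_iff zero_less_divide_iff mult_less_0_iff divide_less_0_iff)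
  have "((\<lambda>x. - f1 x) has_derivative (\<lambda>x. x \<bullet> (- g1 p))) (at p)"
    using has_derivative_minus[OF s1(2)] by simp
  from derivative_direction[OF this, of h] \<open>(- h) \<bullet> g1 p > 0\<close>
  obtain d1 where d1: "d1 > 0" "\<And>t. 0 < t \<Longrightarrow> t < d1 \<Longrightarrow> f1 (p + t *\<^sub>R h) < 0" using p0 by auto
  from derivative_direction[OF s2(2) \<open>h \<bullet> g2 p > 0\<close>]
  obtain d2 where d2: "d2 > 0" "\<And>t. 0 < t \<Longrightarrow> t < d2 \<Longrightarrow> 0 < f2 (p + t *\<^sub>R h)" using p0 by auto
  have "((\<lambda>t. p + t *\<^sub>R h) \<longlongrightarrow> p + 0 *\<^sub>R h) (at_right 0)" by (intro tendsto_intros)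
  from topological_tendstoD[OF this, of "U1 \<inter> U2"] have "\<forall>\<^sub>F t in at_right 0. p + t *\<^sub>R h \<in> U1 \<inter> U2"
    using s1(1) s2(1) s(2,4) by auto
  moreover have "\<forall>\<^sub>F t in at_right 0. t < min d1 d2 \<and> 0 < t"
    using d1(1) d2(1) by (auto simp: eventually_at_right_field intro!: exI[of _ "min d1 d2"])
  ultimately have "\<forall>\<^sub>F t::real in at_right 0. False"
  proof eventually_elim
    case (elim t)
    then have "f1 (p + t *\<^sub>R h) < 0" "0 < f2 (p + t *\<^sub>R h)" using d1 d2 by auto
    then show ?case using s(5,6)[of "p + t *\<^sub>R h"] elim by simp
  qed
  then show False by simp
qed

lemma outward_normal_eq:
  assumes "defining_function S p f g U" "p \<in> frontier S"
  shows "outward_normal S p = sgn (g p)"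
  unfolding outward_normal_def
proof (rule the_equality)
  show "\<exists>f g' U. defining_function S p f g' U \<and> sgn (g p) = sgn (g' p)" using assms(1) by blast
  fix u assume "\<exists>f g U. defining_function S p f g U \<and> u = sgn (g p)"
  then obtain f' g' U' where d: "defining_function S p f' g' U'" and u: "u = sgn (g' p)" by auto
  show "u = sgn (g p)" unfolding u by (rule defining_function_sgn_unique[OF d assms])
qed

text \<open>A segment from \<open>p\<close> into the convex set cannot start in a direction in which \<open>f\<close> increases. For an interior
  point the inequality may be applied to a point pushed further along the gradient.\<close>

lemma convex_supporting_normal:
  assumes d: "defining_function S p f g U" and p: "p \<in> frontier S" "p \<in> S" and S: "convex S"
  shows "y \<in> S \<Longrightarrow> (y - p) \<bullet> g p \<le> 0" "y \<in> interior S \<Longrightarrow> (y - p) \<bullet> g p < 0"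
proof -
  have p0: "f p = 0" using defining_function_frontier[OF d] p by auto
  note s = defining_functionD(2,1,3)[OF d]
  note s1 = submersion_onD[OF s(1,2)]
  have le: "(y - p) \<bullet> g p \<le> 0" if y: "y \<in> S" for y
  proof (rule ccontr)
    assume "\<not> ?thesis"
    then have "(y - p) \<bullet> g p > 0" by simp
    from derivative_direction[OF s1(2) this] obtain d where d: "d > 0"
      "\<And>t. 0 < t \<Longrightarrow> t < d \<Longrightarrow> 0 < f (p + t *\<^sub>R (y - p))" using p0 by auto
    have "((\<lambda>t. p + t *\<^sub>R (y - p)) \<longlongrightarrow> p + 0 *\<^sub>R (y - p)) (at_right 0)" by (intro tendsto_intros)
    from topological_tendstoD[OF this, of U] have "\<forall>\<^sub>F t in at_right 0. p + t *\<^sub>R (y - p) \<in> U"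
      using s1(1) s(2) by auto
    moreover have "\<forall>\<^sub>F t in at_right 0. t < min d 1 \<and> 0 < t"
      using d by (auto simp: eventually_at_right_field intro!: exI[of _ "min d 1"])
    ultimately have "\<forall>\<^sub>F t::real in at_right 0. False"
    proof eventually_elim
      case (elim t)
      have "p + t *\<^sub>R (y - p) = (1 - t) *\<^sub>R p + t *\<^sub>R y" by (simp add: algebra_simps)
      also have "\<dots> \<in> S" using elim by (intro convexD[OF S p(2) y]) auto
      finally have "p + t *\<^sub>R (y - p) \<in> S \<inter> U" using elim by simp
      then show ?case using s(3) elim d(2)[of t] by simp
    qed
    then show False by simp
  qed
  show "y \<in> S \<Longrightarrow> (y - p) \<bullet> g p \<le> 0" by (rule le)
  assume "y \<in> interior S"
  then obtain e where e: "e > 0" "cball y e \<subseteq> S" unfolding mem_interior_cball by blast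
  have "y + e *\<^sub>R sgn (g p) \<in> cball y e" using e s1(3) by (simp add: dist_norm norm_sgn)
  then have "(y + e *\<^sub>R sgn (g p) - p) \<bullet> g p \<le> 0" using e le by blast
  moreover have "e * (sgn (g p) \<bullet> g p) > 0" using e s1(3) by (simp add: sgn_div_norm)
  ultimately show "(y - p) \<bullet> g p < 0" by (simp add: inner_diff_left inner_add_left)
qed

lemma strictly_convex_imp_convex:
  assumes "strictly_convex_set S" shows "convex S"
  unfolding convex_contains_open_segment
proof (intro ballI)
  fix a b assume "a \<in> S" "b \<in> S"
  then show "open_segment a b \<subseteq> S"
    using assms interior_subset[of S] unfolding strictly_convex_set_def by (cases "a = b") auto
qed

locale billiard_table =
  fixes K :: "nat \<Rightarrow> 'a::euclidean_space set" and z :: nat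
  assumes table: "open_billiard K z"
begin

abbreviation "Q \<equiv> obstacles K z"
abbreviation "\<nu> \<equiv> outward_normal Q"
abbreviation "I \<equiv> {1..z}"

lemma obstacle:
  assumes "i \<in> I"
  shows "K i \<noteq> {}" "compact (K i)" "closed (K i)" "strictly_convex_set (K i)" "convex (K i)"
    "smooth_boundary (K i)" "K i \<subseteq> Q"
proof -
  show *: "K i \<noteq> {}" "compact (K i)" "strictly_convex_set (K i)" "smooth_boundary (K i)"
    using table assms unfolding open_billiard_def by auto
  show "closed (K i)" "convex (K i)" using * compact_imp_closed strictly_convex_imp_convex by auto
  show "K i \<subseteq> Q" using assms unfolding obstacles_def by blast
qed

lemma obstacles_disjoint: "i \<in> I \<Longrightarrow> j \<in> I \<Longrightarrow> x \<in> K i \<Longrightarrow> x \<in> K j \<Longrightarrow> i = j"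
proof (rule ccontr)
  assume "i \<in> I" "j \<in> I" "x \<in> K i" "x \<in> K j" "i \<noteq> j"
  then have "K i \<inter> K j = {}" using table unfolding open_billiard_def by simp
  then show False using \<open>x \<in> K i\<close> \<open>x \<in> K j\<close> by blast
qed

lemma closed_obstacles: "closed Q"
  unfolding obstacles_def using obstacle(3) by (intro closed_UN) simp_all

lemma isolated_obstacle:
  assumes "i \<in> I"
  obtains V where "open V" "K i \<subseteq> V" "Q \<inter> V = K i \<inter> V"
proof
  let ?V = "- (\<Union>j\<in>I - {i}. K j)"
  show "open ?V" using obstacle by (intro open_Compl closed_UN) auto
  show "K i \<subseteq> ?V" using obstacles_disjoint assms by blast
  show "Q \<inter> ?V = K i \<inter> ?V" using assms unfolding obstacles_def by blast
qed

lemma interior_obstacles: "i \<in> I \<Longrightarrow> x \<in> K i \<Longrightarrow> x \<in> interior Q \<longleftrightarrow> x \<in> interior (K i)"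
proof -
  assume i: "i \<in> I" "x \<in> K i"
  then obtain V where V: "open V" "K i \<subseteq> V" "Q \<inter> V = K i \<inter> V" using isolated_obstacle by blast
  have "interior Q \<inter> V \<subseteq> K i" using V interior_subset by blast
  then have "x \<in> interior (K i)" if "x \<in> interior Q"
    using that i V by (intro interiorI[of "interior Q \<inter> V"]) auto
  then show ?thesis using interior_mono[OF obstacle(7)[OF i(1)]] by blast
qed

lemma frontier_obstacle: "i \<in> I \<Longrightarrow> x \<in> K i \<Longrightarrow> x \<in> frontier Q \<longleftrightarrow> x \<in> frontier (K i)"
  using interior_obstacles[of i x] obstacle(7)[of i] obstacle(3)[of i] closed_obstacles unfolding frontier_def
  by (simp add: closure_closed subset_iff)

lemma frontier_obstacles_cases:
  assumes "x \<in> frontier Q"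
  obtains i where "i \<in> I" "x \<in> K i" "x \<in> frontier (K i)"
proof -
  have "x \<in> Q" using assms frontier_subset_closed[OF closed_obstacles] by blast
  then obtain i where "i \<in> I" "x \<in> K i" unfolding obstacles_def by blast
  with that show thesis using frontier_obstacle assms by blast
qed

lemma frontier_obstacleD: "i \<in> I \<Longrightarrow> x \<in> frontier (K i) \<Longrightarrow> x \<in> K i \<and> x \<in> frontier Q"
  using frontier_subset_closed[OF obstacle(3), of i] frontier_obstacle[of i x] by auto

lemma defining_function_obstacles:
  assumes "i \<in> I" "p \<in> frontier (K i)"
  obtains f g U where "defining_function Q p f g U" "defining_function (K i) p f g U" "outward_normal Q p = sgn (g p)"
proof -
  obtain f g U where d: "defining_function (K i) p f g U"
    using obstacle(6)[OF assms(1)] assms(2) unfolding smooth_boundary_def by blast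
  obtain V where V: "open V" "K i \<subseteq> V" "Q \<inter> V = K i \<inter> V" using isolated_obstacle[OF assms(1)] by blast
  have p: "p \<in> V" "p \<in> frontier Q" using frontier_obstacleD[OF assms] V by auto
  have "defining_function Q p f g (U \<inter> V)" "defining_function (K i) p f g (U \<inter> V)"
    using defining_function_subset[OF d V(1) p(1)] V(3) by auto
  with that outward_normal_eq[OF _ p(2)] show thesis by blast
qed

lemma normal_supporting:
  assumes "i \<in> I" "p \<in> frontier (K i)"
  shows "norm (\<nu> p) = 1" "y \<in> K i \<Longrightarrow> \<nu> p \<bullet> (y - p) \<le> 0" "y \<in> interior (K i) \<Longrightarrow> \<nu> p \<bullet> (y - p) < 0"
proof -
  obtain f g U where d: "defining_function (K i) p f g U" "\<nu> p = sgn (g p)"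
    using defining_function_obstacles[OF assms] by blast
  then have g: "g p \<noteq> 0" unfolding defining_function_def submersion_on_def by blast
  show "norm (\<nu> p) = 1" using d(2) g by (simp add: norm_sgn)
  note s = convex_supporting_normal[OF d(1) assms(2) frontier_obstacleD[OF assms, THEN conjunct1] obstacle(5)[OF assms(1)]]
  show "y \<in> K i \<Longrightarrow> \<nu> p \<bullet> (y - p) \<le> 0" "y \<in> interior (K i) \<Longrightarrow> \<nu> p \<bullet> (y - p) < 0"
    using s[of y] g by (simp_all add: d(2) sgn_div_norm inner_commute divide_le_0_iff divide_less_0_iff mult_le_0_iff mult_less_0_iff)
qed

lemma norm_normal: "p \<in> frontier Q \<Longrightarrow> norm (\<nu> p) = 1"
  by (erule frontier_obstacles_cases) (rule normal_supporting(1))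

text \<open>Local data at a boundary point: a function vanishing on the boundary and a field \<open>N\<close> extending the
  normal, both strictly differentiable. Dispersion of the billiard has its origin in \<open>N' h \<bullet> h \<ge> 0\<close>: adding
  the supporting inequalities at two boundary points shows that the normal of a convex body is monotone.
  The last property says that the inward side of the boundary is interior.\<close>

lemma normal_field:
  assumes p: "p \<in> frontier Q"
  obtains f N N' where "strict_derivative f (\<lambda>h. h \<bullet> \<nu> p) p UNIV" "\<forall>\<^sub>F x in nhds p. x \<in> frontier Q \<longrightarrow> f x = 0"
    "strict_derivative N N' p UNIV" "\<forall>\<^sub>F x in nhds p. x \<in> frontier Q \<longrightarrow> N x = \<nu> x"
    "\<And>h. h \<bullet> \<nu> p = 0 \<Longrightarrow> N' h \<bullet> h \<ge> 0" "\<And>h. N' h \<bullet> \<nu> p = 0"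
    "\<forall>h. 0 < h \<bullet> \<nu> p \<longrightarrow> (\<exists>d>0. \<forall>t. 0 < t \<and> t < d \<longrightarrow> p - t *\<^sub>R h \<in> interior Q)"
proof -
  obtain i where i: "i \<in> I" "p \<in> frontier (K i)" using frontier_obstacles_cases[OF p] by blast
  obtain f g U where d: "defining_function Q p f g U" "\<nu> p = sgn (g p)"
    using defining_function_obstacles[OF i] by blast
  then have s: "submersion_on f g U" "p \<in> U" unfolding defining_function_def by auto
  note s1 = submersion_onD[OF s]
  have fr: "x \<in> frontier Q \<longleftrightarrow> f x = 0" if "x \<in> U" for x
    using defining_function_frontier[OF defining_function_move[OF d(1) that]] .
  have nu: "\<nu> x = sgn (g x)" if "x \<in> U" "x \<in> frontier Q" for x
    using outward_normal_eq[OF defining_function_move[OF d(1) that(1)] that(2)] .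
  have ev: "\<forall>\<^sub>F x in nhds p. x \<in> U" by (rule eventually_nhds_in_open[OF s1(1) s(2)])
  obtain g' where "strict_derivative g g' p UNIV" using s1(5) by blast
  from strict_derivative_sgn[OF this _ s1(3)] obtain N' where
    N': "strict_derivative (\<lambda>x. sgn (g x)) N' p UNIV" by auto
  have Nd: "((\<lambda>x. sgn (g x)) has_derivative N') (at p)"
    using strict_derivative_imp_has_derivative[OF N'] by simp
  have perp: "N' h \<bullet> \<nu> p = 0" for h
    unfolding d(2) by (rule unit_gradient_derivative_perp[OF s N'])
  have conv: "N' h \<bullet> h \<ge> 0" if h: "h \<bullet> \<nu> p = 0" for h
  proof -
    have "h \<bullet> g p = 0" using h s1(3) by (simp add: d(2) sgn_div_norm)
    then have "contingent {x\<in>U. f x = 0} p h"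
      using fr[OF s(2)] p by (intro contingent_level_set[OF s1(1) s(2) s1(2,6) _ s1(3)]) auto
    moreover obtain V where V: "open V" "K i \<subseteq> V" "Q \<inter> V = K i \<inter> V" using isolated_obstacle[OF i(1)] by blast
    ultimately have "contingent ({x\<in>U. f x = 0} \<inter> V) p h"
      using frontier_obstacleD[OF i] by (intro contingent_open_Int) auto
    then obtain y t where y: "\<forall>k::nat. y k \<in> {x\<in>U. f x = 0} \<inter> V" and t: "\<forall>k. 0 < t k" "t \<longlonglongrightarrow> 0"
      and lim: "(\<lambda>k. (y k - p) /\<^sub>R t k) \<longlonglongrightarrow> h" unfolding contingent_def by blast
    have yi: "y k \<in> U" "y k \<in> frontier (K i)" "y k \<in> frontier Q" for k
    proof -
      show "y k \<in> U" "y k \<in> frontier Q" using y fr by blast+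
      then have "y k \<in> K i" using y V frontier_subset_closed[OF closed_obstacles] by blast
      then show "y k \<in> frontier (K i)" using frontier_obstacle[OF i(1)] \<open>y k \<in> frontier Q\<close> by blast
    qed
    have "(\<lambda>k. (sgn (g (y k)) - sgn (g p)) /\<^sub>R t k) \<longlonglongrightarrow> N' h"
      by (rule contingent_derivative_tendsto[OF Nd _ t lim]) simp
    then have "(\<lambda>k. ((sgn (g (y k)) - sgn (g p)) /\<^sub>R t k) \<bullet> ((y k - p) /\<^sub>R t k)) \<longlonglongrightarrow> N' h \<bullet> h"
      by (intro tendsto_inner lim)
    moreover have "((sgn (g (y k)) - sgn (g p)) /\<^sub>R t k) \<bullet> ((y k - p) /\<^sub>R t k) \<ge> 0" for k
    proof -
      have "\<nu> p \<bullet> (y k - p) \<le> 0" "\<nu> (y k) \<bullet> (p - y k) \<le> 0"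
        using normal_supporting(2)[OF i] normal_supporting(2)[OF i(1) yi(2)] frontier_obstacleD[OF i(1)] i(2) yi(2) by blast+
      then have "0 \<le> (sgn (g (y k)) - sgn (g p)) \<bullet> (y k - p)"
        using nu[OF yi(1,3), of k] d(2) by (simp add: inner_diff_left inner_diff_right)
      then show ?thesis using t(1) by (simp add: zero_le_mult_iff less_imp_le)
    qed
    ultimately show ?thesis by (intro LIMSEQ_le_const) auto
  qed
  show thesis
  proof (rule that)
    have "bounded_linear (\<lambda>r. r / norm (g p))" by (rule bounded_linear_divide)
    from strict_derivative_compose_linear[OF s1(4)[of UNIV] _ this]
    show "strict_derivative (\<lambda>x. f x / norm (g p)) (\<lambda>h. h \<bullet> \<nu> p) p UNIV"
      by (simp add: d(2) sgn_div_norm divide_inverse mult.commute)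
    show "\<forall>\<^sub>F x in nhds p. x \<in> frontier Q \<longrightarrow> f x / norm (g p) = 0"
      using ev by eventually_elim (use fr in auto)
    show "\<forall>\<^sub>F x in nhds p. x \<in> frontier Q \<longrightarrow> sgn (g x) = \<nu> x"
      using ev by eventually_elim (use nu in auto)
    show "\<forall>h. 0 < h \<bullet> \<nu> p \<longrightarrow> (\<exists>d>0. \<forall>t. 0 < t \<and> t < d \<longrightarrow> p - t *\<^sub>R h \<in> interior Q)"
    proof (intro allI impI)
      fix h assume "0 < h \<bullet> \<nu> p"
      then have h: "h \<bullet> g p > 0" using s1(3) by (simp add: d(2) sgn_div_norm zero_less_divide_iff zero_less_mult_iff)
      have "((\<lambda>x. - f x) has_derivative (\<lambda>x. x \<bullet> (- g p))) (at p)"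
        using has_derivative_minus[OF s1(2)] by simp
      from derivative_direction[OF this, of "- h"] h fr[OF s(2)] p
      obtain d1 where d1: "d1 > 0" "\<And>t. 0 < t \<Longrightarrow> t < d1 \<Longrightarrow> f (p - t *\<^sub>R h) < 0" by auto
      obtain e where e: "e > 0" "ball p e \<subseteq> U" using s1(1) s(2) openE by blast
      have h0: "norm h > 0" using h by auto
      show "\<exists>d>0. \<forall>t. 0 < t \<and> t < d \<longrightarrow> p - t *\<^sub>R h \<in> interior Q"
      proof (intro exI[of _ "min d1 (e / norm h)"] conjI allI impI)
        show "min d1 (e / norm h) > 0" using d1 e h0 by simp
        fix t assume t: "0 < t \<and> t < min d1 (e / norm h)"
        then have "p - t *\<^sub>R h \<in> ball p e" using h0 by (simp add: dist_norm pos_less_divide_eq)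
        then have "p - t *\<^sub>R h \<in> U" using e by blast
        then show "p - t *\<^sub>R h \<in> interior Q"
          using defining_function_interior(1)[OF defining_function_move[OF d(1)]] d1(2) t by auto
      qed
    qed
  qed (use N' conv perp in auto)
qed

end


section \<open>The billiard map and its strict derivative\<close>

lemma near_tendsto: "isCont f x \<Longrightarrow> (f \<longlongrightarrow> f x) (near x S)"
  unfolding near_def isCont_def tendsto_at_iff_tendsto_nhds by (rule tendsto_mono[OF inf_le1])

context billiard_table
begin

text \<open>No normalisation of the velocity: \<open>exterior\<close> is then open, so that derivatives at exterior states are
  unique. A state on the boundary must not point into its obstacle, since then its first hit would be
  on the same obstacle.\<close>

definition states :: "('a \<times> 'a) set" where
  "states = {(p, v). v \<noteq> 0 \<and> (p \<in> Q \<longrightarrow> p \<in> frontier Q \<and> 0 \<le> \<nu> p \<bullet> v)}"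

definition outgoing :: "('a \<times> 'a) set" where
  "outgoing = {y \<in> states. fst y \<in> frontier Q}"

definition exterior :: "('a \<times> 'a) set" where
  "exterior = {(p, v). v \<noteq> 0 \<and> p \<notin> Q}"

definition impact :: "'a \<times> 'a \<Rightarrow> 'a" where
  "impact y = fst y + flight_time Q y *\<^sub>R snd y"

lemma billiard_impact: "billiard Q y = (impact y, reflected Q (impact y) (snd y))"
  by (simp add: billiard_def Let_def impact_def)

lemma outgoing_states: "outgoing \<subseteq> states"
  by (auto simp: outgoing_def)

lemma exterior_states: "exterior \<subseteq> states"
  by (auto simp: exterior_def states_def)

lemma open_exterior: "open exterior"
proof -
  have "exterior = (- Q) \<times> (- {0})" by (auto simp: exterior_def)
  then show ?thesis
    using open_Times[OF open_Compl[OF closed_obstacles] open_Compl[OF closed_singleton[of "0::'a"]]] by simp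
qed

lemma boundary_states_outgoing: "boundary_states Q \<subseteq> outgoing"
  unfolding boundary_states_def outgoing_def states_def by auto

text \<open>The midpoint of the chord would be an interior point on the wrong side of the supporting hyperplane.\<close>

lemma no_return:
  assumes y: "(p, v) \<in> states" and i: "i \<in> I" "p \<in> K i" and t: "t > 0"
  shows "p + t *\<^sub>R v \<notin> K i"
proof
  assume a: "p + t *\<^sub>R v \<in> K i"
  have "p \<in> Q" using i obstacle(7) by blast
  then have p: "p \<in> frontier (K i)" "0 \<le> \<nu> p \<bullet> v" "v \<noteq> 0"
    using y frontier_obstacle[OF i] unfolding states_def by auto
  have "p + (t / 2) *\<^sub>R v \<in> open_segment p (p + t *\<^sub>R v)"
    unfolding in_segment using t p(3) by (auto intro!: exI[of _ "1/2"] simp: algebra_simps simp flip: scaleR_add_left)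
  then have "p + (t / 2) *\<^sub>R v \<in> interior (K i)"
    using obstacle(4)[OF i(1)] i(2) a t p(3) unfolding strictly_convex_set_def by fastforce
  then have "\<nu> p \<bullet> (p + (t / 2) *\<^sub>R v - p) < 0" by (rule normal_supporting(3)[OF i(1) p(1)])
  then show False using p(2) t by (simp add: mult_less_0_iff)
qed

lemma crossing:
  fixes p v :: 'a
  assumes p: "p \<notin> S" and t: "p + t *\<^sub>R v \<in> S" "0 \<le> t" and S: "closed S"
  obtains s where "0 < s" "s \<le> t" "p + s *\<^sub>R v \<in> frontier S"
proof -
  have "closed_segment p (p + t *\<^sub>R v) \<inter> frontier S \<noteq> {}"
    by (rule connected_Int_frontier) (use p t in auto)
  then obtain x where x: "x \<in> closed_segment p (p + t *\<^sub>R v)" "x \<in> frontier S" by blast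
  then obtain u where u: "0 \<le> u" "u \<le> 1" "x = p + (u * t) *\<^sub>R v"
    unfolding in_segment by (auto simp: algebra_simps)
  have "u * t \<noteq> 0"
  proof
    assume "u * t = 0"
    then have "x = p" using u by simp
    then show False using x(2) p frontier_subset_closed[OF S] by blast
  qed
  then have "0 < u * t" using u t by (simp add: less_le)
  moreover have "u * t \<le> t" using u t mult_right_mono[of u 1 t] by simp
  ultimately show thesis using that x(2) u(3) by blast
qed

text \<open>By \<open>no_return\<close> only these points can be hit. They stay away from the initial position,
  which makes the set of hit times closed in spite of the strict inequality \<open>0 < t\<close>.\<close>

definition others :: "'a \<Rightarrow> 'a set" where
  "others p = (\<Union>j\<in>{j\<in>I. p \<notin> K j}. frontier (K j))"

lemma closed_others: "closed (others p)"
  unfolding others_def by (intro closed_UN ballI frontier_closed) simp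

lemma hit_times_others:
  assumes "(p, v) \<in> states"
  shows "hit_times Q (p, v) = {t. 0 \<le> t \<and> p + t *\<^sub>R v \<in> others p}"
proof (intro set_eqI iffI)
  fix t assume "t \<in> hit_times Q (p, v)"
  then have t: "0 < t" "p + t *\<^sub>R v \<in> frontier Q" by (auto simp: hit_times_def)
  from frontier_obstacles_cases[OF t(2)] obtain i where
    i: "i \<in> I" "p + t *\<^sub>R v \<in> K i" "p + t *\<^sub>R v \<in> frontier (K i)" .
  then have "p \<notin> K i" using no_return[OF assms i(1) _ t(1)] by blast
  then show "t \<in> {t. 0 \<le> t \<and> p + t *\<^sub>R v \<in> others p}" using t i by (auto simp: others_def)
next
  fix t assume "t \<in> {t. 0 \<le> t \<and> p + t *\<^sub>R v \<in> others p}"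
  then obtain j where t: "0 \<le> t" and j: "j \<in> I" "p \<notin> K j" "p + t *\<^sub>R v \<in> frontier (K j)"
    by (auto simp: others_def)
  from frontier_obstacleD[OF j(1,3)] have *: "p + t *\<^sub>R v \<in> K j" "p + t *\<^sub>R v \<in> frontier Q" by auto
  then have "t \<noteq> 0" using j(2) by (metis add.right_neutral scaleR_zero_left)
  then show "t \<in> hit_times Q (p, v)" using t * by (simp add: hit_times_def)
qed

lemma flight_time_hit:
  assumes y: "(p, v) \<in> states" and h: "hit_times Q (p, v) \<noteq> {}"
  shows "flight_time Q (p, v) \<in> hit_times Q (p, v)"
proof -
  have bdd: "bdd_below (hit_times Q (p, v))"
    by (rule bdd_belowI[of _ 0]) (auto simp: hit_times_def)
  have "closed ({0..} \<inter> (\<lambda>t. p + t *\<^sub>R v) -` others p)"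
    by (intro closed_Int closed_vimage[OF closed_others] continuous_intros closed_atLeast)
  moreover have "{0..} \<inter> (\<lambda>t. p + t *\<^sub>R v) -` others p = hit_times Q (p, v)"
    unfolding hit_times_others[OF y] by auto
  ultimately show ?thesis
    unfolding flight_time_def using closed_contains_Inf[OF h bdd] by simp
qed

lemma flight_time_le: "t \<in> hit_times Q y \<Longrightarrow> flight_time Q y \<le> t"
  unfolding flight_time_def
  by (rule cInf_lower) (auto simp: hit_times_def intro!: bdd_belowI[of _ 0])

lemma flight_time_pos: "y \<in> states \<Longrightarrow> hit_times Q y \<noteq> {} \<Longrightarrow> 0 < flight_time Q y"
  using flight_time_hit[of "fst y" "snd y"] by (simp add: hit_times_def)

lemma impact_frontier: "y \<in> states \<Longrightarrow> hit_times Q y \<noteq> {} \<Longrightarrow> impact y \<in> frontier Q"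
  using flight_time_hit[of "fst y" "snd y"] by (simp add: hit_times_def impact_def)

lemma impact_others: "y \<in> states \<Longrightarrow> hit_times Q y \<noteq> {} \<Longrightarrow> impact y \<in> others (fst y)"
  using flight_time_hit[of "fst y" "snd y"] hit_times_others[of "fst y" "snd y"] by (simp add: impact_def)

lemma free_path:
  assumes y: "(p, v) \<in> states" and t: "0 \<le> t" "t < flight_time Q (p, v)"
  shows "p + t *\<^sub>R v \<notin> interior Q"
proof
  assume a: "p + t *\<^sub>R v \<in> interior Q"
  then have "p + t *\<^sub>R v \<in> Q" using interior_subset by blast
  then obtain i where i: "i \<in> I" "p + t *\<^sub>R v \<in> K i" unfolding obstacles_def by blast
  show False
  proof (cases "p \<in> K i")
    case True
    have "t \<noteq> 0"
    proof
      assume "t = 0"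
      then have "p \<in> interior Q" "p \<in> Q" using a \<open>p + t *\<^sub>R v \<in> Q\<close> by auto
      then show False using y unfolding states_def frontier_def by auto
    qed
    then show False using no_return[OF y i(1) True] t i(2) by simp
  next
    case False
    from crossing[OF False i(2) t(1) obstacle(3)[OF i(1)]] obtain s where
      s: "0 < s" "s \<le> t" "p + s *\<^sub>R v \<in> frontier (K i)" .
    then have "s \<in> hit_times Q (p, v)" using frontier_obstacleD[OF i(1)] by (simp add: hit_times_def)
    then show False using flight_time_le s t by fastforce
  qed
qed

text \<open>Otherwise the trajectory would be inside the obstacle just before the impact.\<close>

lemma impact_incoming:
  assumes y: "y \<in> states" "hit_times Q y \<noteq> {}"
  shows "snd y \<bullet> \<nu> (impact y) \<le> 0"
proof (rule ccontr)
  assume "\<not> ?thesis"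
  then have pos: "0 < snd y \<bullet> \<nu> (impact y)" by simp
  from normal_field[OF impact_frontier[OF y]]
  have "\<forall>h. 0 < h \<bullet> \<nu> (impact y) \<longrightarrow> (\<exists>d>0. \<forall>t. 0 < t \<and> t < d \<longrightarrow> impact y - t *\<^sub>R h \<in> interior Q)"
    by metis
  with pos obtain d where d: "d > 0" "\<And>t. 0 < t \<Longrightarrow> t < d \<Longrightarrow> impact y - t *\<^sub>R snd y \<in> interior Q" by blast
  define t where "t = min d (flight_time Q y) / 2"
  have t: "0 < t" "t < d" "t < flight_time Q y" using d(1) flight_time_pos[OF y] by (auto simp: t_def)
  have "impact y - t *\<^sub>R snd y = fst y + (flight_time Q y - t) *\<^sub>R snd y"
    by (simp add: impact_def algebra_simps)
  moreover have "impact y - t *\<^sub>R snd y \<in> interior Q" using d(2) t by blast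
  moreover have "fst y + (flight_time Q y - t) *\<^sub>R snd y \<notin> interior Q"
    using free_path[of "fst y" "snd y" "flight_time Q y - t"] t y by simp
  ultimately show False by simp
qed

lemma reflected_normal:
  assumes "q \<in> frontier Q"
  shows "norm (reflected Q q v) = norm v" "\<nu> q \<bullet> reflected Q q v = - (v \<bullet> \<nu> q)"
proof -
  have n: "\<nu> q \<bullet> \<nu> q = 1" using norm_normal[OF assms] by (simp add: dot_square_norm)
  show "\<nu> q \<bullet> reflected Q q v = - (v \<bullet> \<nu> q)"
    by (simp add: reflected_def inner_diff_right n inner_commute)
  have "reflected Q q v \<bullet> reflected Q q v = v \<bullet> v"
    by (simp add: reflected_def inner_diff_left inner_diff_right n inner_commute algebra_simps)
  then show "norm (reflected Q q v) = norm v" by (simp add: norm_eq_sqrt_inner)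
qed

lemma billiard_outgoing:
  assumes "y \<in> states" "hit_times Q y \<noteq> {}"
  shows "billiard Q y \<in> outgoing" "norm (snd (billiard Q y)) = norm (snd y)"
proof -
  note q = impact_frontier[OF assms]
  show n: "norm (snd (billiard Q y)) = norm (snd y)" by (simp add: billiard_impact reflected_normal[OF q])
  have "snd y \<noteq> 0" using assms(1) by (auto simp: states_def)
  then have "reflected Q (impact y) (snd y) \<noteq> 0" using reflected_normal(1)[OF q, of "snd y"] by auto
  then show "billiard Q y \<in> outgoing"
    using q impact_incoming[OF assms] reflected_normal(2)[OF q]
    by (simp add: billiard_impact outgoing_def states_def)
qed

text \<open>Derivatives are taken at exterior states and at outgoing boundary states. Flight times
  are continuous at \<open>y0\<close> only along families in which the obstacle touched by \<open>y0\<close> stays touched: a state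
  slightly off that obstacle may hit it after a very short time.\<close>

definition compatible :: "('a \<times> 'a) set \<Rightarrow> 'a \<times> 'a \<Rightarrow> bool" where
  "compatible H y0 \<longleftrightarrow> H \<subseteq> states \<and> y0 \<in> H \<and>
     (\<forall>\<^sub>F y in near y0 H. \<forall>j\<in>I. fst y0 \<in> K j \<longrightarrow> fst y \<in> K j)"

lemma compatible_exterior: "y0 \<in> exterior \<Longrightarrow> compatible exterior y0"
proof -
  assume y: "y0 \<in> exterior"
  then have "\<forall>j\<in>I. fst y0 \<notin> K j" using obstacle(7) by (fastforce simp: exterior_def)
  then show ?thesis using y exterior_states by (simp add: compatible_def)
qed

lemma compatible_outgoing:
  assumes "y0 \<in> outgoing" shows "compatible outgoing y0"
  unfolding compatible_def
proof (intro conjI assms outgoing_states)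
  have "fst y0 \<in> frontier Q" using assms by (simp add: outgoing_def)
  from frontier_obstacles_cases[OF this] obtain i where i: "i \<in> I" "fst y0 \<in> K i" .
  obtain V where V: "open V" "K i \<subseteq> V" "Q \<inter> V = K i \<inter> V" using isolated_obstacle[OF i(1)] .
  have "(fst \<longlongrightarrow> fst y0) (near y0 outgoing)" by (intro near_tendsto continuous_intros)
  then have "\<forall>\<^sub>F y in near y0 outgoing. fst y \<in> V" using V i by (auto dest: topological_tendstoD)
  then show "\<forall>\<^sub>F y in near y0 outgoing. \<forall>j\<in>I. fst y0 \<in> K j \<longrightarrow> fst y \<in> K j"
    using eventually_near_mem
  proof eventually_elim
    case (elim y)
    then have "fst y \<in> Q" using frontier_subset_closed[OF closed_obstacles] by (auto simp: outgoing_def)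
    then have "fst y \<in> K i" using V elim by blast
    then show ?case using i obstacles_disjoint by blast
  qed
qed

definition transversal :: "'a \<times> 'a \<Rightarrow> bool" where
  "transversal y \<longleftrightarrow> hit_times Q y \<noteq> {} \<and> snd y \<bullet> \<nu> (impact y) < 0"

text \<open>From above, the trajectory of \<open>y0\<close> enters the interior of the obstacle shortly after a transversal impact,
  so nearby trajectories have crossed the boundary by then. From below, the path up to a time before the impact
  is compact and has positive distance from all obstacles that can be hit.\<close>

lemma flight_time_near:
  assumes c: "compatible H y0" and tr: "transversal y0" and \<sigma>: "0 < \<sigma>"
  shows "\<forall>\<^sub>F y in near y0 H. hit_times Q y \<noteq> {} \<and> dist (flight_time Q y) (flight_time Q y0) < \<sigma>"
proof -
  obtain p v where y0: "y0 = (p, v)" by fastforce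
  define \<tau> where "\<tau> = flight_time Q y0"
  have st: "y0 \<in> states" and hit: "hit_times Q y0 \<noteq> {}" using c tr by (auto simp: compatible_def transversal_def)
  have \<tau>: "\<tau> > 0" using flight_time_pos[OF st hit] by (simp add: \<tau>_def)
  from normal_field[OF impact_frontier[OF st hit]]
  have "\<forall>h. 0 < h \<bullet> \<nu> (impact y0) \<longrightarrow> (\<exists>d>0. \<forall>t. 0 < t \<and> t < d \<longrightarrow> impact y0 - t *\<^sub>R h \<in> interior Q)"
    by metis
  moreover have "0 < (- v) \<bullet> \<nu> (impact y0)" using tr by (simp add: transversal_def y0)
  ultimately obtain d where d: "d > 0" "\<And>t. 0 < t \<Longrightarrow> t < d \<Longrightarrow> impact y0 - t *\<^sub>R (- v) \<in> interior Q" by blast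
  define t where "t = min d \<sigma> / 2"
  have t: "0 < t" "t < d" "t < \<sigma>" using d \<sigma> by (auto simp: t_def)
  have inQ: "p + (\<tau> + t) *\<^sub>R v \<in> interior Q" using d(2)[OF t(1,2)] by (simp add: impact_def y0 \<tau>_def algebra_simps)
  then obtain i where i: "i \<in> I" "p + (\<tau> + t) *\<^sub>R v \<in> K i"
    using interior_subset[of Q] unfolding obstacles_def by blast
  have ini: "p + (\<tau> + t) *\<^sub>R v \<in> interior (K i)" using interior_obstacles[OF i] inQ by blast
  have pi: "p \<notin> K i" using no_return[of p v i "\<tau> + t"] st i \<tau> t y0 by auto
  have 1: "\<forall>\<^sub>F y in near y0 H. fst y + (\<tau> + t) *\<^sub>R snd y \<in> interior (K i)"
    using ini by (intro topological_tendstoD[OF near_tendsto]) (auto simp: y0)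
  have 2: "\<forall>\<^sub>F y in near y0 H. fst y \<in> - K i"
    using pi obstacle(3)[OF i(1)] by (intro topological_tendstoD[OF near_tendsto]) (auto simp: y0)
  have upper: "\<forall>\<^sub>F y in near y0 H. hit_times Q y \<noteq> {} \<and> flight_time Q y < \<tau> + \<sigma>"
    using 1 2
  proof eventually_elim
    case (elim y)
    then have "fst y + (\<tau> + t) *\<^sub>R snd y \<in> K i" "fst y \<notin> K i" using interior_subset by blast+
    from crossing[OF this(2,1) _ obstacle(3)[OF i(1)]] \<tau> t obtain s where
      s: "0 < s" "s \<le> \<tau> + t" "fst y + s *\<^sub>R snd y \<in> frontier (K i)" by auto
    then have "s \<in> hit_times Q y" using frontier_obstacleD[OF i(1)] by (simp add: hit_times_def)
    then show ?case using flight_time_le[of s y] s t by force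
  qed
  have lower: "\<forall>\<^sub>F y in near y0 H. hit_times Q y \<noteq> {} \<longrightarrow> \<tau> - \<sigma> < flight_time Q y"
  proof (cases "\<tau> - \<sigma> < 0")
    case True
    show ?thesis using eventually_near_mem
    proof eventually_elim
      case (elim y)
      then show ?case using flight_time_pos[of y] True c unfolding compatible_def by fastforce
    qed
  next
    case False
    define a where "a = \<tau> - \<sigma>"
    have a: "0 \<le> a" "a < \<tau>" using False \<sigma> by (auto simp: a_def)
    have "\<exists>d>0. \<forall>x\<in>(\<lambda>t. p + t *\<^sub>R v) ` {0..a}. \<forall>y\<in>others p. d \<le> dist x y"
    proof (rule separate_compact_closed)
      show "compact ((\<lambda>t. p + t *\<^sub>R v) ` {0..a})" by (intro compact_continuous_image continuous_intros) simp
      show "closed (others p)" by (rule closed_others)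
      show "(\<lambda>t. p + t *\<^sub>R v) ` {0..a} \<inter> others p = {}"
      proof (rule ccontr)
        assume "\<not> ?thesis"
        then obtain s where s: "0 \<le> s" "s \<le> a" "p + s *\<^sub>R v \<in> others p" by auto
        then have "s \<in> hit_times Q y0" using hit_times_others st unfolding y0 by auto
        then show False using flight_time_le[of s y0] s a unfolding \<tau>_def by simp
      qed
    qed
    then obtain e where e: "e > 0" "\<And>s x. 0 \<le> s \<Longrightarrow> s \<le> a \<Longrightarrow> x \<in> others p \<Longrightarrow> e \<le> dist (p + s *\<^sub>R v) x"
      by fastforce
    have "((\<lambda>y. norm (fst y - p) + a * norm (snd y - v)) \<longlongrightarrow> norm (fst y0 - p) + a * norm (snd y0 - v)) (near y0 H)"
      by (intro near_tendsto continuous_intros)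
    then have "\<forall>\<^sub>F y in near y0 H. norm (fst y - p) + a * norm (snd y - v) < e"
      using e(1) by (intro order_tendstoD(2)[where y = "norm (fst y0 - p) + a * norm (snd y0 - v)"]) (auto simp: y0)
    moreover have "\<forall>\<^sub>F y in near y0 H. \<forall>j\<in>I. fst y0 \<in> K j \<longrightarrow> fst y \<in> K j"
      using c by (simp add: compatible_def)
    ultimately show ?thesis using eventually_near_mem
    proof eventually_elim
      case (elim y)
      show ?case
      proof (intro impI, rule ccontr)
        assume h: "hit_times Q y \<noteq> {}" and "\<not> \<tau> - \<sigma> < flight_time Q y"
        then have le: "flight_time Q y \<le> a" by (simp add: a_def)
        have ys: "y \<in> states" using elim c by (auto simp: compatible_def)
        have pos: "0 < flight_time Q y" using flight_time_pos[OF ys h] .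
        have "others (fst y) \<subseteq> others p" using elim(2) unfolding others_def y0 by auto
        then have "impact y \<in> others p" using impact_others[OF ys h] by blast
        then have "e \<le> dist (p + flight_time Q y *\<^sub>R v) (impact y)" using e(2) le pos by simp
        also have "\<dots> = norm ((fst y - p) + flight_time Q y *\<^sub>R (snd y - v))"
          unfolding dist_norm impact_def by (simp add: norm_minus_commute algebra_simps)
        also have "\<dots> \<le> norm (fst y - p) + flight_time Q y * norm (snd y - v)"
          using norm_triangle_ineq[of "fst y - p" "flight_time Q y *\<^sub>R (snd y - v)"] pos by simp
        also have "\<dots> \<le> norm (fst y - p) + a * norm (snd y - v)" using le by (intro add_left_mono mult_right_mono) auto
        also have "\<dots> < e" by (rule elim(1))
        finally show False by simp
      qed
    qed
  qed
  from upper lower show ?thesis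
    by eventually_elim (auto simp: dist_real_def \<tau>_def)
qed

lemma flight_time_tendsto:
  assumes "compatible H y0" "transversal y0"
  shows "(flight_time Q \<longlongrightarrow> flight_time Q y0) (near y0 H)"
proof (rule tendstoI)
  fix e :: real assume "0 < e"
  from flight_time_near[OF assms this]
  show "\<forall>\<^sub>F y in near y0 H. dist (flight_time Q y) (flight_time Q y0) < e"
    by eventually_elim simp
qed

lemma impact_tendsto:
  assumes "compatible H y0" "transversal y0"
  shows "(impact \<longlongrightarrow> impact y0) (near y0 H)"
  unfolding impact_def
  by (rule tendsto_add[OF near_tendsto tendsto_scaleR[OF flight_time_tendsto[OF assms] near_tendsto]])
    (intro continuous_intros)+

lemma eventually_hits:
  assumes "compatible H y0" "transversal y0"
  shows "\<forall>\<^sub>F y in near y0 H. y \<in> states \<and> hit_times Q y \<noteq> {}"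
  using flight_time_near[OF assms zero_less_one] eventually_near_mem
proof eventually_elim
  case (elim y)
  then show ?case using assms(1) unfolding compatible_def by blast
qed

text \<open>Found by differentiating \<open>f (impact y) = 0\<close>, where \<open>f\<close> is a defining function of the obstacle.\<close>

definition flight_der :: "'a \<times> 'a \<Rightarrow> 'a \<times> 'a \<Rightarrow> real" where
  "flight_der y Y = - (((fst Y + flight_time Q y *\<^sub>R snd Y) \<bullet> \<nu> (impact y)) / (snd y \<bullet> \<nu> (impact y)))"

text \<open>The implicit function argument in strict form. For two nearby states the impact points differ by
  \<open>A + \<delta> *\<^sub>R v + E\<close>, where \<open>\<delta>\<close> is the difference of the flight times, \<open>A\<close> is linear in the difference of
  the states, and \<open>E\<close> is of higher order. Since \<open>f\<close> vanishes at both impacts, the normal component of this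
  vector is of higher order, and transversality allows to solve for \<open>\<delta>\<close>.\<close>

lemma flight_time_strict_derivative:
  assumes c: "compatible H y0" and tr: "transversal y0"
  shows "strict_derivative (flight_time Q) (flight_der y0) y0 H"
  unfolding strict_derivative_def
proof (intro conjI allI impI)
  define \<tau> where "\<tau> = flight_time Q y0"
  define v where "v = snd y0"
  define n where "n = \<nu> (impact y0)"
  have st: "y0 \<in> states" and hit: "hit_times Q y0 \<noteq> {}" using c tr by (auto simp: compatible_def transversal_def)
  note q0 = impact_frontier[OF st hit]
  have n1: "norm n = 1" using norm_normal[OF q0] by (simp add: n_def)
  have \<tau>: "\<tau> > 0" using flight_time_pos[OF st hit] by (simp add: \<tau>_def)
  define m where "m = - (v \<bullet> n)"
  have m: "m > 0" using tr by (simp add: m_def v_def n_def transversal_def)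
  have T: "flight_der y0 Y = ((fst Y + \<tau> *\<^sub>R snd Y) \<bullet> n) / m" for Y
    unfolding flight_der_def m_def v_def n_def \<tau>_def by simp
  show bl: "bounded_linear (flight_der y0)"
    unfolding T by (intro bounded_linear_compose[OF bounded_linear_divide] bounded_linear_compose[OF bounded_linear_inner_left]
      bounded_linear_add bounded_linear_compose[OF bounded_linear_scaleR_right] bounded_linear_fst bounded_linear_snd)
  obtain C where C: "C > 0" "\<And>Y. norm (flight_der y0 Y) \<le> norm Y * C"
    using bounded_linear.pos_bounded[OF bl] by blast
  from normal_field[OF q0] obtain f where f: "strict_derivative f (\<lambda>h. h \<bullet> n) (impact y0) UNIV"
    and f0: "\<forall>\<^sub>F x in nhds (impact y0). x \<in> frontier Q \<longrightarrow> f x = 0" unfolding n_def by metis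
  fix e :: real assume e: "0 < e"
  define M1 where "M1 = 2 + norm v"
  define M where "M = 3 + \<tau> + M1 * C"
  have M: "M1 > 0" "M > 0" using \<tau> C by (auto simp: M1_def M_def add_pos_nonneg add_nonneg_pos intro!: add_pos_nonneg)
  define \<eta> where "\<eta> = min 1 (min (m / (2 * M1)) (e * m / (2 * M)))"
  have \<eta>: "\<eta> > 0" "\<eta> \<le> 1" "\<eta> * M1 \<le> m / 2" "\<eta> * M \<le> e * m / 2"
  proof -
    show "\<eta> > 0" "\<eta> \<le> 1" using m e M by (auto simp: \<eta>_def)
    have "\<eta> \<le> m / (2 * M1)" "\<eta> \<le> e * m / (2 * M)" by (auto simp: \<eta>_def)
    then show "\<eta> * M1 \<le> m / 2" "\<eta> * M \<le> e * m / 2" using M by (simp_all add: field_simps)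
  qed
  have "\<forall>\<^sub>F p in near y0 H \<times>\<^sub>F near y0 H.
     norm (f (impact (fst p)) - f (impact (snd p)) - (impact (fst p) - impact (snd p)) \<bullet> n)
       \<le> \<eta> * norm (impact (fst p) - impact (snd p))"
  proof -
    from strict_derivativeD[OF f \<eta>(1)] obtain P1 P2 where P: "eventually P1 (nhds (impact y0))"
      "eventually P2 (nhds (impact y0))" "\<And>a b. P1 a \<Longrightarrow> P2 b \<Longrightarrow>
        norm (f a - f b - (a - b) \<bullet> n) \<le> \<eta> * norm (a - b)"
      unfolding eventually_prod_filter by (auto simp: near_open)
    have "eventually (\<lambda>y. P1 (impact y) \<and> P2 (impact y)) (near y0 H)"
      by (rule eventually_compose_filterlim[OF eventually_conj[OF P(1,2)] impact_tendsto[OF c tr]])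
    from eventually_near_pair[OF this] show ?thesis by eventually_elim (use P(3) in auto)
  qed
  moreover have "\<forall>\<^sub>F y in near y0 H. f (impact y) = 0"
  proof -
    have "\<forall>\<^sub>F y in near y0 H. impact y \<in> frontier Q \<longrightarrow> f (impact y) = 0"
      by (rule eventually_compose_filterlim[OF f0 impact_tendsto[OF c tr]])
    with eventually_hits[OF c tr] show ?thesis
      by eventually_elim (use impact_frontier in blast)
  qed
  note eventually_near_pair[OF this]
  moreover have "\<forall>\<^sub>F y in near y0 H. dist (flight_time Q y) \<tau> < \<eta>"
    using flight_time_near[OF c tr \<eta>(1)] by eventually_elim (simp add: \<tau>_def)
  note eventually_near_pair[OF this]
  moreover have "\<forall>\<^sub>F y in near y0 H. dist (snd y) v < \<eta>"
    unfolding v_def by (intro tendstoD \<eta>(1) near_tendsto continuous_intros)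
  note eventually_near_pair[OF this]
  ultimately show "\<forall>\<^sub>F p in near y0 H \<times>\<^sub>F near y0 H. norm (flight_time Q (fst p) - flight_time Q (snd p) -
      flight_der y0 (fst p - snd p)) \<le> e * norm (fst p - snd p)"
  proof eventually_elim
    case (elim p)
    define Y where "Y = fst p - snd p"
    define \<delta> where "\<delta> = flight_time Q (fst p) - flight_time Q (snd p)"
    define A where "A = fst Y + \<tau> *\<^sub>R snd Y"
    define E where "E = (flight_time Q (fst p) - \<tau>) *\<^sub>R snd Y + \<delta> *\<^sub>R (snd (snd p) - v)"
    have dq: "impact (fst p) - impact (snd p) = A + \<delta> *\<^sub>R v + E"
      unfolding impact_def A_def E_def \<delta>_def Y_def by (simp add: algebra_simps)
    have nY: "norm (fst Y) \<le> norm Y" "norm (snd Y) \<le> norm Y" 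
      using norm_fst_le[of "fst Y" "snd Y"] norm_snd_le[of "snd Y" "fst Y"] by simp_all
    have A: "norm A \<le> (1 + \<tau>) * norm Y"
    proof -
      have "norm A \<le> norm (fst Y) + \<tau> * norm (snd Y)"
        unfolding A_def using \<tau> norm_triangle_ineq[of "fst Y" "\<tau> *\<^sub>R snd Y"] by simp
      also have "\<dots> \<le> norm Y + \<tau> * norm Y" using nY \<tau> by (intro add_mono mult_left_mono) auto
      finally show ?thesis by (simp add: algebra_simps)
    qed
    have E: "norm E \<le> \<eta> * norm Y + \<eta> * \<bar>\<delta>\<bar>"
    proof -
      have "norm E \<le> \<bar>flight_time Q (fst p) - \<tau>\<bar> * norm (snd Y) + \<bar>\<delta>\<bar> * norm (snd (snd p) - v)"
        unfolding E_def using norm_triangle_ineq[of "(flight_time Q (fst p) - \<tau>) *\<^sub>R snd Y" "\<delta> *\<^sub>R (snd (snd p) - v)"] by simp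
      also have "\<dots> \<le> \<eta> * norm Y + \<bar>\<delta>\<bar> * \<eta>"
        using elim(3,4) nY \<eta>(1) by (intro add_mono mult_mono) (auto simp: dist_real_def dist_norm)
      finally show ?thesis by (simp add: mult.commute)
    qed
    have "(A + \<delta> *\<^sub>R v + E) \<bullet> n = - m * (\<delta> - flight_der y0 Y) + E \<bullet> n"
      unfolding T using m by (simp add: m_def A_def inner_add_left field_simps)
    then have "m * \<bar>\<delta> - flight_der y0 Y\<bar> \<le> \<bar>(A + \<delta> *\<^sub>R v + E) \<bullet> n\<bar> + \<bar>E \<bullet> n\<bar>"
      using m abs_mult[of m "\<delta> - flight_der y0 Y"] by linarith
    also have "\<dots> \<le> \<eta> * norm (A + \<delta> *\<^sub>R v + E) + norm E"
      using elim(1,2) Cauchy_Schwarz_ineq2[of E n] n1 unfolding dq by simp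
    also have "\<dots> \<le> \<eta> * (norm A + \<bar>\<delta>\<bar> * norm v + norm E) + norm E"
      using \<eta>(1) norm_triangle_ineq[of "A + \<delta> *\<^sub>R v" E] norm_triangle_ineq[of A "\<delta> *\<^sub>R v"]
      by (intro add_right_mono mult_left_mono) auto
    also have "\<dots> \<le> \<eta> * ((1 + \<tau>) * norm Y + \<bar>\<delta>\<bar> * norm v + (norm Y + \<bar>\<delta>\<bar>)) + (\<eta> * norm Y + \<eta> * \<bar>\<delta>\<bar>)"
    proof -
      have "\<eta> * norm Y + \<eta> * \<bar>\<delta>\<bar> \<le> norm Y + \<bar>\<delta>\<bar>"
        using \<eta>(1,2) mult_right_mono[of \<eta> 1 "norm Y"] mult_right_mono[of \<eta> 1 "\<bar>\<delta>\<bar>"] by simp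
      then show ?thesis using A E \<eta>(1) by (intro add_mono mult_left_mono) auto
    qed
    also have "\<dots> = \<eta> * (3 + \<tau>) * norm Y + \<eta> * M1 * \<bar>\<delta>\<bar>" by (simp add: M1_def algebra_simps)
    also have "\<dots> \<le> \<eta> * (3 + \<tau>) * norm Y + \<eta> * M1 * (\<bar>\<delta> - flight_der y0 Y\<bar> + norm Y * C)"
      using C(2)[of Y] \<eta>(1) M(1) by (intro add_left_mono mult_left_mono) auto
    also have "\<dots> = \<eta> * M * norm Y + \<eta> * M1 * \<bar>\<delta> - flight_der y0 Y\<bar>" by (simp add: M_def algebra_simps)
    also have "\<dots> \<le> (e * m / 2) * norm Y + (m / 2) * \<bar>\<delta> - flight_der y0 Y\<bar>"
      using \<eta>(3,4) by (intro add_mono mult_right_mono) auto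
    finally have "m * \<bar>\<delta> - flight_der y0 Y\<bar> \<le> m * (e * norm Y)" by (simp add: algebra_simps)
    then show ?case using m unfolding \<delta>_def Y_def by simp
  qed
qed

definition normal_derivative :: "'a \<Rightarrow> ('a \<Rightarrow> 'a) \<Rightarrow> bool" where
  "normal_derivative p N' \<longleftrightarrow> (\<exists>N. strict_derivative N N' p UNIV \<and>
     (\<forall>\<^sub>F x in nhds p. x \<in> frontier Q \<longrightarrow> N x = \<nu> x)) \<and>
     (\<forall>h. h \<bullet> \<nu> p = 0 \<longrightarrow> N' h \<bullet> h \<ge> 0) \<and> (\<forall>h. N' h \<bullet> \<nu> p = 0)"

text \<open>The shape operator of the boundary. Its values on vectors that are not tangent depend on how
  the normal field is extended, hence the choice.\<close>

definition shape :: "'a \<Rightarrow> 'a \<Rightarrow> 'a" where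
  "shape p = (SOME N'. normal_derivative p N')"

lemma normal_derivative_shape: "p \<in> frontier Q \<Longrightarrow> normal_derivative p (shape p)"
  unfolding shape_def
proof (rule someI_ex[of "normal_derivative p"])
  assume "p \<in> frontier Q"
  then show "\<exists>N'. normal_derivative p N'"
  proof (rule normal_field)
    fix f :: "'a \<Rightarrow> real" and N N'
    assume "strict_derivative N N' p UNIV" "\<forall>\<^sub>F x in nhds p. x \<in> frontier Q \<longrightarrow> N x = \<nu> x"
      and 1: "\<And>h. h \<bullet> \<nu> p = 0 \<Longrightarrow> N' h \<bullet> h \<ge> 0" and 2: "\<And>h. N' h \<bullet> \<nu> p = 0"
    then have 0: "\<exists>N. strict_derivative N N' p UNIV \<and> (\<forall>\<^sub>F x in nhds p. x \<in> frontier Q \<longrightarrow> N x = \<nu> x)"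
      by (intro exI[of _ N] conjI)
    show "\<exists>N'. normal_derivative p N'"
      unfolding normal_derivative_def by (rule exI[of _ N'], intro conjI allI impI 0 1 2)
  qed
qed

definition impact_der :: "'a \<times> 'a \<Rightarrow> 'a \<times> 'a \<Rightarrow> 'a" where
  "impact_der y Y = fst Y + (flight_time Q y *\<^sub>R snd Y + flight_der y Y *\<^sub>R snd y)"

definition billiard_der :: "'a \<times> 'a \<Rightarrow> 'a \<times> 'a \<Rightarrow> 'a \<times> 'a" where
  "billiard_der y Y = (let n = \<nu> (impact y); dq = impact_der y Y; dn = shape (impact y) dq
     in (dq, snd Y - ((2 * (snd y \<bullet> n)) *\<^sub>R dn + (2 * (snd y \<bullet> dn + snd Y \<bullet> n)) *\<^sub>R n)))"

lemma impact_strict_derivative: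
  assumes c: "compatible H y0" and tr: "transversal y0"
  shows "strict_derivative impact (impact_der y0) y0 H"
proof -
  have y0: "y0 \<in> H" using c by (simp add: compatible_def)
  show ?thesis
    unfolding impact_def[abs_def] impact_der_def[abs_def]
    by (rule strict_derivative_add[OF strict_derivative_bounded_linear[OF bounded_linear_fst]
        strict_derivative_bilinear[OF bounded_bilinear_scaleR y0 flight_time_strict_derivative[OF c tr]
          strict_derivative_bounded_linear[OF bounded_linear_snd]]])
qed

lemma billiard_strict_derivative:
  assumes c: "compatible H y0" and tr: "transversal y0"
  shows "strict_derivative (billiard Q) (billiard_der y0) y0 H"
proof -
  have y0: "y0 \<in> H" "y0 \<in> states" and hit: "hit_times Q y0 \<noteq> {}" using c tr by (auto simp: compatible_def transversal_def)
  note q0 = impact_frontier[OF y0(2) hit]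
  from normal_derivative_shape[OF q0] obtain N where
    N: "strict_derivative N (shape (impact y0)) (impact y0) UNIV"
    "\<forall>\<^sub>F x in nhds (impact y0). x \<in> frontier Q \<longrightarrow> N x = \<nu> x" unfolding normal_derivative_def by blast
  have N0: "N (impact y0) = \<nu> (impact y0)" using eventually_nhds_x_imp_x[OF N(2)] q0 by blast
  note qd = impact_strict_derivative[OF c tr] and qt = impact_tendsto[OF c tr]
  have Nd: "strict_derivative (\<lambda>y. N (impact y)) (\<lambda>Y. shape (impact y0) (impact_der y0 Y)) y0 H"
    by (rule strict_derivative_compose[OF qd N(1)]) (simp add: near_open qt)
  have vd: "strict_derivative snd snd y0 H"
    by (intro strict_derivative_bounded_linear bounded_linear_intros)
  have id: "strict_derivative (\<lambda>y. 2 * (snd y \<bullet> N (impact y)))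
     (\<lambda>Y. 2 * (snd y0 \<bullet> shape (impact y0) (impact_der y0 Y) + snd Y \<bullet> N (impact y0))) y0 H"
    by (rule strict_derivative_compose_linear[OF strict_derivative_bilinear[OF bounded_bilinear_inner y0(1) vd Nd] y0(1)
        bounded_linear_mult_right])
  have rd: "strict_derivative (\<lambda>y. snd y + - ((2 * (snd y \<bullet> N (impact y))) *\<^sub>R N (impact y)))
     (\<lambda>Y. snd Y + - ((2 * (snd y0 \<bullet> N (impact y0))) *\<^sub>R shape (impact y0) (impact_der y0 Y) +
        (2 * (snd y0 \<bullet> shape (impact y0) (impact_der y0 Y) + snd Y \<bullet> N (impact y0))) *\<^sub>R N (impact y0))) y0 H"
    by (rule strict_derivative_add[OF vd strict_derivative_compose_linear[OF
        strict_derivative_bilinear[OF bounded_bilinear_scaleR y0(1) id Nd] y0(1)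
        bounded_linear_minus[OF bounded_linear_ident]]])
  have eq: "(\<lambda>Y. (impact_der y0 Y, snd Y + - ((2 * (snd y0 \<bullet> N (impact y0))) *\<^sub>R shape (impact y0) (impact_der y0 Y) +
        (2 * (snd y0 \<bullet> shape (impact y0) (impact_der y0 Y) + snd Y \<bullet> N (impact y0))) *\<^sub>R N (impact y0)))) = billiard_der y0"
    unfolding billiard_der_def[abs_def] Let_def N0 by (simp only: diff_conv_add_uminus)
  from strict_derivative_Pair[OF qd rd y0(1)]
  have "strict_derivative (\<lambda>y. (impact y, snd y + - ((2 * (snd y \<bullet> N (impact y))) *\<^sub>R N (impact y))))
     (billiard_der y0) y0 H"
    unfolding eq .
  moreover have "\<forall>\<^sub>F y in near y0 H. billiard Q y = (impact y, snd y + - ((2 * (snd y \<bullet> N (impact y))) *\<^sub>R N (impact y)))"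
  proof -
    have "\<forall>\<^sub>F y in near y0 H. impact y \<in> frontier Q \<longrightarrow> N (impact y) = \<nu> (impact y)"
      by (rule eventually_compose_filterlim[OF N(2) qt])
    with eventually_hits[OF c tr] show ?thesis
      by eventually_elim (use impact_frontier in \<open>simp add: billiard_impact reflected_def\<close>)
  qed
  ultimately show ?thesis by (rule strict_derivative_cong)
qed

lemma billiard_near_outgoing:
  assumes c: "compatible H y0" and tr: "transversal y0"
  shows "filterlim (billiard Q) (near (billiard Q y0) outgoing) (near y0 H)"
proof -
  have "\<forall>\<^sub>F y in near y0 H. billiard Q y \<in> outgoing"
    using eventually_hits[OF c tr] by eventually_elim (use billiard_outgoing in blast)
  moreover have "(billiard Q \<longlongrightarrow> billiard Q y0) (near y0 H)"
    using strict_derivative_tendsto[OF billiard_strict_derivative[OF c tr]] c by (simp add: compatible_def)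
  ultimately show ?thesis
    unfolding near_def[of "billiard Q y0"] by (simp add: filterlim_inf filterlim_principal)
qed

end


section \<open>Linearised orbits\<close>

context billiard_table
begin

definition regular_orbit :: "'a \<times> 'a \<Rightarrow> bool" where
  "regular_orbit y \<longleftrightarrow> y \<in> states \<and> (\<forall>m. transversal ((billiard Q ^^ m) y))"

lemma orbit_states:
  assumes "regular_orbit y"
  shows "(billiard Q ^^ m) y \<in> states" "norm (snd ((billiard Q ^^ m) y)) = norm (snd y)"
    "(billiard Q ^^ Suc m) y \<in> outgoing"
proof -
  have *: "(billiard Q ^^ m) y \<in> states \<and> norm (snd ((billiard Q ^^ m) y)) = norm (snd y)" for m
  proof (induction m)
    case 0
    then show ?case using assms by (simp add: regular_orbit_def)
  next
    case (Suc m)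
    have "hit_times Q ((billiard Q ^^ m) y) \<noteq> {}" using assms by (simp add: regular_orbit_def transversal_def)
    from billiard_outgoing[OF Suc[THEN conjunct1] this] Suc show ?case
      using outgoing_states by auto
  qed
  then show "(billiard Q ^^ m) y \<in> states" "norm (snd ((billiard Q ^^ m) y)) = norm (snd y)" by auto
  have "hit_times Q ((billiard Q ^^ m) y) \<noteq> {}" using assms by (simp add: regular_orbit_def transversal_def)
  then show "(billiard Q ^^ Suc m) y \<in> outgoing" using billiard_outgoing(1)[of "(billiard Q ^^ m) y"] * by simp
qed

lemma orbit_transversal: "regular_orbit y \<Longrightarrow> transversal ((billiard Q ^^ m) y)"
  by (simp add: regular_orbit_def)

lemma orbit_hits: "regular_orbit y \<Longrightarrow> hit_times Q ((billiard Q ^^ m) y) \<noteq> {}"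
  by (simp add: regular_orbit_def transversal_def)

primrec orbit_der :: "'a \<times> 'a \<Rightarrow> nat \<Rightarrow> 'a \<times> 'a \<Rightarrow> 'a \<times> 'a" where
  "orbit_der y 0 Y = Y"
| "orbit_der y (Suc m) Y = billiard_der ((billiard Q ^^ m) y) (orbit_der y m Y)"

definition time_der :: "'a \<times> 'a \<Rightarrow> nat \<Rightarrow> 'a \<times> 'a \<Rightarrow> real" where
  "time_der y m Y = (\<Sum>i<m. flight_der ((billiard Q ^^ i) y) (orbit_der y i Y))"

text \<open>The derivative of the position of the front at a fixed time, just after the \<open>m\<close>-th reflection: the impact
  point moves by \<open>fst (orbit_der y m Y)\<close>, but the impact is delayed by \<open>time_der y m Y\<close>. Unlike the impact
  point, this displacement stays orthogonal to the velocity and is only reflected isometrically at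
  an impact.\<close>

definition jacobi :: "'a \<times> 'a \<Rightarrow> nat \<Rightarrow> 'a \<times> 'a \<Rightarrow> 'a" where
  "jacobi y m Y = fst (orbit_der y m Y) - time_der y m Y *\<^sub>R snd ((billiard Q ^^ m) y)"

definition later_states :: "('a \<times> 'a) set \<Rightarrow> nat \<Rightarrow> ('a \<times> 'a) set" where
  "later_states H m = (if m = 0 then H else outgoing)"

lemma compatible_later:
  assumes "compatible H y0" "regular_orbit y0"
  shows "compatible (later_states H m) ((billiard Q ^^ m) y0)"
proof (cases m)
  case 0
  then show ?thesis using assms by (simp add: later_states_def)
next
  case (Suc k)
  then show ?thesis using compatible_outgoing[OF orbit_states(3)[OF assms(2), of k]] by (simp add: later_states_def)
qed

lemma orbit_strict_derivative:
  assumes c: "compatible H y0" and r: "regular_orbit y0"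
  shows "strict_derivative (billiard Q ^^ m) (orbit_der y0 m) y0 H"
    "filterlim (billiard Q ^^ m) (near ((billiard Q ^^ m) y0) (later_states H m)) (near y0 H)"
proof -
  have "strict_derivative (billiard Q ^^ m) (orbit_der y0 m) y0 H \<and>
    filterlim (billiard Q ^^ m) (near ((billiard Q ^^ m) y0) (later_states H m)) (near y0 H)"
  proof (induction m)
    case 0
    have "strict_derivative (\<lambda>y. y) (\<lambda>Y. Y) y0 H"
      by (rule strict_derivative_bounded_linear[OF bounded_linear_ident])
    moreover have "orbit_der y0 0 = (\<lambda>Y. Y)" by (simp add: fun_eq_iff)
    ultimately show ?case by (simp add: later_states_def filterlim_ident id_def)
  next
    case (Suc m)
    note cm = compatible_later[OF c r, of m] and tm = orbit_transversal[OF r, of m]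
    have "strict_derivative (\<lambda>y. billiard Q ((billiard Q ^^ m) y))
        (\<lambda>Y. billiard_der ((billiard Q ^^ m) y0) (orbit_der y0 m Y)) y0 H"
      using strict_derivative_compose[OF Suc[THEN conjunct1] billiard_strict_derivative[OF cm tm] Suc[THEN conjunct2]] .
    moreover have "filterlim (\<lambda>y. billiard Q ((billiard Q ^^ m) y))
        (near (billiard Q ((billiard Q ^^ m) y0)) outgoing) (near y0 H)"
      using filterlim_compose[OF billiard_near_outgoing[OF cm tm] Suc[THEN conjunct2]] .
    moreover have "orbit_der y0 (Suc m) = (\<lambda>Y. billiard_der ((billiard Q ^^ m) y0) (orbit_der y0 m Y))"
      by (simp add: fun_eq_iff)
    ultimately show ?case by (simp add: later_states_def comp_def)
  qed
  then show "strict_derivative (billiard Q ^^ m) (orbit_der y0 m) y0 H"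
    "filterlim (billiard Q ^^ m) (near ((billiard Q ^^ m) y0) (later_states H m)) (near y0 H)" by auto
qed

lemma refl_time_strict_derivative:
  assumes c: "compatible H y0" and r: "regular_orbit y0"
  shows "strict_derivative (\<lambda>y. refl_time Q y m) (time_der y0 m) y0 H"
proof -
  have "strict_derivative (\<lambda>y. \<Sum>i<m. flight_time Q ((billiard Q ^^ i) y))
     (\<lambda>Y. \<Sum>i<m. flight_der ((billiard Q ^^ i) y0) (orbit_der y0 i Y)) y0 H"
    by (intro strict_derivative_sum strict_derivative_compose[OF orbit_strict_derivative(1)[OF c r]
      flight_time_strict_derivative[OF compatible_later[OF c r] orbit_transversal[OF r]]
      orbit_strict_derivative(2)[OF c r]])
  then show ?thesis unfolding refl_time_def time_der_def[abs_def] .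
qed

lemma eventually_orbit_hits:
  assumes c: "compatible H y0" and r: "regular_orbit y0"
  shows "\<forall>\<^sub>F y in near y0 H. (billiard Q ^^ m) y \<in> states \<and> hit_times Q ((billiard Q ^^ m) y) \<noteq> {}"
  by (rule eventually_compose_filterlim[OF eventually_hits[OF compatible_later[OF c r] orbit_transversal[OF r]]
    orbit_strict_derivative(2)[OF c r]])

lemma normal_impact_der:
  assumes "transversal y"
  shows "impact_der y Y \<bullet> \<nu> (impact y) = 0"
proof -
  have "snd y \<bullet> \<nu> (impact y) \<noteq> 0" using assms by (simp add: transversal_def)
  then have "flight_der y Y * (snd y \<bullet> \<nu> (impact y)) = - ((fst Y + flight_time Q y *\<^sub>R snd Y) \<bullet> \<nu> (impact y))"
    by (simp add: flight_der_def)
  then show ?thesis by (simp add: impact_der_def inner_add_left)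
qed

text \<open>Writing \<open>L = J + \<tau> *\<^sub>R w\<close> for the displacement before the impact, one finds that \<open>J'\<close> is the reflection of \<open>L\<close>,
  and that the inner product of displacement and change of velocity grows at the impact by
  \<open>- 2 * c * (dn \<bullet> dq)\<close>. This is nonnegative because the velocity is incoming, so \<open>c < 0\<close>, and the obstacle is convex.\<close>

lemma billiard_der_properties:
  fixes x w :: 'a
  assumes st: "y \<in> states" and tr: "transversal y"
    and J: "J = fst Y - s *\<^sub>R snd y" and Jv: "J \<bullet> snd y = 0" and wv: "snd Y \<bullet> snd y = 0"
    and J': "J' = fst (billiard_der y Y) - (s + flight_der y Y) *\<^sub>R snd (billiard Q y)"
  shows "norm J' = norm (J + flight_time Q y *\<^sub>R snd Y)" "J' \<bullet> snd (billiard Q y) = 0"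
    "snd (billiard_der y Y) \<bullet> snd (billiard Q y) = 0"
    "(J + flight_time Q y *\<^sub>R snd Y) \<bullet> snd Y \<le> J' \<bullet> snd (billiard_der y Y)"
    "fst (billiard_der y Y) \<bullet> \<nu> (impact y) = 0"
proof -
  define n where "n = \<nu> (impact y)"
  define v where "v = snd y"
  define w where "w = snd Y"
  define \<tau> where "\<tau> = flight_time Q y"
  define \<delta> where "\<delta> = flight_der y Y"
  define dq where "dq = impact_der y Y"
  define dn where "dn = shape (impact y) dq"
  define c where "c = v \<bullet> n"
  define L where "L = J + \<tau> *\<^sub>R w"
  have hit: "hit_times Q y \<noteq> {}" using tr by (simp add: transversal_def)
  note q = impact_frontier[OF st hit]
  have n1: "n \<bullet> n = 1" using norm_normal[OF q] by (simp add: n_def dot_square_norm)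
  have c0: "c < 0" using tr by (simp add: transversal_def c_def v_def n_def)
  have dqn: "dq \<bullet> n = 0" using normal_impact_der[OF tr] by (simp add: dq_def n_def)
  have dnn: "dn \<bullet> n = 0" and dndq: "dn \<bullet> dq \<ge> 0"
    using normal_derivative_shape[OF q] dqn unfolding normal_derivative_def dn_def n_def by auto
  have v': "snd (billiard Q y) = v - (2 * c) *\<^sub>R n"
    by (simp add: billiard_impact reflected_def c_def n_def v_def)
  have Y': "fst (billiard_der y Y) = dq" "snd (billiard_der y Y) = w - ((2 * c) *\<^sub>R dn + (2 * (v \<bullet> dn + w \<bullet> n)) *\<^sub>R n)"
    by (simp_all add: billiard_der_def Let_def dq_def dn_def c_def n_def v_def w_def)
  have dq: "dq = L + (s + \<delta>) *\<^sub>R v"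
    unfolding dq_def impact_der_def L_def J v_def w_def \<tau>_def \<delta>_def by (simp add: algebra_simps)
  have Lv: "L \<bullet> v = 0" "w \<bullet> v = 0" using Jv wv by (simp_all add: L_def v_def w_def inner_add_left)
  have Ln: "L \<bullet> n = - (s + \<delta>) * c" using dqn unfolding dq inner_add_left inner_scaleR_left c_def[symmetric] by linarith
  have J'2: "J' = L - (2 * (L \<bullet> n)) *\<^sub>R n"
    unfolding J' Y'(1) v' dq Ln unfolding \<delta>_def by (simp add: scaleR_diff_right scaleR_add_left algebra_simps)
  have nn: "n \<bullet> L = L \<bullet> n" "n \<bullet> v = c" "v \<bullet> n = c" "n \<bullet> dn = 0" "v \<bullet> L = 0" "n \<bullet> w = w \<bullet> n"
    using Lv dnn by (simp_all add: inner_commute[of n] inner_commute[of v L] c_def)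
  have "J' \<bullet> J' = L \<bullet> L"
    unfolding J'2 by (simp add: inner_diff_left inner_diff_right n1 nn algebra_simps)
  then show "norm J' = norm (J + flight_time Q y *\<^sub>R snd Y)"
    by (simp add: norm_eq_sqrt_inner L_def \<tau>_def w_def)
  show "J' \<bullet> snd (billiard Q y) = 0"
    unfolding J'2 v' by (simp add: inner_diff_left inner_diff_right n1 nn Lv algebra_simps)
  show "snd (billiard_der y Y) \<bullet> snd (billiard Q y) = 0"
    unfolding Y'(2) v'
    by (simp add: inner_diff_left inner_diff_right inner_add_left n1 nn Lv dnn inner_commute[of dn v] algebra_simps)
  show "fst (billiard_der y Y) \<bullet> \<nu> (impact y) = 0" using dqn by (simp add: Y' n_def)
  have "dn \<bullet> dq = L \<bullet> dn + (s + \<delta>) * (v \<bullet> dn)" by (simp add: dq inner_add_left inner_add_right inner_commute)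
  then have Ldn: "L \<bullet> dn = dn \<bullet> dq - (s + \<delta>) * (v \<bullet> dn)" by simp
  have "J' \<bullet> snd (billiard_der y Y) = L \<bullet> w - 2 * c * (L \<bullet> dn) + 2 * (L \<bullet> n) * (v \<bullet> dn)"
    unfolding J'2 Y'(2)
    by (simp add: inner_diff_left inner_diff_right inner_add_left inner_add_right n1 nn dnn algebra_simps)
  also have "\<dots> = L \<bullet> w - 2 * c * (dn \<bullet> dq)"
    unfolding Ldn Ln by (simp add: algebra_simps)
  also have "\<dots> \<ge> L \<bullet> w" using c0 dndq by (simp add: mult_nonpos_nonneg)
  finally show "(J + flight_time Q y *\<^sub>R snd Y) \<bullet> snd Y \<le> J' \<bullet> snd (billiard_der y Y)"
    by (simp add: L_def \<tau>_def w_def)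
qed

text \<open>The tangent vectors \<open>Y = (x, S x)\<close> of a front with nonnegative curvature operator \<open>S\<close> are of this
  kind.\<close>

definition diverging :: "'a \<times> 'a \<Rightarrow> 'a \<times> 'a \<Rightarrow> bool" where
  "diverging y Y \<longleftrightarrow> fst Y \<bullet> snd y = 0 \<and> snd Y \<bullet> snd y = 0 \<and> fst Y \<bullet> snd Y \<ge> 0"

lemma jacobi_step:
  assumes r: "regular_orbit y" and Y: "diverging y Y"
  shows "jacobi y m Y \<bullet> snd ((billiard Q ^^ m) y) = 0"
    "snd (orbit_der y m Y) \<bullet> snd ((billiard Q ^^ m) y) = 0"
    "norm (jacobi y (Suc m) Y) = norm (jacobi y m Y + flight_time Q ((billiard Q ^^ m) y) *\<^sub>R snd (orbit_der y m Y))"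
    "fst Y \<bullet> snd Y \<le> jacobi y m Y \<bullet> snd (orbit_der y m Y)"
    "fst (orbit_der y (Suc m) Y) \<bullet> \<nu> (impact ((billiard Q ^^ m) y)) = 0"
proof -
  have S: "jacobi y m Y \<bullet> snd ((billiard Q ^^ m) y) = 0 \<and> snd (orbit_der y m Y) \<bullet> snd ((billiard Q ^^ m) y) = 0 \<and>
      fst Y \<bullet> snd Y \<le> jacobi y m Y \<bullet> snd (orbit_der y m Y)" for m
  proof (induction m)
    case 0
    then show ?case using Y by (simp add: jacobi_def time_der_def diverging_def)
  next
    case (Suc m)
    have td: "time_der y (Suc m) Y = time_der y m Y + flight_der ((billiard Q ^^ m) y) (orbit_der y m Y)"
      by (simp add: time_der_def)
    note p = billiard_der_properties[OF orbit_states(1)[OF r] orbit_transversal[OF r],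
        OF jacobi_def Suc[THEN conjunct1] Suc[THEN conjunct2, THEN conjunct1] refl]
    have "jacobi y m Y \<bullet> snd (orbit_der y m Y) \<le>
      (jacobi y m Y + flight_time Q ((billiard Q ^^ m) y) *\<^sub>R snd (orbit_der y m Y)) \<bullet> snd (orbit_der y m Y)"
      using flight_time_pos[OF orbit_states(1)[OF r] orbit_hits[OF r], of m] by (simp add: inner_add_left)
    with p(2,3,4) Suc show ?case by (simp add: jacobi_def[of y "Suc m"] td)
  qed
  then show "jacobi y m Y \<bullet> snd ((billiard Q ^^ m) y) = 0"
    "snd (orbit_der y m Y) \<bullet> snd ((billiard Q ^^ m) y) = 0"
    "fst Y \<bullet> snd Y \<le> jacobi y m Y \<bullet> snd (orbit_der y m Y)" by auto
  have td: "time_der y (Suc m) Y = time_der y m Y + flight_der ((billiard Q ^^ m) y) (orbit_der y m Y)"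
    by (simp add: time_der_def)
  note p = billiard_der_properties[OF orbit_states(1)[OF r] orbit_transversal[OF r],
      OF jacobi_def S[THEN conjunct1] S[THEN conjunct2, THEN conjunct1] refl]
  show "norm (jacobi y (Suc m) Y) = norm (jacobi y m Y + flight_time Q ((billiard Q ^^ m) y) *\<^sub>R snd (orbit_der y m Y))"
    "fst (orbit_der y (Suc m) Y) \<bullet> \<nu> (impact ((billiard Q ^^ m) y)) = 0"
    using p(1,5) by (simp_all add: jacobi_def[of y "Suc m"] td)
qed

lemma norm_increasing: "(a::'a) \<bullet> b \<ge> 0 \<Longrightarrow> t \<ge> 0 \<Longrightarrow> norm a \<le> norm (a + t *\<^sub>R b)"
proof -
  assume "a \<bullet> b \<ge> 0" "t \<ge> 0"
  then have "a \<bullet> a \<le> (a + t *\<^sub>R b) \<bullet> (a + t *\<^sub>R b)"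
    by (simp add: inner_add_left inner_add_right inner_commute)
  then show ?thesis by (simp add: norm_eq_sqrt_inner)
qed

lemma jacobi_mono:
  assumes r: "regular_orbit y" and Y: "diverging y Y"
  shows "norm (jacobi y m Y) \<le> norm (jacobi y (Suc m) Y)" "norm (fst Y) \<le> norm (jacobi y m Y)"
proof -
  have *: "norm (jacobi y m Y) \<le> norm (jacobi y (Suc m) Y)" for m
    unfolding jacobi_step(3)[OF r Y]
    using jacobi_step(4)[OF r Y, of m] Y flight_time_pos[OF orbit_states(1)[OF r] orbit_hits[OF r], of m]
    by (intro norm_increasing) (auto simp: diverging_def)
  then show "norm (jacobi y m Y) \<le> norm (jacobi y (Suc m) Y)" .
  show "norm (fst Y) \<le> norm (jacobi y m Y)"
  proof (induction m)
    case 0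
    then show ?case by (simp add: jacobi_def time_der_def)
  next
    case (Suc m)
    then show ?case using *[of m] by simp
  qed
qed

text \<open>The displacement is the orthogonal projection of the derivative of the impact point along the
  velocity.\<close>

lemma jacobi_le_orbit_der:
  assumes r: "regular_orbit y" and Y: "diverging y Y"
  shows "norm (jacobi y m Y) \<le> norm (orbit_der y m Y)"
proof -
  have "norm (jacobi y m Y) * norm (jacobi y m Y) = jacobi y m Y \<bullet> jacobi y m Y" by (simp add: dot_square_norm power2_eq_square)
  also have "\<dots> = jacobi y m Y \<bullet> fst (orbit_der y m Y)"
    using jacobi_step(1)[OF r Y, of m] by (subst (2) jacobi_def) (simp add: inner_diff_right)
  also have "\<dots> \<le> norm (jacobi y m Y) * norm (fst (orbit_der y m Y))" by (rule norm_cauchy_schwarz)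
  also have "\<dots> \<le> norm (jacobi y m Y) * norm (orbit_der y m Y)"
    using norm_fst_le[of "fst (orbit_der y m Y)" "snd (orbit_der y m Y)"] by (intro mult_left_mono) auto
  finally show ?thesis by (cases "jacobi y m Y = 0") auto
qed

text \<open>The derivative of the impact point exceeds the displacement by a multiple of the velocity, which is controlled
  because the impact point moves tangentially to the obstacle and the velocity is transversal to it. The derivative of
  the velocity is bounded by the displacements at its two ends, divided by the flight time.\<close>

lemma orbit_der_le_jacobi:
  assumes r: "regular_orbit y" and Y: "diverging y Y" and n: "norm (snd y) = 1"
    and \<tau>: "0 < \<tau>" "\<tau> \<le> flight_time Q ((billiard Q ^^ Suc m) y)"
    and c: "0 < c" "c \<le> snd ((billiard Q ^^ Suc m) y) \<bullet> \<nu> (impact ((billiard Q ^^ m) y))"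
  shows "norm (orbit_der y (Suc m) Y) \<le> (1 + 1 / c + 2 / \<tau>) * norm (jacobi y (Suc (Suc m)) Y)"
proof -
  define J where "J = jacobi y (Suc m) Y"
  define J2 where "J2 = jacobi y (Suc (Suc m)) Y"
  define v where "v = snd ((billiard Q ^^ Suc m) y)"
  define nn where "nn = \<nu> (impact ((billiard Q ^^ m) y))"
  define w where "w = snd (orbit_der y (Suc m) Y)"
  define t where "t = flight_time Q ((billiard Q ^^ Suc m) y)"
  define s where "s = time_der y (Suc m) Y"
  have J: "fst (orbit_der y (Suc m) Y) = J + s *\<^sub>R v" by (simp add: J_def jacobi_def v_def s_def)
  have v1: "norm v = 1" unfolding v_def using orbit_states(2)[OF r, of "Suc m"] n by simp
  have nn1: "norm nn = 1"
    unfolding nn_def using norm_normal[OF impact_frontier[OF orbit_states(1)[OF r] orbit_hits[OF r]]] .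
  have "(J + s *\<^sub>R v) \<bullet> nn = 0" using jacobi_step(5)[OF r Y, of m] unfolding J nn_def .
  then have "s * (v \<bullet> nn) = - (J \<bullet> nn)" by (simp add: inner_add_left)
  then have "\<bar>s\<bar> * (v \<bullet> nn) \<le> norm J"
    using Cauchy_Schwarz_ineq2[of J nn] nn1 c unfolding v_def nn_def
    abs_mult[of s "v \<bullet> nn"] by simp
  moreover have "\<bar>s\<bar> * c \<le> \<bar>s\<bar> * (v \<bullet> nn)" using c unfolding v_def nn_def by (intro mult_left_mono) auto
  ultimately have s: "\<bar>s\<bar> \<le> norm J / c" using c by (simp add: pos_le_divide_eq)
  have JJ: "norm J \<le> norm J2" unfolding J_def J2_def by (rule jacobi_mono(1)[OF r Y])
  have "norm (J + t *\<^sub>R w) = norm J2" unfolding J2_def J_def w_def t_def using jacobi_step(3)[OF r Y, of "Suc m"] by simp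
  then have "norm (t *\<^sub>R w) \<le> norm J2 + norm J" using norm_triangle_ineq4[of "J + t *\<^sub>R w" J] by simp
  moreover have "\<tau> * norm w \<le> t * norm w" using \<tau> unfolding t_def by (intro mult_right_mono) auto
  ultimately have "\<tau> * norm w \<le> 2 * norm J2" using JJ \<tau> unfolding t_def by simp
  then have w: "norm w \<le> 2 / \<tau> * norm J2" using \<tau> by (simp add: field_simps)
  have "norm (J + s *\<^sub>R v) \<le> norm J + \<bar>s\<bar>" using norm_triangle_ineq[of J "s *\<^sub>R v"] v1 by simp
  also have "\<dots> \<le> norm J + norm J / c" using s by simp
  also have "\<dots> \<le> norm J2 + norm J2 / c" using JJ c by (intro add_mono divide_right_mono) auto
  finally have x: "norm (J + s *\<^sub>R v) \<le> (1 + 1 / c) * norm J2" by (simp add: algebra_simps)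
  have "norm (orbit_der y (Suc m) Y) \<le> norm (J + s *\<^sub>R v) + norm w"
    using norm_Pair_le[of "fst (orbit_der y (Suc m) Y)" "snd (orbit_der y (Suc m) Y)"] unfolding J[symmetric] w_def by simp
  also have "\<dots> \<le> (1 + 1 / c + 2 / \<tau>) * norm J2" using x w by (simp add: algebra_simps)
  finally show ?thesis unfolding J2_def .
qed

end


section \<open>Bounded orbits: transversality and free paths\<close>

lemma finite_uniform_pos:
  fixes P :: "'b \<Rightarrow> real \<Rightarrow> bool"
  assumes "finite A" "\<And>p. p \<in> A \<Longrightarrow> \<exists>d>0. P p d"
    and mono: "\<And>p d e. P p d \<Longrightarrow> 0 < e \<Longrightarrow> e \<le> d \<Longrightarrow> P p e"
  shows "\<exists>d>0. \<forall>p\<in>A. P p d"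
  using assms(1,2)
proof (induction A)
  case empty
  then show ?case by (auto intro: exI[of _ 1])
next
  case (insert a A)
  have "\<exists>d>0. \<forall>p\<in>A. P p d" by (rule insert.IH) (use insert.prems in simp)
  then obtain d where d: "d > 0" "\<forall>p\<in>A. P p d" by blast
  obtain e where e: "e > 0" "P a e" using insert.prems[of a] by blast
  show ?case
  proof (intro exI[of _ "min d e"] conjI ballI)
    show "min d e > 0" using d e by simp
    fix p assume "p \<in> insert a A"
    then show "P p (min d e)"
      using mono[of p d "min d e"] mono[of a e "min d e"] d e by (cases "p = a") auto
  qed
qed

lemma sgn_eq_between:
  fixes a b e :: "'b::real_normed_vector"
  assumes "sgn (e - b) = sgn (b - a)" "a \<noteq> b"
  shows "b \<in> closed_segment a e"
proof -
  define r where "r = norm (e - b)"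
  define s where "s = norm (b - a)"
  have s: "s > 0" "r \<ge> 0" using assms(2) by (auto simp: s_def r_def)
  have "e - b = r *\<^sub>R sgn (e - b)" "b - a = s *\<^sub>R sgn (b - a)"
    by (cases "e = b"; simp add: r_def s_def sgn_div_norm) (use s in \<open>simp add: s_def sgn_div_norm\<close>)
  then have *: "s *\<^sub>R (e - b) = r *\<^sub>R (b - a)" using assms(1) by (metis mult.commute scaleR_scaleR)
  then have "(r + s) *\<^sub>R b = r *\<^sub>R a + s *\<^sub>R e" by (simp add: algebra_simps)
  then have "b = (r / (r + s)) *\<^sub>R a + (s / (r + s)) *\<^sub>R e"
    using s by (metis (no_types, lifting) add_nonneg_pos divide_inverse_commute less_irrefl scaleR_left.add
        scaleR_one scaleR_right_distrib scaleR_scaleR vector_space_over_itself.scale_right_imp_eq right_inverse left_inverse)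
  moreover have "r / (r + s) = 1 - s / (r + s)" using s by (simp add: field_simps)
  ultimately show ?thesis unfolding in_segment using s by (intro exI[of _ "s / (r + s)"]) auto
qed

context billiard_table
begin

lemma obstacle_distance:
  "\<exists>d>0. \<forall>i\<in>I. \<forall>j\<in>I. i \<noteq> j \<longrightarrow> (\<forall>x\<in>K i. \<forall>y\<in>K j. d \<le> dist x y)"
proof -
  have "\<exists>d>0. \<forall>p\<in>{(i, j). i \<in> I \<and> j \<in> I \<and> i \<noteq> j}. (\<forall>x\<in>K (fst p). \<forall>y\<in>K (snd p). d \<le> dist x y)"
  proof (rule finite_uniform_pos)
    show "finite {(i, j). i \<in> I \<and> j \<in> I \<and> i \<noteq> j}" by (rule finite_subset[of _ "I \<times> I"]) auto
    fix p assume "p \<in> {(i, j). i \<in> I \<and> j \<in> I \<and> i \<noteq> j}"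
    then have p: "fst p \<in> I" "snd p \<in> I" "fst p \<noteq> snd p" by auto
    show "\<exists>d>0. \<forall>x\<in>K (fst p). \<forall>y\<in>K (snd p). d \<le> dist x y"
      by (rule separate_compact_closed[OF obstacle(2)[OF p(1)] obstacle(3)[OF p(2)]])
         (use obstacles_disjoint[OF p(1,2)] p(3) in blast)
  qed force
  then obtain d where d: "d > 0" "\<forall>p\<in>{(i, j). i \<in> I \<and> j \<in> I \<and> i \<noteq> j}. (\<forall>x\<in>K (fst p). \<forall>y\<in>K (snd p). d \<le> dist x y)"
    by blast
  show ?thesis
  proof (intro exI[of _ d] conjI ballI impI d(1))
    fix i j x y assume "i \<in> I" "j \<in> I" "i \<noteq> j" "x \<in> K i" "y \<in> K j"
    then show "d \<le> dist x y" using d(2)[rule_format, of "(i, j)" x y] by simp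
  qed
qed

text \<open>If a trajectory passed the middle obstacle without changing its direction, its point there would lie on a
  segment between the two other obstacles. For different outer obstacles this is excluded by the condition on
  convex hulls, for equal ones by convexity and disjointness. Compactness makes the deflection uniform.\<close>

lemma deflection:
  "\<exists>c>0. \<forall>i\<in>I. \<forall>j\<in>I. \<forall>l\<in>I. i \<noteq> j \<longrightarrow> j \<noteq> l \<longrightarrow>
    (\<forall>a\<in>K i. \<forall>b\<in>K j. \<forall>e\<in>K l. c \<le> norm (sgn (e - b) - sgn (b - a)))"
proof -
  define P where "P = (\<lambda>(i, j, l) c. \<forall>x\<in>K i \<times> K j \<times> K l.
      c \<le> norm (sgn (snd (snd x) - fst (snd x)) - sgn (fst (snd x) - fst x)))"
  define T where "T = {(i, j, l). i \<in> I \<and> j \<in> I \<and> l \<in> I \<and> i \<noteq> j \<and> j \<noteq> l}"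
  have "\<exists>c>0. \<forall>p\<in>T. P p c"
  proof (rule finite_uniform_pos)
    show "finite T" unfolding T_def by (rule finite_subset[of _ "I \<times> I \<times> I"]) auto
    fix p assume "p \<in> T"
    then obtain i j l where p: "p = (i, j, l)" and ijl: "i \<in> I" "j \<in> I" "l \<in> I" "i \<noteq> j" "j \<noteq> l"
      by (auto simp: T_def)
    define F where "F = (\<lambda>x::'a \<times> 'a \<times> 'a. norm (sgn (snd (snd x) - fst (snd x)) - sgn (fst (snd x) - fst x)))"
    let ?S = "K i \<times> K j \<times> K l"
    have S: "compact ?S" "?S \<noteq> {}"
      using obstacle(1,2)[OF ijl(1)] obstacle(1,2)[OF ijl(2)] obstacle(1,2)[OF ijl(3)]
      by (auto intro!: compact_Times)
    have ne: "fst (snd x) \<noteq> fst x" "snd (snd x) \<noteq> fst (snd x)" if "x \<in> ?S" for x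
      using that obstacles_disjoint[OF ijl(1,2)] obstacles_disjoint[OF ijl(2,3)] ijl(4,5) by auto
    have "continuous_on ?S F"
      unfolding F_def sgn_div_norm using ne by (intro continuous_intros) force+
    from continuous_attains_inf[OF S this] obtain x where x: "x \<in> ?S" "\<forall>y\<in>?S. F x \<le> F y" by blast
    obtain a b e where abe: "x = (a, b, e)" by (cases x)
    have "F x \<noteq> 0"
    proof
      assume "F x = 0"
      then have "sgn (e - b) = sgn (b - a)" by (simp add: F_def abe)
      moreover have "a \<noteq> b" using ne(1)[OF x(1)] by (simp add: abe)
      ultimately have seg: "b \<in> closed_segment a e" by (rule sgn_eq_between)
      have mem: "a \<in> K i" "b \<in> K j" "e \<in> K l" using x(1) by (auto simp: abe)
      show False
      proof (cases "i = l")
        case True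
        then have "b \<in> K i"
          using closed_segment_subset[OF mem(1) _ obstacle(5)[OF ijl(1)], of e] mem(3) seg by blast
        then show False using obstacles_disjoint[OF ijl(1,2) _ mem(2)] ijl(4) by blast
      next
        case False
        have "convex hull (K i \<union> K l) \<inter> K j = {}"
          using table ijl False unfolding open_billiard_def by simp
        moreover have "closed_segment a e \<subseteq> convex hull (K i \<union> K l)"
          unfolding segment_convex_hull using mem by (intro hull_mono) auto
        ultimately show False using seg mem(2) by blast
      qed
    qed
    then have "F x > 0" by (simp add: F_def)
    with x(2) show "\<exists>c>0. P p c"
      by (intro exI[of _ "F x"]) (simp add: P_def p F_def)
  next
    fix p d e
    assume "P p d" "(e::real) \<le> d"
    then show "P p e"
      unfolding P_def by (cases p) (simp, meson order_trans)
  qed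
  then obtain c where c: "c > 0" "\<forall>p\<in>T. P p c" by blast
  show ?thesis
  proof (intro exI[of _ c] conjI ballI impI c(1))
    fix i j l a b e
    assume *: "i \<in> I" "j \<in> I" "l \<in> I" "i \<noteq> j" "j \<noteq> l" and mem: "a \<in> K i" "b \<in> K j" "e \<in> K l"
    from * have "(i, j, l) \<in> T" by (simp add: T_def)
    from c(2)[rule_format, OF this] mem show "c \<le> norm (sgn (e - b) - sgn (b - a))" by (simp add: P_def)
  qed
qed

lemma impact_other_obstacle:
  assumes "y \<in> outgoing" "hit_times Q y \<noteq> {}"
  obtains i j where "i \<in> I" "j \<in> I" "i \<noteq> j" "fst y \<in> K i" "impact y \<in> K j"
proof -
  have y: "y \<in> states" "fst y \<in> frontier Q" using assms(1) by (auto simp: outgoing_def)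
  from frontier_obstacles_cases[OF y(2)] obtain i where i: "i \<in> I" "fst y \<in> K i" .
  from impact_others[OF y(1) assms(2)] obtain j where j: "j \<in> I" "fst y \<notin> K j" "impact y \<in> frontier (K j)"
    by (auto simp: others_def)
  have "i \<noteq> j" using i j by auto
  with that i j frontier_obstacleD[OF j(1,3)] show thesis by blast
qed

lemma impact_sgn:
  assumes "y \<in> states" "hit_times Q y \<noteq> {}" "norm (snd y) = 1"
  shows "sgn (impact y - fst y) = snd y" "dist (fst y) (impact y) = flight_time Q y"
  using flight_time_pos[OF assms(1,2)] assms(3) by (simp_all add: impact_def sgn_div_norm dist_norm)

text \<open>The two cosine bounds concern a state whose past is known to contain an impact, either because it is itself
  the image of a state, or because its time reversal hits an obstacle.\<close>

definition orbit_bounds :: "real \<Rightarrow> real \<Rightarrow> bool" where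
  "orbit_bounds c d \<longleftrightarrow> (\<forall>y\<in>outgoing. norm (snd y) = 1 \<longrightarrow> hit_times Q y \<noteq> {} \<longrightarrow>
     d \<le> flight_time Q y \<and>
     (hit_times Q (billiard Q y) \<noteq> {} \<longrightarrow> c \<le> snd (billiard Q y) \<bullet> \<nu> (impact y)) \<and>
     (hit_times Q (reversal Q y) \<noteq> {} \<longrightarrow> c \<le> snd y \<bullet> \<nu> (fst y)))"

text \<open>At a reflection the velocity changes by twice its normal component, so a lower bound for the deflection is one
  for the cosine of the angle of reflection.\<close>

lemma uniform_bounds: "\<exists>c>0. \<exists>d>0. orbit_bounds c d"
proof -
  obtain d where d: "d > 0" "\<forall>i\<in>I. \<forall>j\<in>I. i \<noteq> j \<longrightarrow> (\<forall>x\<in>K i. \<forall>y\<in>K j. d \<le> dist x y)"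
    using obstacle_distance by blast
  obtain c where c: "c > 0" "\<forall>i\<in>I. \<forall>j\<in>I. \<forall>l\<in>I. i \<noteq> j \<longrightarrow> j \<noteq> l \<longrightarrow>
    (\<forall>a\<in>K i. \<forall>b\<in>K j. \<forall>e\<in>K l. c \<le> norm (sgn (e - b) - sgn (b - a)))"
    using deflection by blast
  have ref: "c / 2 \<le> v \<bullet> \<nu> q" if "q \<in> frontier Q" "c \<le> norm (v - u)" "v - u = (2 * (v \<bullet> \<nu> q)) *\<^sub>R \<nu> q" "0 \<le> v \<bullet> \<nu> q" for q v u
    using that norm_normal[OF that(1)] by simp
  show ?thesis unfolding orbit_bounds_def
  proof (rule exI[of _ "c / 2"], intro conjI exI[of _ d] ballI impI)
    show "c / 2 > 0" "d > 0" using c d by auto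
    fix y assume y: "y \<in> outgoing" "norm (snd y) = 1"
    then have ys: "y \<in> states" using outgoing_states by blast
    {
      assume h: "hit_times Q y \<noteq> {}"
      from impact_other_obstacle[OF y(1) h] obtain i j where ij: "i \<in> I" "j \<in> I" "i \<noteq> j" "fst y \<in> K i" "impact y \<in> K j" .
      then show "d \<le> flight_time Q y" using d(2)[rule_format, OF ij] impact_sgn(2)[OF ys h y(2)] by simp
      {
        define y' where "y' = billiard Q y"
        assume h': "hit_times Q (billiard Q y) \<noteq> {}"
        have y': "y' \<in> outgoing" "norm (snd y') = 1" "fst y' = impact y"
          using billiard_outgoing[OF ys h] y(2) by (auto simp: y'_def billiard_impact)
        from impact_other_obstacle[OF y'(1) h'[folded y'_def]] obtain j' l where
          jl: "j' \<in> I" "l \<in> I" "j' \<noteq> l" "fst y' \<in> K j'" "impact y' \<in> K l" .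
        have "j' = j" using obstacles_disjoint[OF jl(1) ij(2)] jl(4) ij(5) y'(3) by simp
        with c(2)[rule_format, OF ij(1,2) jl(2) ij(3) _ ij(4,5) jl(5)] jl(3)
        have "c \<le> norm (sgn (impact y' - impact y) - sgn (impact y - fst y))" by simp
        then have cc: "c \<le> norm (snd y' - snd y)"
          using impact_sgn(1)[OF ys h y(2)] impact_sgn(1)[of y'] y' outgoing_states h'[folded y'_def] by auto
        note q = impact_frontier[OF ys h]
        have "snd y' \<bullet> \<nu> (impact y) = - (snd y \<bullet> \<nu> (impact y))"
          using reflected_normal(2)[OF q, of "snd y"] by (simp add: y'_def billiard_impact inner_commute)
        then show "c / 2 \<le> snd (billiard Q y) \<bullet> \<nu> (impact y)"
          using impact_incoming[OF ys h] cc
          by (intro ref[OF q, of _ "snd y"]) (simp_all add: y'_def billiard_impact reflected_def)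
      }
      {
        define x where "x = reversal Q y"
        define u where "u = reflected Q (fst y) (snd y)"
        have fy: "fst y \<in> frontier Q" and vy: "0 \<le> \<nu> (fst y) \<bullet> snd y"
          using y(1) frontier_subset_closed[OF closed_obstacles] by (auto simp: outgoing_def states_def)
        assume h': "hit_times Q (reversal Q y) \<noteq> {}"
        have x: "x = (fst y, - u)" using fy by (simp add: x_def u_def reversal_def)
        have u1: "norm u = 1" using reflected_normal(1)[OF fy] y(2) by (simp add: u_def)
        have xo: "x \<in> outgoing"
          using reflected_normal(2)[OF fy, of "snd y"] fy vy u1 unfolding x outgoing_def states_def u_def
          by (auto simp: inner_commute)
        then have xs: "x \<in> states" using outgoing_states by blast
        have x1: "norm (snd x) = 1" using u1 by (simp add: x)
        from impact_other_obstacle[OF xo h'[folded x_def]] obtain j' l where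
          jl: "j' \<in> I" "l \<in> I" "j' \<noteq> l" "fst x \<in> K j'" "impact x \<in> K l" .
        have "j' = i" using obstacles_disjoint[OF jl(1) ij(1)] jl(4) ij(4) by (simp add: x)
        with c(2)[rule_format, OF jl(2) ij(1,2) _ ij(3) jl(5) ij(4,5)] jl(3)
        have "c \<le> norm (sgn (impact y - fst y) - sgn (fst y - impact x))" by simp
        moreover have "sgn (fst y - impact x) = u"
        proof -
          have "sgn (fst y - impact x) = - sgn (impact x - fst x)"
            by (simp add: x sgn_minus[symmetric])
          then show ?thesis using impact_sgn(1)[OF xs h'[folded x_def] x1] by (simp add: x)
        qed
        ultimately have cc: "c \<le> norm (snd y - u)" using impact_sgn(1)[OF ys h y(2)] by simp
        show "c / 2 \<le> snd y \<bullet> \<nu> (fst y)"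
          by (rule ref[OF fy cc]) (use vy in \<open>simp_all add: u_def reflected_def inner_commute\<close>)
      }
    }
  qed
qed

lemma M0_regular_orbit:
  assumes "x \<in> M0 Q"
  shows "regular_orbit x" "x \<in> outgoing" "norm (snd x) = 1" "0 < snd x \<bullet> \<nu> (fst x)"
proof -
  show x: "x \<in> outgoing" "norm (snd x) = 1"
    using assms boundary_states_outgoing by (auto simp: M0_def boundary_states_def)
  have h: "hit_times Q ((billiard Q ^^ m) x) \<noteq> {}" "hit_times Q ((billiard Q ^^ m) (reversal Q x)) \<noteq> {}" for m
    using assms by (auto simp: M0_def)
  obtain c d where c: "c > 0" and "orbit_bounds c d" using uniform_bounds by blast
  note cd = this(2)[unfolded orbit_bounds_def]
  show "0 < snd x \<bullet> \<nu> (fst x)" using cd[rule_format, OF x] h(1)[of 0] h(2)[of 0] c by simp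
  have o: "(billiard Q ^^ m) x \<in> outgoing \<and> norm (snd ((billiard Q ^^ m) x)) = 1" for m
  proof (induction m)
    case 0
    then show ?case using x by simp
  next
    case (Suc m)
    then show ?case using billiard_outgoing[OF _ h(1)[of m]] outgoing_states by auto
  qed
  show "regular_orbit x" unfolding regular_orbit_def transversal_def
  proof (intro conjI allI h)
    show "x \<in> states" using x outgoing_states by blast
    fix m
    let ?y = "(billiard Q ^^ m) x"
    have "c \<le> snd (billiard Q ?y) \<bullet> \<nu> (impact ?y)"
      using cd[rule_format, of ?y] o[of m] h(1)[of m] h(1)[of "Suc m"] by simp
    moreover have "snd (billiard Q ?y) \<bullet> \<nu> (impact ?y) = - (snd ?y \<bullet> \<nu> (impact ?y))"
      using reflected_normal(2)[OF impact_frontier[of ?y], of "snd ?y"] o[of m] outgoing_states h(1)[of m]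
      by (auto simp: billiard_impact inner_commute)
    ultimately show "snd ?y \<bullet> \<nu> (impact ?y) < 0" using c by simp
  qed
qed

section \<open>Moving along a free path\<close>

definition advance :: "real \<Rightarrow> 'a \<times> 'a \<Rightarrow> 'a \<times> 'a" where
  "advance r x = (fst x + r *\<^sub>R snd x, snd x)"

lemma advance_free_path:
  assumes x: "x \<in> states" "hit_times Q x \<noteq> {}" and r: "0 < r" "r < flight_time Q x"
  shows "advance r x \<in> exterior" "hit_times Q (advance r x) \<noteq> {}"
    "flight_time Q (advance r x) = flight_time Q x - r" "billiard Q (advance r x) = billiard Q x"
proof -
  have nf: "fst x + t *\<^sub>R snd x \<notin> frontier Q" if "0 < t" "t < flight_time Q x" for t
    using flight_time_le[of t x] that by (auto simp: hit_times_def)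
  show "advance r x \<in> exterior"
  proof -
    have "fst x + r *\<^sub>R snd x \<notin> interior Q" using free_path[of "fst x" "snd x" r] x r by simp
    then have "fst x + r *\<^sub>R snd x \<notin> Q"
      using nf[OF r] closure_subset[of Q] unfolding frontier_def by auto
    then show ?thesis using x(1) by (auto simp: exterior_def advance_def states_def)
  qed
  have fl: "flight_time Q x \<in> hit_times Q x" using flight_time_hit[of "fst x" "snd x"] x by simp
  have eq: "fst (advance r x) + t *\<^sub>R snd (advance r x) = fst x + (r + t) *\<^sub>R snd x" for t
    by (simp add: advance_def algebra_simps)
  have mem: "flight_time Q x - r \<in> hit_times Q (advance r x)"
    using fl r unfolding hit_times_def mem_Collect_eq eq by simp
  then show "hit_times Q (advance r x) \<noteq> {}" by blast
  show ft: "flight_time Q (advance r x) = flight_time Q x - r"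
    unfolding flight_time_def[of Q "advance r x"]
  proof (rule cInf_eq_minimum[OF mem])
    fix t assume "t \<in> hit_times Q (advance r x)"
    then have "0 < t" "fst x + (r + t) *\<^sub>R snd x \<in> frontier Q" unfolding hit_times_def mem_Collect_eq eq by auto
    then show "flight_time Q x - r \<le> t" using nf[of "r + t"] r(1) by fastforce
  qed
  show "billiard Q (advance r x) = billiard Q x"
    unfolding billiard_def ft eq by (simp add: advance_def)
qed

lemma backward_exterior: "y \<in> exterior \<Longrightarrow> (fst y, - snd y) \<in> exterior"
  by (auto simp: exterior_def)

lemma foot_properties:
  assumes y: "y \<in> exterior" and h: "hit_times Q (fst y, - snd y) \<noteq> {}" "hit_times Q y \<noteq> {}"
  shows "foot Q y \<in> outgoing" "billiard Q (foot Q y) = billiard Q y"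
proof -
  define b where "b = (fst y, - snd y)"
  define \<tau> where "\<tau> = flight_time Q b"
  define x where "x = foot Q y"
  have b: "b \<in> states" "hit_times Q b \<noteq> {}"
    using backward_exterior[OF y] exterior_states h by (auto simp: b_def)
  have \<tau>: "\<tau> > 0" using flight_time_pos[OF b] by (simp add: \<tau>_def)
  have x: "x = (impact b, snd y)" by (simp add: x_def foot_def impact_def b_def)
  have y0: "snd y \<noteq> 0" "fst y \<notin> Q" using y by (auto simp: exterior_def)
  show xo: "foot Q y \<in> outgoing"
    using impact_frontier[OF b] impact_incoming[OF b] y0 unfolding x_def[symmetric] x
    by (auto simp: outgoing_def states_def b_def inner_commute)
  then have xs: "x \<in> states" using outgoing_states by (auto simp: x_def)
  have adv: "advance \<tau> x = y" by (simp add: advance_def x impact_def b_def \<tau>_def)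
  have eq: "fst x + t *\<^sub>R snd x = fst y + (t - \<tau>) *\<^sub>R snd y" for t
    unfolding x impact_def by (simp add: b_def \<tau>_def algebra_simps)
  have fr: "fst x + t *\<^sub>R snd x \<notin> frontier Q" if "0 < t" "t \<le> \<tau>" for t
  proof (cases "t = \<tau>")
    case True
    then show ?thesis using y0(2) frontier_subset_closed[OF closed_obstacles] by (auto simp: eq)
  next
    case False
    have "\<tau> - t \<notin> hit_times Q b" using flight_time_le[of "\<tau> - t" b] that unfolding \<tau>_def by force
    then have "fst y - (\<tau> - t) *\<^sub>R snd y \<notin> frontier Q" using False that by (simp add: hit_times_def b_def)
    then show ?thesis by (simp add: eq algebra_simps)
  qed
  obtain t where t: "0 < t" "fst y + t *\<^sub>R snd y \<in> frontier Q" using h(2) by (auto simp: hit_times_def)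
  have "t + \<tau> \<in> hit_times Q x" using t \<tau> unfolding hit_times_def mem_Collect_eq eq by simp
  then have hx: "hit_times Q x \<noteq> {}" by blast
  have "flight_time Q x \<in> hit_times Q x" using flight_time_hit[of "fst x" "snd x"] xs hx by simp
  then have "\<tau> < flight_time Q x" using fr[of "flight_time Q x"] by (force simp: hit_times_def)
  from advance_free_path(4)[OF xs hx \<tau> this] show "billiard Q (foot Q y) = billiard Q y"
    by (simp add: adv x_def[symmetric])
qed

lemma orbit_Suc: "(billiard Q ^^ Suc m) y = (billiard Q ^^ m) (billiard Q y)"
  by (simp only: funpow_Suc_right comp_def)

lemma advance_orbit:
  assumes x: "x \<in> states" "hit_times Q x \<noteq> {}" and r: "0 < r" "r < flight_time Q x"
  shows "(billiard Q ^^ Suc m) (advance r x) = (billiard Q ^^ Suc m) x"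
  unfolding orbit_Suc advance_free_path(4)[OF assms] ..

lemma advance_regular_orbit:
  assumes x: "regular_orbit x" and r: "0 < r" "r < flight_time Q x"
  shows "regular_orbit (advance r x)"
proof -
  have xs: "x \<in> states" "hit_times Q x \<noteq> {}" using orbit_states(1)[OF x, of 0] orbit_hits[OF x, of 0] by auto
  note a = advance_free_path[OF xs r]
  have "transversal ((billiard Q ^^ m) (advance r x))" for m
  proof (cases m)
    case 0
    have "impact (advance r x) = impact x" using a(4) by (simp add: billiard_impact)
    then show ?thesis using 0 a(2) orbit_transversal[OF x, of 0] by (simp add: transversal_def advance_def)
  next
    case (Suc k)
    then show ?thesis using advance_orbit[OF xs r, of k] orbit_transversal[OF x, of m] by simp
  qed
  then show ?thesis using a(1) exterior_states unfolding regular_orbit_def by blast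
qed

lemma backward_flight:
  assumes x: "x \<in> outgoing" "hit_times Q x \<noteq> {}" and r: "0 < r" "r < flight_time Q x"
  shows "hit_times Q (fst (advance r x), - snd x) \<noteq> {}" "flight_time Q (fst (advance r x), - snd x) = r"
    "foot Q (advance r x) = x" "billiard Q (fst (advance r x), - snd x) = reversal Q x"
proof -
  have fx: "fst x \<in> frontier Q" using x by (simp add: outgoing_def)
  have eq: "fst (advance r x) + t *\<^sub>R (- snd x) = fst x + (r - t) *\<^sub>R snd x" for t
    by (simp add: advance_def algebra_simps)
  have mem: "r \<in> hit_times Q (fst (advance r x), - snd x)"
    unfolding hit_times_def mem_Collect_eq fst_conv snd_conv eq using r fx by simp
  then show "hit_times Q (fst (advance r x), - snd x) \<noteq> {}" by blast
  show ft: "flight_time Q (fst (advance r x), - snd x) = r"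
    unfolding flight_time_def[of Q "(fst (advance r x), - snd x)"]
  proof (rule cInf_eq_minimum[OF mem])
    fix t assume "t \<in> hit_times Q (fst (advance r x), - snd x)"
    then have t: "0 < t" "fst x + (r - t) *\<^sub>R snd x \<in> frontier Q"
      unfolding hit_times_def mem_Collect_eq fst_conv snd_conv eq by auto
    show "r \<le> t"
    proof (rule ccontr)
      assume "\<not> r \<le> t"
      then have "r - t \<in> hit_times Q x" using t by (simp add: hit_times_def)
      then show False using flight_time_le[of "r - t" x] t r by simp
    qed
  qed
  have [simp]: "snd (advance r x) = snd x" by (simp add: advance_def)
  show "foot Q (advance r x) = x" unfolding foot_def by (simp add: ft) (simp add: advance_def)
  show "billiard Q (fst (advance r x), - snd x) = reversal Q x"
    unfolding billiard_def Let_def ft fst_conv snd_conv eq using fx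
    by (simp add: reversal_def reflected_def)
qed

end


section \<open>Curvature of the image of a front\<close>

text \<open>A piece \<open>X\<close> of a hypersurface \<open>Z\<close> that fills \<open>Z\<close> near \<open>p\<close>. There \<open>Z\<close> is the zero set of \<open>f\<close>, and the unit
  gradient of \<open>f\<close> extends \<open>n\<close> to a full neighbourhood.\<close>

locale front =
  fixes Z X W U :: "'a::euclidean_space set" and n :: "'a \<Rightarrow> 'a" and p :: 'a
    and f :: "'a \<Rightarrow> real" and g :: "'a \<Rightarrow> 'a" and N' :: "'a \<Rightarrow> 'a"
  assumes p: "p \<in> U" "p \<in> W" "p \<in> Z" and W: "open W" "Z \<inter> W \<subseteq> X" "X \<subseteq> Z"
    and sub: "submersion_on f g U" and ZU: "Z \<inter> U = {x\<in>U. f x = 0}"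
    and n: "\<And>x. x \<in> Z \<inter> U \<Longrightarrow> n x = sgn (g x)"
    and N': "strict_derivative (\<lambda>x. sgn (g x)) N' p UNIV"
begin

lemma base_normal: "n p = sgn (g p)" "norm (n p) = 1" "x \<bullet> n p = 0 \<longleftrightarrow> x \<bullet> g p = 0"
proof -
  note g = submersion_onD(3)[OF sub p(1)]
  show n: "n p = sgn (g p)" using n[of p] p by simp
  show "norm (n p) = 1" unfolding n using g by (simp add: norm_sgn)
  show "x \<bullet> n p = 0 \<longleftrightarrow> x \<bullet> g p = 0" unfolding n using g by (simp add: sgn_div_norm)
qed

lemma front_contingent:
  assumes "x \<bullet> n p = 0" "open V" "p \<in> V"
  shows "contingent (X \<inter> U \<inter> V) p x"
proof -
  note s = submersion_onD[OF sub p(1)]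
  have "x \<bullet> g p = 0" using assms(1) base_normal(3) by blast
  moreover have "f p = 0" using p ZU by blast
  ultimately have "contingent {x\<in>U. f x = 0} p x" by (intro contingent_level_set[OF s(1) p(1) s(2,6) _ s(3)])
  from contingent_open_Int[OF this, of "W \<inter> V"] W assms(2,3) p
  have "contingent ({x\<in>U. f x = 0} \<inter> (W \<inter> V)) p x" by auto
  moreover have "{x\<in>U. f x = 0} \<inter> (W \<inter> V) \<subseteq> X \<inter> U \<inter> V" using ZU W by blast
  ultimately show ?thesis by (rule contingent_mono)
qed

lemma normal_derivative_perp: "N' x \<bullet> n p = 0"
  unfolding base_normal(1) by (rule unit_gradient_derivative_perp[OF sub p(1) N'])

lemma tangent_curve:
  assumes q: "(q has_vector_derivative u) (at 0 within {0..a})" and a: "0 < a" and X: "q ` {0..a} \<subseteq> X" and q0: "q 0 = p"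
  shows "u \<bullet> n p = 0"
proof -
  note s = submersion_onD[OF sub p(1)]
  have "contingent (q ` {0..a}) (q 0) (1 *\<^sub>R u)"
    by (rule contingent_image[OF q[unfolded has_vector_derivative_def] contingent_interval[OF a]])
  then have "contingent X p u" using contingent_mono[OF _ X] q0 by auto
  from contingent_open_Int[OF this s(1) p(1)] have "contingent (X \<inter> U) p u" .
  moreover have "f x = 0" if "x \<in> X \<inter> U" for x using that ZU W by blast
  ultimately have "u \<bullet> g p = 0"
    by (intro contingent_unique[OF has_derivative_at_withinI[OF s(2)] has_derivative_const, of "X \<inter> U" 0 u])
       (use p ZU in auto)
  then show ?thesis using base_normal(3) by blast
qed

lemma curvature_operator_hypersurface:
  assumes "curvature_operator (with_normal n ` Z) p S" "x \<bullet> n p = 0"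
  shows "S x = N' x"
proof -
  obtain M where M: "\<And>x. x \<in> Z \<Longrightarrow> M x = n x" "(M has_derivative S) (at p within Z)"
    using assms(1) unfolding curvature_operator_def by (auto simp: with_normal_def image_image)
  have d: "((\<lambda>x. sgn (g x)) has_derivative N') (at p within X \<inter> U \<inter> UNIV)"
    by (rule has_derivative_at_withinI, rule strict_derivative_imp_has_derivative[OF N']) simp
  have M2: "(M has_derivative S) (at p within X \<inter> U \<inter> UNIV)"
    by (rule has_derivative_subset[OF M(2)]) (use W in auto)
  show ?thesis
    by (rule contingent_unique[OF M2 d _ _ front_contingent[OF assms(2)]]) (use M(1) n W p in auto)
qed

text \<open>\<open>\<Phi>\<close> is meant to be the flow for a fixed time. If its position component has an injective derivative on
  the tangent space, it carries a small piece of the front to a front whose curvature operator is the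
  derivative of the velocity composed with the inverse of the derivative of the position.\<close>

context
  fixes \<Phi> :: "'a \<times> 'a \<Rightarrow> 'a \<times> 'a" and A B :: "'a \<times> 'a \<Rightarrow> 'a"
  assumes A: "strict_derivative (\<lambda>y. fst (\<Phi> y)) A (p, n p) UNIV"
    and B: "strict_derivative (\<lambda>y. snd (\<Phi> y)) B (p, n p) UNIV"
begin

abbreviation "position \<equiv> \<lambda>x. fst (\<Phi> (x, n x))"
abbreviation "velocity \<equiv> \<lambda>x. snd (\<Phi> (x, n x))"
abbreviation "ext_position \<equiv> \<lambda>x. fst (\<Phi> (x, sgn (g x)))"
abbreviation "ext_velocity \<equiv> \<lambda>x. snd (\<Phi> (x, sgn (g x)))"

lemma lift_strict: "strict_derivative (\<lambda>x. (x, sgn (g x))) (\<lambda>x. (x, N' x)) p UNIV"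
  by (rule strict_derivative_Pair[OF strict_derivative_bounded_linear[OF bounded_linear_ident] N']) simp

lemma ext_strict:
  "strict_derivative ext_position (\<lambda>x. A (x, N' x)) p UNIV"
  "strict_derivative ext_velocity (\<lambda>x. B (x, N' x)) p UNIV"
proof -
  have "filterlim (\<lambda>x. (x, sgn (g x))) (near (p, sgn (g p)) UNIV) (near p UNIV)"
    using strict_derivative_tendsto[OF lift_strict] by (simp add: near_open)
  from strict_derivative_compose[OF lift_strict _ this]
  show "strict_derivative ext_position (\<lambda>x. A (x, N' x)) p UNIV"
    "strict_derivative ext_velocity (\<lambda>x. B (x, N' x)) p UNIV"
    using A B unfolding base_normal(1) by auto
qed

lemma ext_eq:
  assumes "x \<in> X \<inter> U"
  shows "ext_position x = position x" "ext_velocity x = velocity x"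
proof -
  from assms have "n x = sgn (g x)" using n[of x] W by blast
  then show "ext_position x = position x" "ext_velocity x = velocity x" by simp_all
qed

lemma position_derivative:
  "(position has_derivative (\<lambda>x. A (x, N' x))) (at p within X)"
  "(velocity has_derivative (\<lambda>x. B (x, N' x))) (at p within X)"
proof -
  have pX: "p \<in> X \<inter> U" using p W by blast
  have "open U" using submersion_onD(1)[OF sub p(1)] .
  then have eq: "at p within X = at p within X \<inter> U" by (intro at_within_nhd[OF p(1)]) auto
  have "(ext_position has_derivative (\<lambda>x. A (x, N' x))) (at p within X \<inter> U)"
    by (rule has_derivative_at_withinI, rule strict_derivative_imp_has_derivative[OF ext_strict(1)]) simp
  then show "(position has_derivative (\<lambda>x. A (x, N' x))) (at p within X)"
    unfolding eq by (rule has_derivative_transform[OF pX, rotated]) (rule ext_eq(1)[symmetric])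
  have "(ext_velocity has_derivative (\<lambda>x. B (x, N' x))) (at p within X \<inter> U)"
    by (rule has_derivative_at_withinI, rule strict_derivative_imp_has_derivative[OF ext_strict(2)]) simp
  then show "(velocity has_derivative (\<lambda>x. B (x, N' x))) (at p within X)"
    unfolding eq by (rule has_derivative_transform[OF pX, rotated]) (rule ext_eq(2)[symmetric])
qed

lemma curvature_operator_unique:
  assumes S: "curvature_operator (\<Phi> ` with_normal n ` (X \<inter> ball p \<delta>)) (position p) S" and \<delta>: "\<delta> > 0"
    and x: "x \<bullet> n p = 0"
  shows "S (A (x, N' x)) = B (x, N' x)"
proof -
  let ?Y = "X \<inter> ball p \<delta>"
  have im: "fst ` \<Phi> ` with_normal n ` ?Y = position ` ?Y" by (simp add: image_image with_normal_def)
  obtain M where M0: "\<forall>(p', v)\<in>\<Phi> ` with_normal n ` ?Y. M p' = v"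
    and MS: "(M has_derivative S) (at (position p) within position ` ?Y)"
    using S unfolding curvature_operator_def im by blast
  have M: "M (position x) = velocity x" if "x \<in> ?Y" for x
  proof -
    have "\<Phi> (x, n x) \<in> \<Phi> ` with_normal n ` ?Y" using that by (auto simp: with_normal_def)
    from bspec[OF M0 this] show ?thesis by (simp add: case_prod_beta)
  qed
  have P: "(position has_derivative (\<lambda>x. A (x, N' x))) (at p within ?Y)"
    "(velocity has_derivative (\<lambda>x. B (x, N' x))) (at p within ?Y)"
    by (rule has_derivative_subset[OF position_derivative(1)], simp,
        rule has_derivative_subset[OF position_derivative(2)], simp)
  from has_derivative_in_compose[OF P(1) MS]
  have D: "((\<lambda>x. M (position x)) has_derivative (\<lambda>x. S (A (x, N' x)))) (at p within ?Y)" .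
  have C: "contingent ?Y p x"
    using contingent_mono[OF front_contingent[OF x open_ball, of p \<delta>]] \<delta> by auto
  have "p \<in> ?Y" using p W \<delta> by auto
  from contingent_unique[OF D P(2) M M[OF this] C] show ?thesis .
qed

text \<open>Adjoining the component \<open>f\<close> to the position gives a map \<open>G\<close> of the ambient space with injective derivative \<open>a\<close>.
  By strict differentiability \<open>G\<close> is bounded below near \<open>p\<close>; on \<open>X\<close>, where \<open>f\<close> vanishes, this says that the
  position is injective with Lipschitz inverse. A linear left inverse of \<open>a\<close> then yields the curvature operator.\<close>

lemma curvature_operator_exists:
  assumes inj: "\<And>x. x \<bullet> n p = 0 \<Longrightarrow> A (x, N' x) = 0 \<Longrightarrow> x = 0"
  shows "\<exists>\<delta>>0. \<exists>S. curvature_operator (\<Phi> ` with_normal n ` (X \<inter> ball p \<delta>)) (position p) S"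
proof -
  note s = submersion_onD[OF sub p(1)]
  define a where "a = (\<lambda>x. (A (x, N' x), x \<bullet> g p))"
  define G where "G = (\<lambda>x. (ext_position x, f x))"
  have G: "strict_derivative G a p UNIV"
    unfolding G_def a_def by (rule strict_derivative_Pair[OF ext_strict(1) s(4)]) simp
  have lin: "linear a" using strict_derivative_linear[OF G] by (rule bounded_linear.linear)
  have inja: "inj a"
    unfolding linear_injective_0[OF lin] using inj base_normal(3) by (auto simp: a_def zero_prod_def)
  obtain c where c: "c > 0" "\<And>x. c * norm x \<le> norm (a x)" using linear_inj_bounded_below_pos[OF lin inja] by blast
  obtain L where L: "linear L" "L \<circ> a = id" using linear_injective_left_inverse[OF lin inja] by blast
  define S where "S = (\<lambda>u. (\<lambda>x. B (x, N' x)) (L (u, 0)))"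
  have bB: "bounded_linear (\<lambda>x. B (x, N' x))" using strict_derivative_linear[OF ext_strict(2)] .
  have bL: "bounded_linear L" using L(1) linear_conv_bounded_linear by blast
  have bBL: "bounded_linear (\<lambda>u. (\<lambda>x. B (x, N' x)) (L u))" by (rule bounded_linear_compose[OF bB bL])
  have bS: "bounded_linear S" unfolding S_def
    by (rule bounded_linear_compose[OF bBL]) (intro bounded_linear_Pair bounded_linear_ident bounded_linear_zero)
  obtain C where C: "C > 0" "\<And>u. norm (B (L u, N' (L u))) \<le> norm u * C"
    using bounded_linear.pos_bounded[OF bBL] by blast
  have "c / 2 > 0" using c by simp
  from strict_derivativeD[OF G this]
  obtain P1 P2 where P: "eventually P1 (nhds p)" "eventually P2 (nhds p)"
    "\<And>x y. P1 x \<Longrightarrow> P2 y \<Longrightarrow> norm (G x - G y - a (x - y)) \<le> c / 2 * norm (x - y)"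
    unfolding eventually_prod_filter by (auto simp: near_open)
  have "\<forall>\<^sub>F x in nhds p. x \<in> U \<and> P1 x \<and> P2 x"
    using eventually_nhds_in_open[OF s(1) p(1)] P(1,2) by eventually_elim simp
  then obtain \<delta> where \<delta>: "\<delta> > 0" "\<And>x. dist x p < \<delta> \<Longrightarrow> x \<in> U \<and> P1 x \<and> P2 x"
    unfolding eventually_nhds_metric by blast
  define Y where "Y = X \<inter> ball p \<delta>"
  have Y: "x \<in> X \<inter> U" "P1 x" "P2 x" "f x = 0" "ext_position x = position x" "ext_velocity x = velocity x" if "x \<in> Y" for x
    using that \<delta>(2)[of x] W ZU ext_eq[of x] by (auto simp: Y_def dist_commute)
  have pY: "p \<in> Y" using p W \<delta> by (auto simp: Y_def)
  have low: "c / 2 * norm (x - y) \<le> norm (position x - position y)" if "x \<in> Y" "y \<in> Y" for x y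
  proof -
    have "c * norm (x - y) \<le> norm (a (x - y))" by (rule c(2))
    also have "\<dots> \<le> norm (G x - G y) + norm (G x - G y - a (x - y))"
      using norm_triangle_ineq4[of "G x - G y" "G x - G y - a (x - y)"] by simp
    also have "\<dots> \<le> norm (G x - G y) + c / 2 * norm (x - y)" using P(3) Y that by simp
    also have "norm (G x - G y) = norm (position x - position y)"
      using Y[OF that(1)] Y[OF that(2)] by (simp add: G_def norm_Pair)
    finally show ?thesis by simp
  qed
  have injY: "inj_on position Y"
  proof (rule inj_onI)
    fix x y assume "x \<in> Y" "y \<in> Y" "position x = position y"
    then have "c / 2 * norm (x - y) \<le> 0" using low[of x y] by simp
    then show "x = y" using c(1) by (simp add: mult_le_0_iff)
  qed
  define M where "M = (\<lambda>u. velocity (the_inv_into Y position u))"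
  have M: "M (position x) = velocity x" if "x \<in> Y" for x
    unfolding M_def using the_inv_into_f_f[OF injY that] by simp
  have "(M has_derivative S) (at (position p) within position ` Y)"
    unfolding has_derivative_within_alt
  proof (intro conjI allI impI bS)
    fix e :: real assume e: "0 < e"
    define e1 where "e1 = e * (c / 2) / (1 + C)"
    have e1: "e1 > 0" using e c C by (simp add: e1_def)
    have "\<forall>\<^sub>F x in nhds p. norm (G x - G p - a (x - p)) \<le> e1 * norm (x - p)"
      using eventually_near_diagonal[OF strict_derivativeD[OF G e1]] by (simp add: near_open)
    moreover have "\<forall>\<^sub>F x in nhds p. norm (ext_velocity x - ext_velocity p - B (x - p, N' (x - p))) \<le> e1 * norm (x - p)"
      using eventually_near_diagonal[OF strict_derivativeD[OF ext_strict(2) e1]] by (simp add: near_open)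
    ultimately have "\<forall>\<^sub>F x in nhds p. norm (G x - G p - a (x - p)) \<le> e1 * norm (x - p) \<and>
      norm (ext_velocity x - ext_velocity p - B (x - p, N' (x - p))) \<le> e1 * norm (x - p)" by (rule eventually_conj)
    then obtain d where d: "d > 0" "\<And>x. dist x p < d \<Longrightarrow> norm (G x - G p - a (x - p)) \<le> e1 * norm (x - p)"
      "\<And>x. dist x p < d \<Longrightarrow> norm (ext_velocity x - ext_velocity p - B (x - p, N' (x - p))) \<le> e1 * norm (x - p)"
      unfolding eventually_nhds_metric by blast
    show "\<exists>d>0. \<forall>u\<in>position ` Y. norm (u - position p) < d \<longrightarrow>
      norm (M u - M (position p) - S (u - position p)) \<le> e * norm (u - position p)"
    proof (intro exI[of _ "c / 2 * d"] conjI ballI impI)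
      show "c / 2 * d > 0" using c d by simp
      fix u assume "u \<in> position ` Y" and u: "norm (u - position p) < c / 2 * d"
      then obtain x where x: "x \<in> Y" "u = position x" by blast
      have lx: "c / 2 * norm (x - p) \<le> norm (u - position p)" using low[OF x(1) pY] x(2) by simp
      then have "c / 2 * norm (x - p) < c / 2 * d" using u by simp
      then have dx: "dist x p < d" using c(1) by (simp add: dist_norm)
      have Gd: "G x - G p = (u - position p, 0)" using Y[OF x(1)] Y[OF pY] x(2) by (simp add: G_def)
      have La: "L (a h) = h" for h using L(2) by (metis comp_apply id_apply)
      interpret bB: bounded_linear "\<lambda>x. B (x, N' x)" by (rule bB)
      interpret L: linear L by (rule L(1))
      have "M u - M (position p) - S (u - position p) =
         (ext_velocity x - ext_velocity p - B (x - p, N' (x - p))) - (\<lambda>x. B (x, N' x)) (L (G x - G p - a (x - p)))"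
        unfolding x(2) M[OF x(1)] M[OF pY] S_def L.diff[of _ "a (x - p)"] bB.diff La
        using Gd Y[OF x(1)] Y[OF pY] x(2) by simp
      then have "norm (M u - M (position p) - S (u - position p)) \<le>
        norm (ext_velocity x - ext_velocity p - B (x - p, N' (x - p))) + norm ((\<lambda>x. B (x, N' x)) (L (G x - G p - a (x - p))))"
        by (metis norm_triangle_ineq4)
      also have "\<dots> \<le> e1 * norm (x - p) + (e1 * norm (x - p)) * C"
        using d(2,3)[OF dx] C(1) by (intro add_mono order_trans[OF C(2)] mult_right_mono) auto
      also have "\<dots> = e1 * (1 + C) * norm (x - p)" by (simp add: algebra_simps)
      also have "e1 * (1 + C) = e * (c / 2)" 
        using C(1) nonzero_divide_eq_eq[of "1 + C" "e * (c / 2)" e1] unfolding e1_def by simp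
      also have "e * (c / 2) * norm (x - p) = e * (c / 2 * norm (x - p))" by simp
      also have "\<dots> \<le> e * norm (u - position p)" using lx e by (intro mult_left_mono) auto
      finally show "norm (M u - M (position p) - S (u - position p)) \<le> e * norm (u - position p)" .
    qed
  qed
  moreover have "fst ` \<Phi> ` with_normal n ` Y = position ` Y" by (simp add: image_image with_normal_def)
  moreover have "\<forall>(p', v)\<in>\<Phi> ` with_normal n ` Y. M p' = v"
  proof (intro ballI)
    fix w assume "w \<in> \<Phi> ` with_normal n ` Y"
    then obtain x where "x \<in> Y" "w = \<Phi> (x, n x)" by (auto simp: with_normal_def)
    then show "case w of (p', v) \<Rightarrow> M p' = v" using M[of x] by (simp add: case_prod_beta)
  qed
  ultimately have "curvature_operator (\<Phi> ` with_normal n ` (X \<inter> ball p \<delta>)) (position p) S"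
    unfolding curvature_operator_def Y_def[symmetric] by metis
  then show ?thesis using \<delta>(1) by blast
qed

lemma the_front_curvature:
  assumes inj: "\<And>x. x \<bullet> n p = 0 \<Longrightarrow> A (x, N' x) = 0 \<Longrightarrow> x = 0" and x: "x \<bullet> n p = 0"
  shows "(THE h. \<exists>\<delta>>0. \<exists>S. curvature_operator (\<Phi> ` with_normal n ` (X \<inter> ball p \<delta>)) (fst (\<Phi> (with_normal n p))) S \<and>
    h = S (A (x, N' x))) = B (x, N' x)"
proof -
  have w: "fst (\<Phi> (with_normal n p)) = position p" by (simp add: with_normal_def)
  show ?thesis unfolding w
  proof (rule the_equality)
    from curvature_operator_exists[OF inj] obtain \<delta> S where
      S: "\<delta> > 0" "curvature_operator (\<Phi> ` with_normal n ` (X \<inter> ball p \<delta>)) (position p) S" by blast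
    with curvature_operator_unique[OF S(2,1) x]
    show "\<exists>\<delta>>0. \<exists>S. curvature_operator (\<Phi> ` with_normal n ` (X \<inter> ball p \<delta>)) (position p) S \<and> B (x, N' x) = S (A (x, N' x))"
      by (intro exI[of _ \<delta>] conjI exI[of _ S]) auto
  next
    fix h
    assume "\<exists>\<delta>>0. \<exists>S. curvature_operator (\<Phi> ` with_normal n ` (X \<inter> ball p \<delta>)) (position p) S \<and> h = S (A (x, N' x))"
    then obtain \<delta> S where S: "\<delta> > 0" "curvature_operator (\<Phi> ` with_normal n ` (X \<inter> ball p \<delta>)) (position p) S"
      and h: "h = S (A (x, N' x))" by blast
    show "h = B (x, N' x)" unfolding h by (rule curvature_operator_unique[OF S(2,1) x])
  qed
qed

end

end


section \<open>The flow along an orbit\<close>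

context billiard_table
begin

lemma refl_count_eq:
  assumes h: "\<And>i. i \<le> m \<Longrightarrow> (billiard Q ^^ i) y \<in> states \<and> hit_times Q ((billiard Q ^^ i) y) \<noteq> {}"
    and t: "refl_time Q y m \<le> t" "t < refl_time Q y (Suc m)"
  shows "refl_count Q y t = m"
  unfolding refl_count_def
proof (rule Least_equality)
  show "hit_times Q ((billiard Q ^^ m) y) = {} \<or> t < refl_time Q y (Suc m)" using t by simp
next
  fix k assume k: "hit_times Q ((billiard Q ^^ k) y) = {} \<or> t < refl_time Q y (Suc k)"
  show "m \<le> k"
  proof (rule ccontr)
    assume "\<not> m \<le> k"
    then have km: "Suc k \<le> m" by simp
    have "refl_time Q y (Suc k) \<le> refl_time Q y m"
      unfolding refl_time_def
    proof (rule sum_mono2)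
      fix i assume "i \<in> {..<m} - {..<Suc k}"
      then show "0 \<le> flight_time Q ((billiard Q ^^ i) y)" using flight_time_pos h[of i] by (simp add: less_imp_le)
    qed (use km in auto)
    then show False using k t h[of k] km by simp
  qed
qed

lemma forward_flow_eq:
  assumes "\<And>i. i \<le> m \<Longrightarrow> (billiard Q ^^ i) y \<in> states \<and> hit_times Q ((billiard Q ^^ i) y) \<noteq> {}"
    and "refl_time Q y m \<le> t" "t < refl_time Q y (Suc m)"
  shows "forward_flow Q t y = (fst ((billiard Q ^^ m) y) + (t - refl_time Q y m) *\<^sub>R snd ((billiard Q ^^ m) y), snd ((billiard Q ^^ m) y))"
  using refl_count_eq[OF assms] by (simp add: forward_flow_def Let_def)

text \<open>Flight times between different obstacles are bounded below, so the reflection times tend to infinity and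
  every time lies between two consecutive ones.\<close>

lemma forward_flow_exterior:
  assumes y: "y \<in> states" "norm (snd y) = 1" and h: "\<And>m. hit_times Q ((billiard Q ^^ m) y) \<noteq> {}" and t: "0 \<le> t"
  shows "fst (forward_flow Q t y) \<notin> interior Q" "norm (snd (forward_flow Q t y)) = 1"
proof -
  have st: "(billiard Q ^^ m) y \<in> states \<and> norm (snd ((billiard Q ^^ m) y)) = 1" for m
  proof (induction m)
    case 0
    then show ?case using y by simp
  next
    case (Suc m)
    then show ?case using billiard_outgoing[OF _ h, of m] outgoing_states by auto
  qed
  have out: "(billiard Q ^^ Suc m) y \<in> outgoing" for m
    using billiard_outgoing(1)[OF _ h, of m] st[of m] by simp
  obtain d where d: "d > 0" "\<And>m. d \<le> flight_time Q ((billiard Q ^^ Suc m) y)"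
    using uniform_bounds out st h unfolding orbit_bounds_def by metis
  have low: "real m * d \<le> refl_time Q y (Suc m)" for m
  proof (induction m)
    case 0
    show ?case using flight_time_pos[OF y(1)] h[of 0] by (simp add: refl_time_def)
  next
    case (Suc m)
    have "refl_time Q y (Suc (Suc m)) = refl_time Q y (Suc m) + flight_time Q ((billiard Q ^^ Suc m) y)"
      by (simp add: refl_time_def)
    then show ?case using Suc d(2)[of m] by (simp add: algebra_simps)
  qed
  obtain k where "t < real k * d" using d(1) reals_Archimedean3 by blast
  then have ex: "\<exists>m. t < refl_time Q y (Suc m)" using low[of k] by (intro exI[of _ k]) linarith
  define m where "m = (LEAST m. t < refl_time Q y (Suc m))"
  have m: "t < refl_time Q y (Suc m)" unfolding m_def by (rule LeastI_ex[OF ex])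
  have m': "refl_time Q y m \<le> t"
  proof (cases m)
    case 0
    then show ?thesis using t by (simp add: refl_time_def)
  next
    case (Suc k)
    then have "\<not> t < refl_time Q y (Suc k)" using not_less_Least[of k "\<lambda>m. t < refl_time Q y (Suc m)"] m_def by simp
    then show ?thesis using Suc by simp
  qed
  have eq: "forward_flow Q t y = (fst ((billiard Q ^^ m) y) + (t - refl_time Q y m) *\<^sub>R snd ((billiard Q ^^ m) y), snd ((billiard Q ^^ m) y))"
    by (rule forward_flow_eq) (use st h m m' in auto)
  show "norm (snd (forward_flow Q t y)) = 1" using st by (simp add: eq)
  have "t - refl_time Q y m < flight_time Q ((billiard Q ^^ m) y)" using m by (simp add: refl_time_def)
  then show "fst (forward_flow Q t y) \<notin> interior Q"
    using free_path[of "fst ((billiard Q ^^ m) y)" "snd ((billiard Q ^^ m) y)"] st m' by (simp add: eq)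
qed

lemma state_dist_self:
  assumes "fst y \<notin> interior Q" "norm (snd y) = 1"
  shows "state_dist Q y y = 0"
  unfolding state_dist_def
proof (rule cInf_eq_minimum, goal_cases)
  case 1
  have "y \<in> (- interior Q) \<times> sphere 0 1" using assms by (cases y) auto
  then show ?case by (intro CollectI exI[of _ "0::nat"] exI[of _ "\<lambda>_. y"]) simp
next
  case (2 x)
  then show ?case by (auto intro!: sum_nonneg)
qed

text \<open>Identifies the normal of the unstable front at its base point with the velocity of the base state.\<close>

lemma base_in_local_unstable:
  assumes x: "x \<in> M0 Q" and r: "0 < r" "r < flight_time Q x" and \<epsilon>: "0 < \<epsilon>"
  shows "advance r x \<in> local_unstable_flow Q \<epsilon> (advance r x)"
proof -
  note m = M0_regular_orbit[OF x]
  have xs: "x \<in> states" "hit_times Q x \<noteq> {}" using orbit_states(1)[OF m(1), of 0] orbit_hits[OF m(1), of 0] by auto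
  note a = advance_free_path[OF xs r] and b = backward_flight[OF m(2) xs(2) r]
  let ?y = "advance r x"
  let ?b = "(fst ?y, - snd x)"
  have n1: "norm (snd ?y) = 1" "snd ?y = snd x" using m(3) by (auto simp: advance_def)
  have nQ: "fst ?y \<notin> Q" using a(1) by (auto simp: exterior_def)
  then have nF: "fst ?y \<notin> frontier Q" using frontier_subset_closed[OF closed_obstacles] by blast
  have bs: "?b \<in> states" using backward_exterior[OF a(1)] exterior_states n1(2) by auto
  have bh: "hit_times Q ((billiard Q ^^ k) ?b) \<noteq> {}" for k
  proof (cases k)
    case 0
    then show ?thesis using b(1) by simp
  next
    case (Suc l)
    have "hit_times Q ((billiard Q ^^ l) (reversal Q x)) \<noteq> {}" using x by (simp add: M0_def)
    then show ?thesis unfolding Suc orbit_Suc b(4) .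
  qed
  have rev: "reversal Q ?y = ?b" using nF n1(2) by (simp add: reversal_def)
  have ext: "fst (flow Q t ?y) \<notin> interior Q \<and> norm (snd (flow Q t ?y)) = 1" if "t \<le> 0" for t
  proof (cases "t = 0")
    case True
    have yh: "hit_times Q ((billiard Q ^^ k) ?y) \<noteq> {}" for k
      using orbit_hits[OF advance_regular_orbit[OF m(1) r]] .
    have "?y \<in> states" using a(1) exterior_states by blast
    from forward_flow_exterior[OF this n1(1) yh, of 0] True show ?thesis by (simp add: flow_def)
  next
    case False
    define w where "w = forward_flow Q (- t) ?b"
    have w: "fst w \<notin> interior Q" "norm (snd w) = 1"
      using forward_flow_exterior[OF bs _ bh, of "- t"] that m(3) by (auto simp: w_def)
    have "flow Q t ?y = reversal Q w" using False that by (simp add: flow_def rev w_def)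
    then show ?thesis using w reflected_normal(1)[of "fst w" "snd w"] by (simp add: reversal_def)
  qed
  have z: "state_dist Q (flow Q t ?y) (flow Q t ?y) = 0" if "t \<le> 0" for t
    using state_dist_self ext[OF that] by blast
  have "\<forall>\<^sub>F t in at_bot. state_dist Q (flow Q t ?y) (flow Q t ?y) = 0"
    using eventually_le_at_bot[of "0::real"] by eventually_elim (rule z)
  then have "((\<lambda>t. state_dist Q (flow Q t ?y) (flow Q t ?y)) \<longlongrightarrow> 0) at_bot" by (rule tendsto_eventually)
  moreover have "?y \<in> flow_states Q" using nQ n1(1) unfolding flow_states_def by (cases ?y) auto
  ultimately show ?thesis using z \<epsilon> unfolding local_unstable_flow_def by simp
qed

lemma flow_strict_derivative:
  assumes y0: "y0 \<in> exterior" "regular_orbit y0"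
    and t: "refl_time Q y0 j < t" "t < refl_time Q y0 (Suc j)"
  shows "strict_derivative (\<lambda>y. fst (flow Q t y)) (\<lambda>Y. jacobi y0 j Y + (t - refl_time Q y0 j) *\<^sub>R snd (orbit_der y0 j Y)) y0 UNIV"
    "strict_derivative (\<lambda>y. snd (flow Q t y)) (\<lambda>Y. snd (orbit_der y0 j Y)) y0 UNIV"
proof -
  note c = compatible_exterior[OF y0(1)]
  have nn: "near y0 exterior = near y0 UNIV" using near_open[OF open_exterior y0(1)] by (simp add: near_open)
  note os = orbit_strict_derivative(1)[OF c y0(2), of j] and rs = refl_time_strict_derivative[OF c y0(2)]
  have "0 \<le> refl_time Q y0 j"
    unfolding refl_time_def using flight_time_pos[OF orbit_states(1)[OF y0(2)] orbit_hits[OF y0(2)]]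
    by (intro sum_nonneg) (simp add: less_imp_le)
  then have t0: "0 \<le> t" using t by simp
  have "\<forall>\<^sub>F y in near y0 exterior. \<forall>i\<in>{..j}. (billiard Q ^^ i) y \<in> states \<and> hit_times Q ((billiard Q ^^ i) y) \<noteq> {}"
    using eventually_orbit_hits[OF c y0(2)] by (simp add: eventually_ball_finite_distrib)
  moreover have "\<forall>\<^sub>F y in near y0 exterior. refl_time Q y j < t"
    by (rule order_tendstoD(2)[OF strict_derivative_tendsto[OF rs y0(1)] t(1)])
  moreover have "\<forall>\<^sub>F y in near y0 exterior. t < refl_time Q y (Suc j)"
    by (rule order_tendstoD(1)[OF strict_derivative_tendsto[OF rs y0(1)] t(2)])
  ultimately have ev: "\<forall>\<^sub>F y in near y0 exterior. flow Q t y =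
     (fst ((billiard Q ^^ j) y) + (t - refl_time Q y j) *\<^sub>R snd ((billiard Q ^^ j) y), snd ((billiard Q ^^ j) y))"
  proof eventually_elim
    case (elim y)
    then show ?case using forward_flow_eq[of j y t] t0 by (simp add: flow_def)
  qed
  have fd: "strict_derivative (\<lambda>y. fst ((billiard Q ^^ j) y)) (\<lambda>Y. fst (orbit_der y0 j Y)) y0 exterior"
    and sd: "strict_derivative (\<lambda>y. snd ((billiard Q ^^ j) y)) (\<lambda>Y. snd (orbit_der y0 j Y)) y0 exterior"
    by (rule strict_derivative_compose_linear[OF os y0(1) bounded_linear_fst],
        rule strict_derivative_compose_linear[OF os y0(1) bounded_linear_snd])
  have td: "strict_derivative (\<lambda>y. t + - refl_time Q y j) (\<lambda>Y. 0 + - time_der y0 j Y) y0 exterior"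
    by (rule strict_derivative_add[OF strict_derivative_const
        strict_derivative_compose_linear[OF rs y0(1) bounded_linear_minus[OF bounded_linear_ident]]])
  from strict_derivative_add[OF fd strict_derivative_bilinear[OF bounded_bilinear_scaleR y0(1) td sd]]
  have "strict_derivative (\<lambda>y. fst ((billiard Q ^^ j) y) + (t + - refl_time Q y j) *\<^sub>R snd ((billiard Q ^^ j) y))
     (\<lambda>Y. jacobi y0 j Y + (t - refl_time Q y0 j) *\<^sub>R snd (orbit_der y0 j Y)) y0 exterior"
    by (simp add: jacobi_def algebra_simps)
  then show "strict_derivative (\<lambda>y. fst (flow Q t y)) (\<lambda>Y. jacobi y0 j Y + (t - refl_time Q y0 j) *\<^sub>R snd (orbit_der y0 j Y)) y0 UNIV"
    by (intro strict_derivative_near_cong[OF strict_derivative_cong nn]) (use ev in \<open>auto elim: eventually_mono\<close>)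
  show "strict_derivative (\<lambda>y. snd (flow Q t y)) (\<lambda>Y. snd (orbit_der y0 j Y)) y0 UNIV"
    by (intro strict_derivative_near_cong[OF strict_derivative_cong[OF sd] nn]) (use ev in \<open>auto elim: eventually_mono\<close>)
qed

end

text \<open>An injective map between spaces of equal dimension.\<close>

lemma hyperplane_onto:
  fixes A :: "'a::euclidean_space \<Rightarrow> 'a"
  assumes A: "linear A" and v: "v \<noteq> 0" "v' \<noteq> 0" and im: "\<And>x. x \<bullet> v = 0 \<Longrightarrow> A x \<bullet> v' = 0"
    and inj: "\<And>x. x \<bullet> v = 0 \<Longrightarrow> A x = 0 \<Longrightarrow> x = 0" and w: "w \<bullet> v' = 0"
  shows "\<exists>x. x \<bullet> v = 0 \<and> A x = w"
proof -
  let ?S = "{x. v \<bullet> x = 0}" and ?T = "{x. v' \<bullet> x = 0}"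
  have S: "subspace ?S" "subspace ?T" by (rule subspace_hyperplane)+
  have "inj_on A ?S"
    unfolding linear_inj_on_iff_eq_0[OF A S(1)] using inj by (simp add: inner_commute)
  then have "dim (A ` ?S) = dim ?S" 
    by (intro dim_image_eq[OF A]) (simp only: span_eq_iff[THEN iffD2, OF S(1)])
  then have "dim (A ` ?S) = dim ?T" using dim_hyperplane[OF v(1)] dim_hyperplane[OF v(2)] by simp
  moreover have "A ` ?S \<subseteq> ?T" using im by (auto simp: inner_commute)
  ultimately have "A ` ?S = ?T"
    by (intro subspace_dim_equal linear_subspace_image[OF A S(1)] S(2)) simp_all
  moreover have "w \<in> ?T" using w by (simp add: inner_commute)
  ultimately obtain x where "x \<in> ?S" "w = A x" by blast
  then show ?thesis by (intro exI[of _ x]) (simp add: inner_commute)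
qed

section \<open>Curvature and direction along the trajectory\<close>

locale billiard_front = billiard_table K z + front Z X W U n p f g N'
  for K :: "nat \<Rightarrow> 'a::euclidean_space set" and z and Z X W U :: "'a set" and n p f g N' +
  assumes ext: "(p, n p) \<in> exterior" and reg: "regular_orbit (p, n p)"
    and convex: "\<And>x. x \<bullet> n p = 0 \<Longrightarrow> x \<noteq> 0 \<Longrightarrow> 0 < x \<bullet> N' x"
begin

abbreviation "base \<equiv> (p, n p)"
abbreviation "T j \<equiv> refl_time Q base j"

text \<open>Displacement and change of velocity for the tangent vector \<open>x\<close> of the front: between the reflections \<open>j\<close>
  and \<open>j + 1\<close>, the front at time \<open>t\<close> has the tangent vector \<open>J j x + (t - T j) *\<^sub>R V j x\<close>, and its curvature operator maps
  this vector to \<open>V j x\<close>.\<close>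

definition J :: "nat \<Rightarrow> 'a \<Rightarrow> 'a" where "J j x = jacobi base j (x, N' x)"
definition V :: "nat \<Rightarrow> 'a \<Rightarrow> 'a" where "V j x = snd (orbit_der base j (x, N' x))"

lemma diverging_tangent: "x \<bullet> n p = 0 \<Longrightarrow> diverging base (x, N' x)"
  using normal_derivative_perp[of x] convex[of x] by (cases "x = 0") (auto simp: diverging_def)

lemma flow_derivs:
  assumes "T j < t" "t < T (Suc j)"
  shows "strict_derivative (\<lambda>y. fst (flow Q t y)) (\<lambda>Y. jacobi base j Y + (t - T j) *\<^sub>R snd (orbit_der base j Y)) (p, n p) UNIV"
    "strict_derivative (\<lambda>y. snd (flow Q t y)) (\<lambda>Y. snd (orbit_der base j Y)) (p, n p) UNIV"
  using flow_strict_derivative[OF ext reg assms] by auto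

lemma T_less: "T j < T (Suc j)"
  using flight_time_pos[OF orbit_states(1)[OF reg] orbit_hits[OF reg], of j] by (simp add: refl_time_def)

lemma bounded_linear_V: "bounded_linear (V j)"
proof -
  obtain t where t: "T j < t" "t < T (Suc j)" using dense[OF T_less] by blast
  from strict_derivative_linear[OF ext_strict(2)[OF flow_derivs[OF t]]]
  show ?thesis unfolding V_def[abs_def] .
qed

lemma linear_position:
  assumes t: "T j < t" "t < T (Suc j)"
  shows "bounded_linear (\<lambda>x. J j x + (t - T j) *\<^sub>R V j x)"
  using strict_derivative_linear[OF ext_strict(1)[OF flow_derivs[OF t]]] unfolding J_def V_def .

lemma bounded_linear_J: "bounded_linear (J j)"
proof -
  obtain t where t: "T j < t" "t < T (Suc j)" using dense[OF T_less] by blast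
  have "bounded_linear (\<lambda>x. (J j x + (t - T j) *\<^sub>R V j x) - (t - T j) *\<^sub>R V j x)"
    by (intro bounded_linear_sub linear_position[OF t] bounded_linear_const_scaleR bounded_linear_V)
  then show ?thesis by simp
qed

lemma norm_position:
  assumes "x \<bullet> n p = 0" "0 \<le> s"
  shows "norm x \<le> norm (J j x)" "norm x \<le> norm (J j x + s *\<^sub>R V j x)" "x \<noteq> 0 \<Longrightarrow> 0 < J j x \<bullet> V j x"
proof -
  note d = diverging_tangent[OF assms(1)]
  show 1: "norm x \<le> norm (J j x)" using jacobi_mono(2)[OF reg d, of j] by (simp add: J_def)
  have 2: "x \<bullet> N' x \<le> J j x \<bullet> V j x" using jacobi_step(4)[OF reg d, of j] by (simp add: J_def V_def)
  then show "x \<noteq> 0 \<Longrightarrow> 0 < J j x \<bullet> V j x" using convex[OF assms(1)] by simp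
  have "0 \<le> J j x \<bullet> V j x" using 2 d by (simp add: diverging_def)
  then show "norm x \<le> norm (J j x + s *\<^sub>R V j x)" using 1 norm_increasing[OF _ assms(2), of "J j x" "V j x"] by simp
qed

lemma front_curvature_eq:
  assumes t: "T j < t" "t < T (Suc j)" and x: "x \<bullet> n p = 0"
  shows "front_curvature Q X n p t (J j x + (t - T j) *\<^sub>R V j x) = V j x"
  unfolding front_curvature_def J_def V_def
proof (rule the_front_curvature[OF flow_derivs[OF t] _ x])
  fix x assume x: "x \<bullet> n p = 0" and "jacobi base j (x, N' x) + (t - T j) *\<^sub>R snd (orbit_der base j (x, N' x)) = 0"
  then show "x = 0" using norm_position(2)[OF x, of "t - T j" j] t by (simp add: J_def V_def)
qed

lemma eventually_free: "\<forall>\<^sub>F t in at_right (T j). T j < t \<and> t < T (Suc j)"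
  using T_less[of j] by (auto simp: eventually_at_right_field)

text \<open>For each \<open>t\<close> the direction is the image of some tangent vector \<open>y t\<close> of the initial front, because all these tangent
  spaces are hyperplanes. As displacements never get shorter, \<open>y t\<close> converges when the time decreases to the
  reflection time.\<close>

lemma curvature_after_eq:
  assumes u: "u \<bullet> n p = 0" "u \<noteq> 0"
  shows "curvature_after Q X n p j (sgn (J j u)) = V j u /\<^sub>R norm (J j u)"
proof -
  define x where "x = u /\<^sub>R norm (J j u)"
  define e where "e = sgn (J j u)"
  interpret J: bounded_linear "J j" by (rule bounded_linear_J)
  interpret V: bounded_linear "V j" by (rule bounded_linear_V)
  have xp: "x \<bullet> n p = 0" using u by (simp add: x_def)
  have Jx: "J j x = e" and Vx: "V j x = V j u /\<^sub>R norm (J j u)"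
    by (simp_all add: x_def J.scaleR V.scaleR e_def sgn_div_norm)
  let ?v = "snd ((billiard Q ^^ j) base)"
  have nz: "n p \<noteq> 0" "?v \<noteq> 0"
  proof -
    show "n p \<noteq> 0" using base_normal(2) by auto
    have "norm ?v = 1" using orbit_states(2)[OF reg, of j] base_normal(2) by simp
    then show "?v \<noteq> 0" by auto
  qed
  have perp: "J j y \<bullet> ?v = 0" "V j y \<bullet> ?v = 0" if "y \<bullet> n p = 0" for y
    using jacobi_step(1,2)[OF reg diverging_tangent[OF that]] by (simp_all add: J_def V_def)
  have ep: "e \<bullet> ?v = 0" using perp(1)[OF xp] Jx by simp
  define y where "y = (\<lambda>t. SOME y. y \<bullet> n p = 0 \<and> J j y + (t - T j) *\<^sub>R V j y = e)"
  have y: "y t \<bullet> n p = 0 \<and> J j (y t) + (t - T j) *\<^sub>R V j (y t) = e" if t: "T j < t" "t < T (Suc j)" for t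
    unfolding y_def
  proof (rule someI_ex, rule hyperplane_onto[OF _ nz _ _ ep])
    show "linear (\<lambda>y. J j y + (t - T j) *\<^sub>R V j y)" using linear_position[OF t] by (rule bounded_linear.linear)
    fix x assume x: "x \<bullet> n p = 0"
    show "(J j x + (t - T j) *\<^sub>R V j x) \<bullet> ?v = 0" using perp[OF x] by (simp add: inner_add_left)
    show "J j x + (t - T j) *\<^sub>R V j x = 0 \<Longrightarrow> x = 0" using norm_position(2)[OF x, of "t - T j" j] t by simp
  qed
  have ev: "\<forall>\<^sub>F t in at_right (T j). front_curvature Q X n p t e = V j (y t)"
    using eventually_free
  proof eventually_elim
    case (elim t)
    then show ?case using front_curvature_eq[of j t "y t"] y[of t] by simp
  qed
  have bound: "\<forall>\<^sub>F t in at_right (T j). norm (y t - x) \<le> (t - T j) * norm (V j x)"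
    using eventually_free
  proof eventually_elim
    case (elim t)
    have "norm (y t - x) \<le> norm (J j (y t - x) + (t - T j) *\<^sub>R V j (y t - x))"
      using y[of t] elim xp by (intro norm_position(2)) (auto simp: inner_diff_left)
    also have "J j (y t - x) + (t - T j) *\<^sub>R V j (y t - x) = (J j (y t) + (t - T j) *\<^sub>R V j (y t)) - (J j x + (t - T j) *\<^sub>R V j x)"
      by (simp add: J.diff V.diff algebra_simps)
    also have "\<dots> = - ((t - T j) *\<^sub>R V j x)" using y[of t] elim Jx by simp
    also have "norm \<dots> = (t - T j) * norm (V j x)" using elim by simp
    finally show ?case .
  qed
  have "((\<lambda>t. (t - T j) * norm (V j x)) \<longlongrightarrow> (T j - T j) * norm (V j x)) (at_right (T j))"
    by (intro tendsto_intros)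
  then have "((\<lambda>t. (t - T j) * norm (V j x)) \<longlongrightarrow> 0) (at_right (T j))" by simp
  from Lim_null_comparison[OF bound this] have "(y \<longlongrightarrow> x) (at_right (T j))" by (simp add: LIM_zero_iff)
  from V.tendsto[OF this] have "((\<lambda>t. front_curvature Q X n p t e) \<longlongrightarrow> V j x) (at_right (T j))"
    by (rule Lim_transform_eventually) (use ev in \<open>auto elim: eventually_mono\<close>)
  then have "Lim (at_right (T j)) (\<lambda>t. front_curvature Q X n p t e) = V j x"
    by (intro tendsto_Lim) auto
  then show ?thesis unfolding curvature_after_def with_normal_def e_def[symmetric] Vx[symmetric] .
qed

lemma curve_direction_eq:
  assumes q: "(q has_vector_derivative u) (at 0 within {0..a})" and a: "0 < a" and X: "q ` {0..a} \<subseteq> X" and q0: "q 0 = p"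
    and u: "u \<noteq> 0"
  shows "curve_direction Q n q a j 0 = sgn (J j u)"
proof -
  have up: "u \<bullet> n p = 0" by (rule tangent_curve[OF q a X q0])
  interpret J: bounded_linear "J j" by (rule bounded_linear_J)
  interpret V: bounded_linear "V j" by (rule bounded_linear_V)
  have vd: "vector_derivative (\<lambda>\<sigma>. fst (flow Q t (with_normal n (q \<sigma>)))) (at 0 within {0..a}) = J j u + (t - T j) *\<^sub>R V j u"
    if t: "T j < t" "t < T (Suc j)" for t
  proof (rule vector_derivative_within_closed_interval[OF a])
    have P: "((\<lambda>x. fst (flow Q t (x, n x))) has_derivative (\<lambda>x. J j x + (t - T j) *\<^sub>R V j x)) (at (q 0) within q ` {0..a})"
      unfolding q0 J_def V_def by (rule has_derivative_subset[OF position_derivative(1)[OF flow_derivs[OF t]] X])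
    from has_derivative_in_compose[OF q[unfolded has_vector_derivative_def] P]
    show "((\<lambda>\<sigma>. fst (flow Q t (with_normal n (q \<sigma>)))) has_vector_derivative J j u + (t - T j) *\<^sub>R V j u) (at 0 within {0..a})"
      unfolding has_vector_derivative_def with_normal_def by (simp add: J.scaleR V.scaleR scaleR_add_right mult.commute)
  qed (use a in auto)
  have Ju: "J j u \<noteq> 0" using norm_position(1)[OF up order_refl, of j] u by auto
  have "((\<lambda>t. sgn (J j u + (t - T j) *\<^sub>R V j u)) \<longlongrightarrow> sgn (J j u + (T j - T j) *\<^sub>R V j u)) (at_right (T j))"
    using Ju by (intro tendsto_intros) auto
  then have "((\<lambda>t. sgn (J j u + (t - T j) *\<^sub>R V j u)) \<longlongrightarrow> sgn (J j u)) (at_right (T j))" by simp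
  moreover have "\<forall>\<^sub>F t in at_right (T j). sgn (J j u + (t - T j) *\<^sub>R V j u) =
      sgn (vector_derivative (\<lambda>\<sigma>. fst (flow Q t (with_normal n (q \<sigma>)))) (at 0 within {0..a}))"
    using eventually_free by eventually_elim (use vd in simp)
  ultimately have "((\<lambda>t. sgn (vector_derivative (\<lambda>\<sigma>. fst (flow Q t (with_normal n (q \<sigma>)))) (at 0 within {0..a}))) \<longlongrightarrow> sgn (J j u)) (at_right (T j))"
    by (rule Lim_transform_eventually)
  then show ?thesis
    unfolding curve_direction_def q0 with_normal_def[of n p] by (intro tendsto_Lim) auto
qed

lemma refl_distance_eq: "q 0 = p \<Longrightarrow> refl_distance Q n q j 0 = flight_time Q ((billiard Q ^^ j) base)"
  using impact_sgn(2)[OF orbit_states(1)[OF reg] orbit_hits[OF reg], of j] orbit_states(2)[OF reg, of j] base_normal(2)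
  by (simp add: refl_distance_def with_normal_def billiard_impact dist_norm norm_minus_commute[of "impact _"])

text \<open>With \<open>h = V j u /\<^sub>R norm (J j u)\<close>, the right side of the equation that defines \<open>ell\<close> is the square of
  \<open>norm (J j u + d *\<^sub>R V j u) / norm (J j u)\<close>, and the numerator is the length of the displacement at the next impact.\<close>

lemma stretch_factor:
  assumes q: "(q has_vector_derivative u) (at 0 within {0..a})" and a: "0 < a" and X: "q ` {0..a} \<subseteq> X" and q0: "q 0 = p"
    and u: "u \<noteq> 0"
  shows "1 + refl_distance Q n q j 0 * ell Q X n q a j 0 = norm (J (Suc j) u) / norm (J j u)"
proof -
  have up: "u \<bullet> n p = 0" by (rule tangent_curve[OF q a X q0])
  define d where "d = refl_distance Q n q j 0"
  have d: "d = flight_time Q ((billiard Q ^^ j) base)" using refl_distance_eq[of q j] q0 by (simp add: d_def)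
  have d0: "d > 0" unfolding d by (rule flight_time_pos[OF orbit_states(1)[OF reg] orbit_hits[OF reg]])
  define r where "r = norm (J j u)"
  have r0: "r > 0" 
    using less_le_trans[of 0 "norm u", OF _ norm_position(1)[OF up order_refl, of j]] u by (simp add: r_def)
  have J1: "norm (J (Suc j) u) = norm (J j u + d *\<^sub>R V j u)"
    using jacobi_step(3)[OF reg diverging_tangent[OF up], of j] by (simp add: J_def V_def d)
  have pos: "0 < J j u \<bullet> V j u" using norm_position(3)[OF up order_refl u] .
  define R where "R = norm (J (Suc j) u) / r"
  have R2: "R^2 = 1 + 2 * d * ((V j u /\<^sub>R r) \<bullet> sgn (J j u)) + d^2 * (norm (V j u /\<^sub>R r))^2"
  proof -
    have jj: "J j u \<bullet> J j u = r^2" by (simp add: r_def dot_square_norm)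
    have "(norm (J (Suc j) u))^2 = r^2 + 2 * d * (V j u \<bullet> J j u) + d^2 * (norm (V j u))^2"
      unfolding J1 power2_norm_eq_inner
      by (simp add: inner_add_left inner_add_right jj inner_commute[of "J j u" "V j u"] power2_eq_square algebra_simps)
    then have "R^2 = (r^2 + 2 * d * (V j u \<bullet> J j u) + d^2 * (norm (V j u))^2) / r^2"
      by (simp add: R_def power_divide)
    also have "\<dots> = 1 + 2 * d * (V j u \<bullet> J j u) / r^2 + d^2 * (norm (V j u))^2 / r^2"
      using r0 by (simp add: add_divide_distrib)
    also have "2 * d * (V j u \<bullet> J j u) / r^2 = 2 * d * ((V j u /\<^sub>R r) \<bullet> sgn (J j u))"
      by (simp add: sgn_div_norm r_def[symmetric] power2_eq_square divide_inverse)
    also have "d^2 * (norm (V j u))^2 / r^2 = d^2 * (norm (V j u /\<^sub>R r))^2"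
      using r0 by (simp add: power_mult_distrib power_inverse divide_inverse)
    finally show ?thesis .
  qed
  have R1: "R > 1"
  proof -
    have "J j u \<bullet> J j u < (J j u + d *\<^sub>R V j u) \<bullet> (J j u + d *\<^sub>R V j u)"
      using pos d0 by (simp add: inner_add_left inner_add_right inner_commute add_pos_nonneg)
    then have "norm (J j u) < norm (J j u + d *\<^sub>R V j u)" by (simp add: norm_eq_sqrt_inner)
    then show ?thesis using r0 by (simp add: R_def J1 r_def)
  qed
  have "ell Q X n q a j 0 = (THE l. 0 < l \<and> (1 + d * l)^2 = R^2)"
    unfolding ell_def Let_def curve_direction_eq[OF q a X q0 u] q0 curvature_after_eq[OF up u] d_def[symmetric]
      r_def[symmetric] R2 ..
  also have "\<dots> = (R - 1) / d"
  proof (rule the_equality)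
    show "0 < (R - 1) / d \<and> (1 + d * ((R - 1) / d))^2 = R^2" using R1 d0 by simp
    fix l assume l: "0 < l \<and> (1 + d * l)^2 = R^2"
    have "1 + d * l = R"
    proof (rule power2_eq_imp_eq)
      show "(1 + d * l)\<^sup>2 = R\<^sup>2" using l by blast
      show "0 \<le> 1 + d * l" using l d0 by (simp add: less_imp_le add_nonneg_nonneg)
      show "0 \<le> R" using R1 by simp
    qed
    then have "d * l = R - 1" by simp
    then show "l = (R - 1) / d" using d0 nonzero_eq_divide_eq[of d l "R - 1"] by (simp add: mult.commute)
  qed
  finally show ?thesis using d0 by (simp add: d_def[symmetric] R_def r_def)
qed

lemma sum_stretch:
  assumes q: "(q has_vector_derivative u) (at 0 within {0..a})" and a: "0 < a" and X: "q ` {0..a} \<subseteq> X" and q0: "q 0 = p"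
    and u: "u \<noteq> 0"
  shows "(\<Sum>i=1..m. ln (1 + refl_distance Q n q i 0 * ell Q X n q a i 0)) = ln (norm (J (Suc m) u)) - ln (norm (J 1 u))"
proof -
  have up: "u \<bullet> n p = 0" by (rule tangent_curve[OF q a X q0])
  have "norm (J i u) > 0" for i
    using less_le_trans[of 0 "norm u", OF _ norm_position(1)[OF up order_refl, of i]] u by simp
  then have "(\<Sum>i=1..m. ln (1 + refl_distance Q n q i 0 * ell Q X n q a i 0)) =
     (\<Sum>i=1..m. ln (norm (J (Suc i) u)) - ln (norm (J i u)))"
    unfolding stretch_factor[OF assms] by (intro sum.cong refl ln_divide_pos)
  also have "\<dots> = ln (norm (J (Suc m) u)) - ln (norm (J 1 u))"
    by (induction m) auto
  finally show ?thesis .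
qed

lemma normal_derivative_within: "(n has_derivative N') (at p within X)"
proof -
  have A: "strict_derivative (\<lambda>y. fst (id y)) fst (p, n p) UNIV"
    and B: "strict_derivative (\<lambda>y. snd (id y)) snd (p, n p) UNIV"
    by (simp_all add: strict_derivative_bounded_linear bounded_linear_fst bounded_linear_snd)
  from position_derivative(2)[OF A B] show ?thesis by simp
qed

end


section \<open>Lyapunov exponent\<close>

text \<open>Two sequences that dominate each other up to a constant and a shift of the index have the same
  exponential growth rate.\<close>

lemma interlaced_growth_rate:
  fixes D E :: "nat \<Rightarrow> real"
  assumes lim: "(\<lambda>m. ln (D m) / real m) \<longlonglongrightarrow> l" and pos: "\<And>m. 0 < E m" and C: "0 < C"
    and le: "\<And>m. E (Suc m) \<le> D (Suc m)" and ge: "\<And>m. D (Suc m) \<le> C * E (Suc (Suc m))"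
  shows "(\<lambda>m. (ln (E (Suc m)) - ln (E 1)) / real m) \<longlonglongrightarrow> l"
proof (rule tendsto_sandwich)
  have i: "(\<lambda>m. c / real m) \<longlonglongrightarrow> 0" for c :: real by (rule lim_const_over_n)
  have "(\<lambda>m. ln (D m) / real m - (ln C + ln (E 1)) / real m) \<longlonglongrightarrow> l - 0" by (intro tendsto_diff lim i)
  then show "(\<lambda>m. ln (D m) / real m - (ln C + ln (E 1)) / real m) \<longlonglongrightarrow> l" by simp
  have s: "(\<lambda>m. 1 + 1 / real m) \<longlonglongrightarrow> 1 + 0" by (intro tendsto_add tendsto_const i)
  have "(\<lambda>m. (ln (D (Suc m)) / real (Suc m)) * (1 + 1 / real m) - ln (E 1) / real m) \<longlonglongrightarrow> l * (1 + 0) - 0"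
    by (intro tendsto_diff tendsto_mult s i LIMSEQ_Suc[OF lim])
  then show "(\<lambda>m. (ln (D (Suc m)) / real (Suc m)) * (1 + 1 / real m) - ln (E 1) / real m) \<longlonglongrightarrow> l" by simp
  show "\<forall>\<^sub>F m in sequentially. ln (D m) / real m - (ln C + ln (E 1)) / real m \<le> (ln (E (Suc m)) - ln (E 1)) / real m"
    using eventually_gt_at_top[of 0]
  proof eventually_elim
    case (elim m)
    then obtain k where k: "m = Suc k" using gr0_implies_Suc by blast
    have "0 < D m" using le[of k] pos[of "Suc k"] k by simp
    then have "ln (D m) \<le> ln (C * E (Suc m))" using ge[of k] C pos by (simp add: k)
    also have "\<dots> = ln C + ln (E (Suc m))" using C pos[of "Suc m"] by (simp add: ln_mult)
    finally have "ln (D m) - (ln C + ln (E 1)) \<le> ln (E (Suc m)) - ln (E 1)" by simp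
    then show ?case unfolding diff_divide_distrib[symmetric] by (rule divide_right_mono) simp
  qed
  show "\<forall>\<^sub>F m in sequentially. (ln (E (Suc m)) - ln (E 1)) / real m \<le> (ln (D (Suc m)) / real (Suc m)) * (1 + 1 / real m) - ln (E 1) / real m"
    using eventually_gt_at_top[of 0]
  proof eventually_elim
    case (elim m)
    have "1 + 1 / real m = real (Suc m) / real m" using elim by (simp add: field_simps)
    then have "(ln (D (Suc m)) / real (Suc m)) * (1 + 1 / real m) - ln (E 1) / real m = (ln (D (Suc m)) - ln (E 1)) / real m"
      by (simp add: diff_divide_distrib del: of_nat_Suc)
    moreover have "ln (E (Suc m)) \<le> ln (D (Suc m))" using le[of m] pos[of "Suc m"] by simp
    then have "(ln (E (Suc m)) - ln (E 1)) / real m \<le> (ln (D (Suc m)) - ln (E 1)) / real m"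
      by (intro divide_right_mono) auto
    ultimately show ?case by simp
  qed
qed

context billiard_table
begin

lemma unstable_front_billiard_front:
  assumes x: "x \<in> M0 Q" and r: "0 < r" "r < flight_time Q x" and \<epsilon>: "0 < \<epsilon>"
    and uf: "unstable_front Q \<epsilon> r x X n"
  shows "\<exists>Z W U f g N'. billiard_front K z Z X W U n (fst x + r *\<^sub>R snd x) f g N'" "n (fst x + r *\<^sub>R snd x) = snd x"
proof -
  define p where "p = fst x + r *\<^sub>R snd x"
  note m = M0_regular_orbit[OF x]
  have xs: "x \<in> states" "hit_times Q x \<noteq> {}" using orbit_states(1)[OF m(1), of 0] orbit_hits[OF m(1), of 0] by auto
  have adv: "advance r x = (p, snd x)" by (simp add: advance_def p_def)
  from uf obtain Z W where L: "local_unstable_flow Q \<epsilon> (p, snd x) = with_normal n ` X"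
    and Z: "oriented_hypersurface Z n" "strictly_convex_hypersurface Z n" "X \<subseteq> Z" "open W" "p \<in> Z \<inter> W" "Z \<inter> W \<subseteq> X"
    unfolding unstable_front_def Let_def p_def by blast
  have "(p, snd x) \<in> with_normal n ` X" using base_in_local_unstable[OF x r \<epsilon>] unfolding adv L .
  then have n: "n p = snd x" by (auto simp: with_normal_def)
  then show "n (fst x + r *\<^sub>R snd x) = snd x" unfolding p_def .
  have pZ: "p \<in> Z" using Z by blast
  from Z(1) pZ obtain f g U where f: "p \<in> U" "submersion_on f g U" "Z \<inter> U = {x\<in>U. f x = 0}" "\<forall>x\<in>Z \<inter> U. n x = sgn (g x)"
    unfolding oriented_hypersurface_def by meson
  obtain g' where g': "strict_derivative g g' p UNIV" using submersion_onD(5)[OF f(2,1)] by blast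
  obtain N' where N': "strict_derivative (\<lambda>x. sgn (g x)) N' p UNIV"
    using strict_derivative_sgn[OF g' _ submersion_onD(3)[OF f(2,1)]] by auto
  interpret F: front Z X W U n p f g N'
    by unfold_locales (use Z f N' pZ in auto)
  from Z(2) pZ obtain S where S: "curvature_operator (with_normal n ` Z) p S" "\<And>u. u \<noteq> 0 \<Longrightarrow> u \<bullet> n p = 0 \<Longrightarrow> S u \<bullet> u > 0"
    unfolding strictly_convex_hypersurface_def by meson
  have "billiard_front K z Z X W U n p f g N'"
  proof
    show "(p, n p) \<in> exterior" using advance_free_path(1)[OF xs r] by (simp add: adv n)
    show "regular_orbit (p, n p)" using advance_regular_orbit[OF m(1) r] by (simp add: adv n)
    show "0 < x \<bullet> N' x" if "x \<bullet> n p = 0" "x \<noteq> 0" for x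
      using S(2)[OF that(2,1)] F.curvature_operator_hypersurface[OF S(1) that(1)] by (simp add: inner_commute)
  qed
  then show "\<exists>Z W U f g N'. billiard_front K z Z X W U n (fst x + r *\<^sub>R snd x) f g N'" unfolding p_def by blast
qed

end

text \<open>The vector \<open>w\<close> is the velocity of the curve of the foot points of \<open>q\<close>, which are boundary states; so the
  derivative within the set of boundary states is determined on \<open>w\<close>. A state and its foot point have the same
  further orbit, so the value can be computed from the front.\<close>

lemma (in billiard_front) billiard_deriv_orbit_der:
  assumes x: "x \<in> M0 Q" and r: "0 < r" "r < flight_time Q x" and p_eq: "p = fst x + r *\<^sub>R snd x" and np: "n p = snd x"
    and q: "(q has_vector_derivative u) (at 0 within {0..a})" and a: "0 < a" and X: "q ` {0..a} \<subseteq> X" and q0: "q 0 = p"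
    and w: "corresponds Q X n p u w"
  shows "billiard_deriv Q (Suc m) x w = orbit_der base (Suc m) (u, N' u)"
proof -
  note mx = M0_regular_orbit[OF x]
  have hx: "hit_times Q x \<noteq> {}" using orbit_hits[OF mx(1), of 0] by simp
  have adv: "base = advance r x" by (simp only: advance_def p_eq[symmetric] np)
  note b = backward_flight[OF mx(2) hx r]
  define c where "c = (\<lambda>s. foot Q (q s, n (q s)))"
  have c0: "c 0 = x" using b(3) by (simp add: c_def q0 adv)
  from w obtain D where D: "((\<lambda>p'. foot Q (with_normal n p')) has_derivative D) (at p within X)" "w = D u"
    unfolding corresponds_def by blast
  interpret D: bounded_linear D using D(1) by (rule has_derivative_bounded_linear)
  have D': "((\<lambda>p'. foot Q (p', n p')) has_derivative D) (at (q 0) within q ` {0..a})"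
    using has_derivative_subset[OF D(1) X] by (simp add: q0 with_normal_def)
  have cd: "(c has_derivative (\<lambda>h. h *\<^sub>R w)) (at 0 within {0..a})"
    using has_derivative_in_compose[OF q[unfolded has_vector_derivative_def] D'] by (simp add: c_def D.scaleR D(2))
  have lift: "((\<lambda>x. (x, n x)) has_derivative (\<lambda>x. (x, N' x))) (at (q 0) within q ` {0..a})"
    unfolding q0 by (intro has_derivative_Pair has_derivative_ident has_derivative_subset[OF normal_derivative_within X])
  define y where "y = (\<lambda>s. (q s, n (q s)))"
  have y0: "y 0 = base" by (simp add: y_def q0)
  interpret N': bounded_linear N' using has_derivative_bounded_linear[OF normal_derivative_within] .
  have yd: "(y has_derivative (\<lambda>h. (h *\<^sub>R u, N' (h *\<^sub>R u)))) (at 0 within {0..a})"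
    using has_derivative_in_compose[OF q[unfolded has_vector_derivative_def] lift] by (simp add: y_def)
  have "(y \<longlongrightarrow> base) (at 0 within {0..a})"
    using has_derivative_continuous[OF yd] by (simp add: continuous_within y0)
  moreover have "\<forall>\<^sub>F y in nhds base. y \<in> exterior \<and> hit_times Q y \<noteq> {} \<and> hit_times Q (fst y, - snd y) \<noteq> {}"
  proof -
    have e1: "\<forall>\<^sub>F y in nhds base. hit_times Q y \<noteq> {}"
      using eventually_hits[OF compatible_exterior[OF ext]] orbit_transversal[OF reg, of 0]
      by (simp add: near_open[OF open_exterior ext] eventually_mono)
    have be: "(p, - n p) \<in> exterior" using backward_exterior[OF ext] by simp
    have bt: "transversal (p, - n p)"
    proof -
      have bb: "(p, - n p) = (fst (advance r x), - snd x)" by (simp only: advance_def p_eq[symmetric] np fst_conv)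
      have "impact (p, - n p) = fst x" unfolding bb impact_def b(2) by (simp add: advance_def)
      then show ?thesis using b(1) mx(4) unfolding transversal_def bb by simp
    qed
    have e2: "\<forall>\<^sub>F y in nhds (p, - n p). hit_times Q y \<noteq> {}"
      using eventually_hits[OF compatible_exterior[OF be] bt]
      by (simp add: near_open[OF open_exterior be] eventually_mono)
    have "((\<lambda>y. (fst y, - snd y)) \<longlongrightarrow> (fst base, - snd base)) (nhds base)"
      by (intro tendsto_intros filterlim_ident)
    from eventually_compose_filterlim[OF e2, of "\<lambda>y. (fst y, - snd y)" "nhds base"] this
    have e3: "\<forall>\<^sub>F y in nhds base. hit_times Q (fst y, - snd y) \<noteq> {}" by simp
    show ?thesis using e1 e3 eventually_nhds_in_open[OF open_exterior ext] by eventually_elim simp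
  qed
  ultimately have "\<forall>\<^sub>F s in at 0 within {0..a}. y s \<in> exterior \<and> hit_times Q (y s) \<noteq> {} \<and> hit_times Q (fst (y s), - snd (y s)) \<noteq> {}"
    by (rule eventually_compose_filterlim[rotated])
  moreover have "\<forall>\<^sub>F s in at 0 within {0..a}. q s \<in> U"
  proof -
    have "(q \<longlongrightarrow> p) (at 0 within {0..a})"
      using has_derivative_continuous[OF q[unfolded has_vector_derivative_def]] by (simp add: continuous_within q0)
    from topological_tendstoD[OF this submersion_onD(1)[OF sub p(1)] p(1)] show ?thesis .
  qed
  ultimately have "\<forall>\<^sub>F s in at 0 within {0..a}. s \<in> {0..a} \<longrightarrow> c s \<in> boundary_states Q \<and> billiard Q (c s) = billiard Q (y s)"
  proof eventually_elim
    case (elim s)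
    show ?case
    proof
      assume s: "s \<in> {0..a}"
      note fp = foot_properties[of "y s"]
      have o: "c s \<in> outgoing" "billiard Q (c s) = billiard Q (y s)"
        using fp elim by (simp_all add: c_def y_def)
      have "q s \<in> X" using s X by blast
      then have "q s \<in> Z \<inter> U" using W(3) elim by blast
      then have "norm (n (q s)) = 1" using n[of "q s"] submersion_onD(3)[OF sub, of "q s"] by (simp add: norm_sgn)
      then have "norm (snd (c s)) = 1" by (simp add: c_def foot_def)
      then show "c s \<in> boundary_states Q \<and> billiard Q (c s) = billiard Q (y s)"
        using o frontier_subset_closed[OF closed_obstacles]
        by (cases "c s") (auto simp: outgoing_def states_def boundary_states_def)
    qed
  qed
  then obtain S where S: "open S" "0 \<in> S"
    "\<And>s. s \<in> S \<Longrightarrow> s \<noteq> 0 \<Longrightarrow> s \<in> {0..a} \<Longrightarrow> c s \<in> boundary_states Q \<and> billiard Q (c s) = billiard Q (y s)"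
    unfolding eventually_at_topological by blast
  define T where "T = {0..a} \<inter> S"
  have xb: "x \<in> boundary_states Q" using x by (simp add: M0_def)
  have xs: "x \<in> states" using mx(2) outgoing_states by blast
  have good: "c s \<in> boundary_states Q \<and> billiard Q (c s) = billiard Q (y s)" if "s \<in> T" for s
  proof (cases "s = 0")
    case True
    then show ?thesis using c0 xb advance_free_path(4)[OF xs hx r] by (simp add: y0 adv)
  next
    case False
    then show ?thesis using S(3) that by (simp add: T_def)
  qed
  have "(billiard Q ^^ Suc m has_derivative orbit_der x (Suc m)) (at x within outgoing)"
    by (rule strict_derivative_imp_has_derivative[OF orbit_strict_derivative(1)[OF compatible_outgoing[OF mx(2)] mx(1)] mx(2)])
  then have "(billiard Q ^^ Suc m has_derivative orbit_der x (Suc m)) (at x within boundary_states Q)"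
    by (rule has_derivative_subset[OF _ boundary_states_outgoing])
  then have "billiard Q ^^ Suc m differentiable (at x within boundary_states Q)" by (rule differentiableI)
  then have F: "(billiard Q ^^ Suc m has_derivative (\<lambda>w. billiard_deriv Q (Suc m) x w)) (at x within boundary_states Q)"
    unfolding billiard_deriv_def by (simp only: frechet_derivative_works)
  have FT: "(billiard Q ^^ Suc m has_derivative (\<lambda>w. billiard_deriv Q (Suc m) x w)) (at (c 0) within c ` T)"
    unfolding c0 by (rule has_derivative_subset[OF F]) (use good in auto)
  have 1: "((\<lambda>s. (billiard Q ^^ Suc m) (c s)) has_derivative (\<lambda>h. billiard_deriv Q (Suc m) x (h *\<^sub>R w))) (at 0 within T)"
    by (rule has_derivative_in_compose[OF has_derivative_subset[OF cd] FT]) (simp add: T_def)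
  have "(billiard Q ^^ Suc m has_derivative orbit_der base (Suc m)) (at base within exterior)"
    by (rule strict_derivative_imp_has_derivative[OF orbit_strict_derivative(1)[OF compatible_exterior[OF ext] reg] ext])
  then have "(billiard Q ^^ Suc m has_derivative orbit_der base (Suc m)) (at (y 0))"
    using at_within_open[OF ext open_exterior] by (simp add: y0)
  from has_derivative_compose[OF has_derivative_subset[OF yd] this]
  have 2: "((\<lambda>s. (billiard Q ^^ Suc m) (y s)) has_derivative (\<lambda>h. orbit_der base (Suc m) (h *\<^sub>R u, N' (h *\<^sub>R u)))) (at 0 within T)"
    by (simp add: T_def)
  have eq: "(billiard Q ^^ Suc m) (c s) = (billiard Q ^^ Suc m) (y s)" if "s \<in> T" for s
    using good[OF that] by (simp only: orbit_Suc)
  have "0 \<in> T" using S a by (simp add: T_def)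
  have "contingent T 0 1" unfolding T_def by (rule contingent_open_Int[OF contingent_interval[OF a] S(1,2)])
  from contingent_unique[OF 1 2 eq eq[OF \<open>0 \<in> T\<close>] this] show ?thesis by simp
qed

text \<open>The length of the displacement and the norm of the derivative of the billiard map satisfy the hypotheses of
  \<open>interlaced_growth_rate\<close>.\<close>

lemma (in billiard_table) lyapunov_exponent_unstable_front:
  assumes x: "x \<in> M0 Q" and r: "0 < r" "r < flight_time Q x" and \<epsilon>: "0 < \<epsilon>"
    and uf: "unstable_front Q \<epsilon> r x X n"
    and a: "0 < a" and q: "q differentiable (at 0 within {0..a})" and X: "q ` {0..a} \<subseteq> X" and q0: "q 0 = fst x + r *\<^sub>R snd x"
    and w: "corresponds Q X n (q 0) (vector_derivative q (at 0 within {0..a})) w" "w \<noteq> 0"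
    and lim: "(\<lambda>m. ln (norm (billiard_deriv Q m x w)) / real m) \<longlonglongrightarrow> l"
  shows "(\<lambda>m. (\<Sum>i=1..m. ln (1 + refl_distance Q n q i 0 * ell Q X n q a i 0)) / real m) \<longlonglongrightarrow> l"
proof -
  define p where "p = fst x + r *\<^sub>R snd x"
  define u where "u = vector_derivative q (at 0 within {0..a})"
  have qd: "(q has_vector_derivative u) (at 0 within {0..a})"
    using q unfolding u_def by (simp only: vector_derivative_works)
  from unstable_front_billiard_front[OF x r \<epsilon> uf] obtain Z W U f g N' where
    F: "billiard_front K z Z X W U n (fst x + r *\<^sub>R snd x) f g N'" and np: "n (fst x + r *\<^sub>R snd x) = snd x" by blast
  interpret F: billiard_front K z Z X W U n p f g N' using F unfolding p_def .
  have q0: "q 0 = p" using q0 unfolding p_def .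
  have np: "n p = snd x" using np unfolding p_def .
  have w': "corresponds Q X n p u w" using w(1) by (simp add: q0 u_def)
  have u: "u \<noteq> 0"
  proof
    assume "u = 0"
    with w' show False using w(2) unfolding corresponds_def
      using has_derivative_bounded_linear bounded_linear.linear linear_0 by metis
  qed
  have up: "u \<bullet> n p = 0" by (rule F.tangent_curve[OF qd a X q0])
  note div = F.diverging_tangent[OF up]
  note mx = M0_regular_orbit[OF x]
  have xs: "x \<in> states" "hit_times Q x \<noteq> {}" using orbit_states(1)[OF mx(1), of 0] orbit_hits[OF mx(1), of 0] by auto
  have base: "(p, n p) = advance r x" by (simp only: advance_def p_def[symmetric] np)
  obtain c d where c: "c > 0" "d > 0" and "orbit_bounds c d" using uniform_bounds by blast
  note cd = this(3)[unfolded orbit_bounds_def]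
  define D where "D = (\<lambda>m. norm (billiard_deriv Q m x w))"
  define E where "E = (\<lambda>m. norm (F.J m u))"
  have D: "D (Suc m) = norm (orbit_der (p, n p) (Suc m) (u, N' u))" for m
    unfolding D_def using F.billiard_deriv_orbit_der[OF x r p_def np qd a X q0 w', of m] by simp
  have "(\<lambda>m. (ln (E (Suc m)) - ln (E 1)) / real m) \<longlonglongrightarrow> l"
  proof (rule interlaced_growth_rate)
    show "(\<lambda>m. ln (D m) / real m) \<longlonglongrightarrow> l" unfolding D_def by (rule lim)
    show "0 < 1 + 1 / c + 2 / d" using c by (simp add: add_pos_pos)
    fix m
    show "0 < E m" unfolding E_def
      using less_le_trans[of 0 "norm u", OF _ F.norm_position(1)[OF up order_refl, of m]] u by simp
    show "E (Suc m) \<le> D (Suc m)"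
      unfolding E_def D F.J_def by (rule jacobi_le_orbit_der[OF F.reg div])
    have o: "(billiard Q ^^ m) x \<in> outgoing"
      using mx(2) orbit_states(3)[OF mx(1), of "m - 1"] by (cases m) auto
    have n1: "norm (snd ((billiard Q ^^ m) x)) = 1" for m using orbit_states(2)[OF mx(1), of m] mx(3) by simp
    have S: "(billiard Q ^^ Suc m) (p, n p) = (billiard Q ^^ Suc m) x" for m
      unfolding base by (rule advance_orbit[OF xs r])
    have im: "impact ((billiard Q ^^ m) (p, n p)) = impact ((billiard Q ^^ m) x)"
      using S[of m] by (simp add: billiard_impact)
    show "D (Suc m) \<le> (1 + 1 / c + 2 / d) * E (Suc (Suc m))"
      unfolding E_def D F.J_def
    proof (rule orbit_der_le_jacobi[OF F.reg div])
      show "norm (snd (p, n p)) = 1" using np mx(3) by simp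
      show "0 < d" "0 < c" using c by auto
      show "d \<le> flight_time Q ((billiard Q ^^ Suc m) (p, n p))"
        unfolding S using cd[rule_format, OF orbit_states(3)[OF mx(1), of m] n1 orbit_hits[OF mx(1)]] by blast
      show "c \<le> snd ((billiard Q ^^ Suc m) (p, n p)) \<bullet> \<nu> (impact ((billiard Q ^^ m) (p, n p)))"
        unfolding S im using cd[rule_format, OF o n1 orbit_hits[OF mx(1)]] orbit_hits[OF mx(1), of "Suc m"] by simp
    qed
  qed
  then show ?thesis unfolding F.sum_stretch[OF qd a X q0 u] E_def by simp
qed

theorem mainTheorem3:
  fixes K :: "nat \<Rightarrow> 'a::euclidean_space set" and z k :: nat
    and \<mu> :: "(int \<Rightarrow> nat) measure" and lam :: "nat \<Rightarrow> real"
    and E :: "nat \<Rightarrow> 'a \<times> 'a \<Rightarrow> ('a \<times> 'a) set"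
  assumes "DIM('a) \<ge> 3"
    and "open_billiard K z"
    and "ergodic_shift_measure z \<mu>"
    and "oseledets_splitting K z \<mu> k lam E"
  shows "AE \<xi> in \<mu>. \<forall>x0\<in>M0 (obstacles K z). coding K z x0 = \<xi> \<longrightarrow>
    (\<exists>r0>0. \<forall>r\<in>{0<..<r0}. \<exists>\<epsilon>0>0. \<forall>\<epsilon>\<in>{0<..<\<epsilon>0}. \<forall>X n q a w.
       unstable_front (obstacles K z) \<epsilon> r x0 X n \<and>
       0 < a \<and> Ck_curve 3 {0..a} q \<and> q ` {0..a} \<subseteq> X \<and> q 0 = fst x0 + r *\<^sub>R snd x0 \<and>
       corresponds (obstacles K z) X n (q 0) (vector_derivative q (at 0 within {0..a})) w \<and>
       w \<in> unstable_space (obstacles K z) x0 - span (\<Union>j\<in>{2..k}. E j x0) \<longrightarrow>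
       (\<lambda>m. (\<Sum>i=1..m. ln (1 + refl_distance (obstacles K z) n q i 0 *
                              ell (obstacles K z) X n q a i 0)) / real m) \<longlonglongrightarrow> lam 1)"
proof -
  interpret billiard_table K z by unfold_locales (rule assms(2))
  have k: "1 \<in> {1..k}" using assms(4) by (simp add: oseledets_splitting_def)
  have "AE \<xi> in \<mu>. \<forall>x\<in>M0 Q. coding K z x = \<xi> \<longrightarrow>
        unstable_space Q x = span (\<Union>i\<in>{1..k}. E i x) \<and>
        (\<forall>w \<in> span (\<Union>i\<in>{1..k}. E i x) - span (\<Union>i\<in>{2..k}. E i x).
           (\<lambda>m. ln (norm (billiard_deriv Q m x w)) / real m) \<longlonglongrightarrow> lam 1)"
    using assms(4)[unfolded oseledets_splitting_def, THEN conjunct2, THEN conjunct2, THEN conjunct2]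
  proof eventually_elim
    case (elim \<xi>)
    show ?case
    proof (intro ballI impI)
      fix x assume "x \<in> M0 Q" "coding K z x = \<xi>"
      from elim[rule_format, OF this] have a: "unstable_space Q x = span (\<Union>i\<in>{1..k}. E i x)"
        and b: "\<forall>j\<in>{1..k}. \<forall>w \<in> span (\<Union>i\<in>{j..k}. E i x) - span (\<Union>i\<in>{j+1..k}. E i x).
           (\<lambda>m. ln (norm (billiard_deriv Q m x w)) / real m) \<longlonglongrightarrow> lam j" by blast+
      show "unstable_space Q x = span (\<Union>i\<in>{1..k}. E i x) \<and>
        (\<forall>w \<in> span (\<Union>i\<in>{1..k}. E i x) - span (\<Union>i\<in>{2..k}. E i x).
           (\<lambda>m. ln (norm (billiard_deriv Q m x w)) / real m) \<longlonglongrightarrow> lam 1)"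
        using a bspec[OF b k] by (simp only: one_add_one simp_thms)
    qed
  qed
  then show ?thesis
  proof eventually_elim
    case (elim \<xi>)
    show ?case
    proof (intro ballI impI)
      fix x0 assume x0: "x0 \<in> M0 Q" and "coding K z x0 = \<xi>"
      from elim[rule_format, OF this] have us: "unstable_space Q x0 = span (\<Union>i\<in>{1..k}. E i x0)"
        and lim: "\<And>w. w \<in> span (\<Union>i\<in>{1..k}. E i x0) - span (\<Union>i\<in>{2..k}. E i x0) \<Longrightarrow>
           (\<lambda>m. ln (norm (billiard_deriv Q m x0 w)) / real m) \<longlonglongrightarrow> lam 1" by blast+
      note mx = M0_regular_orbit[OF x0]
      have fl: "0 < flight_time Q x0"
        using flight_time_pos[of x0] orbit_states(1)[OF mx(1), of 0] orbit_hits[OF mx(1), of 0] by simp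
      show "\<exists>r0>0. \<forall>r\<in>{0<..<r0}. \<exists>\<epsilon>0>0. \<forall>\<epsilon>\<in>{0<..<\<epsilon>0}. \<forall>X n q a w.
         unstable_front Q \<epsilon> r x0 X n \<and>
         0 < a \<and> Ck_curve 3 {0..a} q \<and> q ` {0..a} \<subseteq> X \<and> q 0 = fst x0 + r *\<^sub>R snd x0 \<and>
         corresponds Q X n (q 0) (vector_derivative q (at 0 within {0..a})) w \<and>
         w \<in> unstable_space Q x0 - span (\<Union>j\<in>{2..k}. E j x0) \<longrightarrow>
         (\<lambda>m. (\<Sum>i=1..m. ln (1 + refl_distance Q n q i 0 * ell Q X n q a i 0)) / real m) \<longlonglongrightarrow> lam 1"
        \<comment> \<open>below the first flight time the base point lies on the free path before the first impact\<close>
      proof (rule exI[of _ "flight_time Q x0"], intro conjI ballI fl, rule exI[of _ 1],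
          intro conjI ballI allI impI zero_less_one)
        fix r \<epsilon> :: real and X n q a w
        assume r: "r \<in> {0<..<flight_time Q x0}" and e: "\<epsilon> \<in> {0<..<1}" and h: "unstable_front Q \<epsilon> r x0 X n \<and>
         0 < a \<and> Ck_curve 3 {0..a} q \<and> q ` {0..a} \<subseteq> X \<and> q 0 = fst x0 + r *\<^sub>R snd x0 \<and>
         corresponds Q X n (q 0) (vector_derivative q (at 0 within {0..a})) w \<and>
         w \<in> unstable_space Q x0 - span (\<Union>j\<in>{2..k}. E j x0)"
        have "Ck_curve (Suc 2) {0..a} q" using h by (simp add: numeral_3_eq_3 numeral_2_eq_2)
        then have "\<forall>s\<in>{0..a}. q differentiable (at s within {0..a})" unfolding Ck_curve.simps by (rule conjunct1)
        moreover have "0 \<in> {0..a}" using h by simp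
        ultimately have qd: "q differentiable (at 0 within {0..a})" by blast
        have "w \<noteq> 0" using h span_0 by auto
        then show "(\<lambda>m. (\<Sum>i=1..m. ln (1 + refl_distance Q n q i 0 * ell Q X n q a i 0)) / real m) \<longlonglongrightarrow> lam 1"
          using r e h us
          by (intro lyapunov_exponent_unstable_front[where \<epsilon> = \<epsilon>, OF x0 _ _ _ _ _ qd _ _ _ _ lim]) auto
      qed
    qed
  qed
qed

end
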